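(* Let $\Gamma$ be a network, $\mathcal H=\{H_\gamma\}_{\gamma\in\mathcal E}$ a Hamiltonian on $\Gamma$, $c_x$ a flux limiter and $L$ the corresponding overall Lagrangian, all as in the context. Let $\{\xi_n\}_{n\in\mathbb N}$ be a sequence of curves $\xi_n:[t_1,t_2]\to\Gamma$ (with $[t_1,t_2]\subset\mathbb R^+$), uniformly converging to a curve $\zeta:[t_1,t_2]\to\Gamma$ and such that $\{\dot\xi_n\}$ weakly converges to $\dot\zeta$ in $L^2$. Then $$\liminf_{n\to\infty}\int_{t_1}^{t_2}L(\xi_n,\dot\xi_n,\tau)\,d\tau\ \ge\ \int_{t_1}^{t_2}L(\zeta,\dot\zeta,\tau)\,d\tau.$$
   Context: Conventions: $\mathbb R^+=[0,\infty)$; "curve" means absolutely continuous curve; $L^2$ is $L^2([t_1,t_2];\mathbb R^N)$. Network. $\mathcal E$ is a finite or countable collection of arcs: regular ($C^1$ with non-vanishing derivative, including one-sided derivatives at the endpoints) simple oriented curves $\gamma:[0,|\gamma|]\to\mathbb R^N$ parametrized by arc length, $|\gamma|$ being the Euclidean length; loops ($\gamma(0)=\gamma(|\gamma|)$) are allowed. With each $\gamma$, $\mathcal E$ also contains the inverse arc $\tilde\gamma(s)=\gamma(|\gamma|-s)$. It is assumed that $\gamma((0,|\gamma|))\cap\gamma'([0,|\gamma'|])=\emptyset$ whenever $\gamma'\neq\gamma,\tilde\gamma$. $\Gamma=\bigcup_{\gamma\in\mathcal E}\gamma([0,|\gamma|])$. Vertices are the endpoints of arcs; $\mathbf V$ is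 the set of vertices (no interior point of an arc is a vertex). Any two vertices are linked by a finite concatenation of arcs. $\mathcal E_x=\{\gamma\in\mathcal E:\gamma(0)=x\}$ for $x\in\mathbf V$; it is finite for every $x\in\mathbf V$; and $\inf_{\gamma}|\gamma|>0$. $d_\Gamma$ is the geodesic distance on $\Gamma$; continuity and uniform convergence in $\Gamma$ refer to $d_\Gamma$. Tangent spaces: if $x=\gamma(s)$, $s\in(0,|\gamma|)$, then $T_x\Gamma=\mathbb R\dot\gamma(s)$; if $x\in\mathbf V$, $T_x\Gamma$ is the convex hull of $\{\lambda\dot\gamma(0):\lambda\in\mathbb R,\gamma\in\mathcal E_x\}$; $T\Gamma$ is the disjoint union of the $T_x\Gamma$. Hamiltonian. For each $\gamma\in\mathcal E$, $H_\gamma:[0,|\gamma|]\times\mathbb R^+\times\mathbb R\to\mathbb R$, with $H_{\tilde\gamma}(s,t,\mu)=H_\gamma(|\gamma|-s,t,-\mu)$, such that: (1) $H_\gamma$ is continuous; (2) $H_\gamma$ is convex in $\mu$; (3) for every $T>0$ there are nondecreasing, convex, superlinearly coercive $\vartheta_T,\Theta_T:\mathbb R^+\to\mathbb R$ with $\vartheta_T(|\mu|)\le H_\gamma(s,t,\mu)\le\Theta_T(|\mu|)$ for all $\gamma\in\mathcal E$, $s\in[0,|\gamma|]$, $\mu\in\mathbb R$, $t\in[0,T]$; (4) for every $T>0$ there are $\alpha_T,\beta_T\ge0$, $\epsilon_T\in(0,T]$ such that for all $\gamma,s,\mu$, $H_\gamma(s,t_1,\mu)-H_\gamma(s,t_2,\mu)\le\big(\alpha_T\frac{H_\gamma(s,t_2,\mu)}{1+|\mu|}+\beta_T\big)|t_2-t_1|$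 whenever $t_1,t_2\in[0,T]$, $|t_2-t_1|<\epsilon_T$. Put $L_\gamma(s,\lambda,t)=\max_{\mu\in\mathbb R}\{\lambda\mu-H_\gamma(s,t,\mu)\}$. Flux limiter. A map $(x,t)\mapsto c_x(t)$ from $\mathbf V\times\mathbb R^+$ to $\mathbb R$, continuous in $t$, with $c_x(t)\le\min_{\gamma\in\mathcal E_x}L_\gamma(0,0,t)$ for all $(x,t)$, and such that for each $T>0$: there is $C_T$ with $|c_x(t)|\le C_T$ for all $x\in\mathbf V$, $t\in[0,T]$; and there are $\hat\beta_T\ge0$, $\hat\epsilon_T\in(0,T]$ with $c_x(t_1)-c_x(t_2)\le\hat\beta_T|t_2-t_1|$ for all $x\in\mathbf V$, $t_1,t_2\in[0,T]$, $|t_2-t_1|<\hat\epsilon_T$. Overall Lagrangian $L:T\Gamma\times\mathbb R^+\to\mathbb R$: $L(x,q,t)=L_\gamma(s,q\cdot\dot\gamma(s),t)$ if $x=\gamma(s)$ with $s\in(0,|\gamma|)$; $L(x,q,t)=\frac{|q|^2}{2}+c_x(t)$ if $x\in\mathbf V$. For a curve $\xi$ in $\Gamma$, $L(\xi,\dot\xi,\tau)$ stands for $L(\xi(\tau),\dot\xi(\tau),\tau)$, defined for a.e. $\tau$. *)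

theory Defs
  imports "HOL-Analysis.Analysis"
begin

section \<open>Absolutely continuous curves, weak convergence, integrals\<close>

definition absolutely_continuous_curve ::
    "real \<Rightarrow> real \<Rightarrow> (real \<Rightarrow> 'a::euclidean_space) \<Rightarrow> bool" where
  "absolutely_continuous_curve a b \<xi> \<longleftrightarrow>
     (\<forall>\<epsilon>>0. \<exists>\<delta>>0. \<forall>(n::nat) u v.
        (\<forall>i<n. a \<le> u i \<and> u i \<le> v i \<and> v i \<le> b) \<and>
        (\<forall>i<n. \<forall>j<n. i \<noteq> j \<longrightarrow> {u i<..<v i} \<inter> {u j<..<v j} = {}) \<and>
        (\<Sum>i<n. v i - u i) < \<delta> \<longrightarrow>
        (\<Sum>i<n. dist (\<xi> (u i)) (\<xi> (v i))) < \<epsilon>)"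

text \<open>A curve in a set: absolute continuity is with respect to the Euclidean distance of the
  ambient space. Only the values on the interval \<open>[a,b]\<close> matter.\<close>

definition curve_in ::
    "'a::euclidean_space set \<Rightarrow> real \<Rightarrow> real \<Rightarrow> (real \<Rightarrow> 'a) \<Rightarrow> bool" where
  "curve_in S a b \<xi> \<longleftrightarrow> absolutely_continuous_curve a b \<xi> \<and> \<xi> ` {a..b} \<subseteq> S"

text \<open>The velocity of a curve, defined at almost every time of the interior of its domain when the
  curve is absolutely continuous; on the remaining null set the value is arbitrary.\<close>

abbreviation velocity :: "(real \<Rightarrow> 'a::euclidean_space) \<Rightarrow> real \<Rightarrow> 'a" where
  "velocity \<xi> \<tau> \<equiv> vector_derivative \<xi> (at \<tau>)"

definition curve_length :: "real \<Rightarrow> real \<Rightarrow> (real \<Rightarrow> 'a::euclidean_space) \<Rightarrow> real" where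
  "curve_length a b \<xi> = (LINT \<tau>|lebesgue_on {a..b}. norm (velocity \<xi> \<tau>))"

definition in_L2 :: "real \<Rightarrow> real \<Rightarrow> (real \<Rightarrow> 'a::euclidean_space) \<Rightarrow> bool" where
  "in_L2 a b f \<longleftrightarrow> f \<in> borel_measurable (lebesgue_on {a..b}) \<and>
     integrable (lebesgue_on {a..b}) (\<lambda>\<tau>. (norm (f \<tau>))\<^sup>2)"

definition weakly_converges_L2 ::
    "real \<Rightarrow> real \<Rightarrow> (nat \<Rightarrow> real \<Rightarrow> 'a::euclidean_space) \<Rightarrow> (real \<Rightarrow> 'a) \<Rightarrow> bool" where
  "weakly_converges_L2 a b f g \<longleftrightarrow>
     (\<forall>n. in_L2 a b (f n)) \<and> in_L2 a b g \<and>
     (\<forall>\<phi>. in_L2 a b \<phi> \<longrightarrow>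
        (\<lambda>n. LINT \<tau>|lebesgue_on {a..b}. f n \<tau> \<bullet> \<phi> \<tau>)
          \<longlonglongrightarrow> (LINT \<tau>|lebesgue_on {a..b}. g \<tau> \<bullet> \<phi> \<tau>))"

text \<open>Lebesgue integral with values in the extended reals, as the difference of the integrals of
  the positive part and of the negative part. The actions considered below may be infinite; their
  integrands are bounded from below, so that the subtracted term is always finite.\<close>

definition lebesgue_integral_ereal :: "real \<Rightarrow> real \<Rightarrow> (real \<Rightarrow> real) \<Rightarrow> ereal" where
  "lebesgue_integral_ereal a b f =
     enn2ereal (\<integral>\<^sup>+ \<tau>. ennreal (f \<tau>) \<partial>lebesgue_on {a..b}) -
     enn2ereal (\<integral>\<^sup>+ \<tau>. ennreal (- f \<tau>) \<partial>lebesgue_on {a..b})"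


section \<open>Networks\<close>

text \<open>A parametrized curve is a pair of the length \<open>l\<close> of its parameter interval and of a function
  that is made \<open>undefined\<close> outside \<open>[0,l]\<close>. Hence equality of pairs is equality of
  parametrized curves, and a collection of arcs is a set of pairs.\<close>

type_synonym 'a arc = "real \<times> (real \<Rightarrow> 'a)"

abbreviation arc_len :: "'a arc \<Rightarrow> real" where
  "arc_len \<gamma> \<equiv> fst \<gamma>"

abbreviation arc_pt :: "'a arc \<Rightarrow> real \<Rightarrow> 'a" where
  "arc_pt \<gamma> \<equiv> snd \<gamma>"

text \<open>The derivative is one-sided at the endpoints of the parameter interval.\<close>

definition arc_vel :: "'a::euclidean_space arc \<Rightarrow> real \<Rightarrow> 'a" where
  "arc_vel \<gamma> s = vector_derivative (arc_pt \<gamma>) (at s within {0..arc_len \<gamma>})"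

definition inverse_arc :: "'a arc \<Rightarrow> 'a arc" where
  "inverse_arc \<gamma> = (arc_len \<gamma>, restrict (\<lambda>s. arc_pt \<gamma> (arc_len \<gamma> - s)) {0..arc_len \<gamma>})"

text \<open>Regular simple curves parametrized by arc length: the unit speed condition makes the
  derivative non-vanishing and makes \<open>arc_len\<close> the Euclidean length. A simple curve may be a
  loop, that is, its two endpoints may coincide.\<close>

definition regular_arc :: "'a::euclidean_space arc \<Rightarrow> bool" where
  "regular_arc \<gamma> \<longleftrightarrow>
     0 < arc_len \<gamma> \<and>
     arc_pt \<gamma> \<in> extensional {0..arc_len \<gamma>} \<and>
     (\<forall>s\<in>{0..arc_len \<gamma>}.
        (arc_pt \<gamma> has_vector_derivative arc_vel \<gamma> s) (at s within {0..arc_len \<gamma>})) \<and>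
     continuous_on {0..arc_len \<gamma>} (arc_vel \<gamma>) \<and>
     (\<forall>s\<in>{0..arc_len \<gamma>}. norm (arc_vel \<gamma> s) = 1) \<and>
     (\<forall>s\<in>{0..arc_len \<gamma>}. \<forall>s'\<in>{0..arc_len \<gamma>}.
        arc_pt \<gamma> s = arc_pt \<gamma> s' \<longrightarrow> s = s' \<or> {s, s'} = {0, arc_len \<gamma>})"

definition vertices :: "'a arc set \<Rightarrow> 'a set" where
  "vertices E = (\<Union>\<gamma>\<in>E. {arc_pt \<gamma> 0, arc_pt \<gamma> (arc_len \<gamma>)})"

definition arcs_from :: "'a arc set \<Rightarrow> 'a \<Rightarrow> 'a arc set" where
  "arcs_from E x = {\<gamma> \<in> E. arc_pt \<gamma> 0 = x}"

definition network_points :: "'a arc set \<Rightarrow> 'a set" where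
  "network_points E = (\<Union>\<gamma>\<in>E. arc_pt \<gamma> ` {0..arc_len \<gamma>})"

definition network :: "'a::euclidean_space arc set \<Rightarrow> bool" where
  "network E \<longleftrightarrow>
     countable E \<and>
     (\<forall>\<gamma>\<in>E. regular_arc \<gamma>) \<and>
     (\<forall>\<gamma>\<in>E. inverse_arc \<gamma> \<in> E) \<and>
     (\<forall>\<gamma>\<in>E. \<forall>\<gamma>'\<in>E. \<gamma>' \<noteq> \<gamma> \<and> \<gamma>' \<noteq> inverse_arc \<gamma> \<longrightarrow>
        arc_pt \<gamma> ` {0<..<arc_len \<gamma>} \<inter> arc_pt \<gamma>' ` {0..arc_len \<gamma>'} = {}) \<and>
     (\<forall>x\<in>vertices E. \<forall>y\<in>vertices E.
        (x, y) \<in> {(arc_pt \<gamma> 0, arc_pt \<gamma> (arc_len \<gamma>)) | \<gamma>. \<gamma> \<in> E}\<^sup>*) \<and>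
     (\<forall>x\<in>vertices E. finite (arcs_from E x)) \<and>
     (\<exists>m>0. \<forall>\<gamma>\<in>E. m \<le> arc_len \<gamma>)"

text \<open>Geodesic distance: infimum of the Euclidean lengths of the curves in the network that join
  the two points (there is at least one, by connectedness).\<close>

definition geodesic_dist :: "'a::euclidean_space arc set \<Rightarrow> 'a \<Rightarrow> 'a \<Rightarrow> real" where
  "geodesic_dist E x y =
     Inf {curve_length 0 1 \<eta> | \<eta>. curve_in (network_points E) 0 1 \<eta> \<and> \<eta> 0 = x \<and> \<eta> 1 = y}"


section \<open>Hamiltonians, flux limiters and Lagrangians\<close>

text \<open>A family of Hamiltonians is written \<open>H \<gamma> s t \<mu>\<close>; its values are constrained and used only for
  \<open>\<gamma>\<close> in the network, \<open>s\<close> in \<open>[0, arc_len \<gamma>]\<close> and \<open>t \<ge> 0\<close>.\<close>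

type_synonym 'a hamiltonian = "'a arc \<Rightarrow> real \<Rightarrow> real \<Rightarrow> real \<Rightarrow> real"

definition superlinear_bound :: "(real \<Rightarrow> real) \<Rightarrow> bool" where
  "superlinear_bound \<theta> \<longleftrightarrow>
     mono_on {0..} \<theta> \<and> convex_on {0..} \<theta> \<and> filterlim (\<lambda>r. \<theta> r / r) at_top at_top"

definition network_hamiltonian ::
    "'a::euclidean_space arc set \<Rightarrow> 'a hamiltonian \<Rightarrow> bool" where
  "network_hamiltonian E H \<longleftrightarrow>
     (\<forall>\<gamma>\<in>E. \<forall>s\<in>{0..arc_len \<gamma>}. \<forall>t\<ge>0. \<forall>\<mu>.
        H (inverse_arc \<gamma>) s t \<mu> = H \<gamma> (arc_len \<gamma> - s) t (- \<mu>)) \<and>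
     (\<forall>\<gamma>\<in>E. continuous_on ({0..arc_len \<gamma>} \<times> {0..} \<times> UNIV) (\<lambda>(s, t, \<mu>). H \<gamma> s t \<mu>)) \<and>
     (\<forall>\<gamma>\<in>E. \<forall>s\<in>{0..arc_len \<gamma>}. \<forall>t\<ge>0. convex_on UNIV (H \<gamma> s t)) \<and>
     (\<forall>T>0. \<exists>\<theta> \<Theta>. superlinear_bound \<theta> \<and> superlinear_bound \<Theta> \<and>
        (\<forall>\<gamma>\<in>E. \<forall>s\<in>{0..arc_len \<gamma>}. \<forall>t\<in>{0..T}. \<forall>\<mu>.
           \<theta> \<bar>\<mu>\<bar> \<le> H \<gamma> s t \<mu> \<and> H \<gamma> s t \<mu> \<le> \<Theta> \<bar>\<mu>\<bar>)) \<and>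
     (\<forall>T>0. \<exists>\<alpha>\<ge>0. \<exists>\<beta>\<ge>0. \<exists>\<epsilon>\<in>{0<..T}.
        \<forall>\<gamma>\<in>E. \<forall>s\<in>{0..arc_len \<gamma>}. \<forall>\<mu>. \<forall>t\<^sub>1\<in>{0..T}. \<forall>t\<^sub>2\<in>{0..T}. \<bar>t\<^sub>2 - t\<^sub>1\<bar> < \<epsilon> \<longrightarrow>
          H \<gamma> s t\<^sub>1 \<mu> - H \<gamma> s t\<^sub>2 \<mu> \<le> (\<alpha> * (H \<gamma> s t\<^sub>2 \<mu> / (1 + \<bar>\<mu>\<bar>)) + \<beta>) * \<bar>t\<^sub>2 - t\<^sub>1\<bar>)"

text \<open>The supremum is a maximum, since \<open>H \<gamma> s t\<close> is continuous and superlinearly coercive.\<close>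

definition arc_lagrangian ::
    "'a hamiltonian \<Rightarrow> 'a arc \<Rightarrow> real \<Rightarrow> real \<Rightarrow> real \<Rightarrow> real" where
  "arc_lagrangian H \<gamma> s v t = (SUP \<mu>. v * \<mu> - H \<gamma> s t \<mu>)"

definition flux_limiter ::
    "'a::euclidean_space arc set \<Rightarrow> 'a hamiltonian \<Rightarrow> ('a \<Rightarrow> real \<Rightarrow> real) \<Rightarrow> bool" where
  "flux_limiter E H c \<longleftrightarrow>
     (\<forall>x\<in>vertices E. continuous_on {0..} (c x)) \<and>
     (\<forall>x\<in>vertices E. \<forall>t\<ge>0. c x t \<le> (MIN \<gamma>\<in>arcs_from E x. arc_lagrangian H \<gamma> 0 0 t)) \<and>
     (\<forall>T>0. \<exists>C. \<forall>x\<in>vertices E. \<forall>t\<in>{0..T}. \<bar>c x t\<bar> \<le> C) \<and>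
     (\<forall>T>0. \<exists>\<beta>\<ge>0. \<exists>\<epsilon>\<in>{0<..T}.
        \<forall>x\<in>vertices E. \<forall>t\<^sub>1\<in>{0..T}. \<forall>t\<^sub>2\<in>{0..T}. \<bar>t\<^sub>2 - t\<^sub>1\<bar> < \<epsilon> \<longrightarrow>
          c x t\<^sub>1 - c x t\<^sub>2 \<le> \<beta> * \<bar>t\<^sub>2 - t\<^sub>1\<bar>)"

text \<open>The overall Lagrangian. A point of the network that is not a vertex lies in the interior of
  exactly one arc and of its inverse, at one parameter each; the value does not depend on which of
  the two is chosen, because of the symmetry of the Hamiltonians. The formula extends the Lagrangian
  from the tangent bundle of the network to all vectors \<open>q\<close>; this is harmless, as the velocity of
  a curve in the network is tangent at almost every time.\<close>

definition overall_lagrangian ::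
    "'a::euclidean_space arc set \<Rightarrow> 'a hamiltonian \<Rightarrow> ('a \<Rightarrow> real \<Rightarrow> real)
      \<Rightarrow> 'a \<Rightarrow> 'a \<Rightarrow> real \<Rightarrow> real" where
  "overall_lagrangian E H c x q t =
     (if x \<in> vertices E then (norm q)\<^sup>2 / 2 + c x t
      else let (\<gamma>, s) = (SOME (\<gamma>, s). \<gamma> \<in> E \<and> s \<in> {0<..<arc_len \<gamma>} \<and> x = arc_pt \<gamma> s)
           in arc_lagrangian H \<gamma> s (q \<bullet> arc_vel \<gamma> s) t)"

end

theory Submission
  imports Defs
begin

text \<open>The geodesic distance is an infimum over curves that are absolutely continuous for the Euclidean
  distance, while infinitely many arcs may accumulate in the Euclidean sense. By Baire's theorem such
  a curve nevertheless meets only finitely many arcs, so that a short curve stays near its starting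
  point in the obvious combinatorial sense. Hence Lipschitz functions \<open>W\<close> of the arc length coordinate
  of one arc, set to zero elsewhere, turn curves in the network into absolutely continuous real
  functions, and uniform convergence in the geodesic distance gives pointwise convergence of \<open>W \<circ> \<xi>\<^sub>n\<close>.

  It suffices to treat curves with bounded actions. Superlinearity of the Lagrangians then makes the
  speeds uniformly integrable, so that the integrals of \<open>(W \<circ> \<xi>\<^sub>n)'\<close> over every measurable set converge.
  While \<open>\<zeta>\<close> is inside an arc, the Lagrangian is the supremum over rational \<open>\<mu>\<close> of the affine functions
  \<open>v \<mu> - H\<close>, whose integrals converge. While \<open>\<zeta>\<close> rests at a vertex \<open>x\<close>, its velocity vanishes almost
  everywhere; for each arc issuing from \<open>x\<close> one chooses \<open>\<mu>\<close> with \<open>- H \<ge> c\<^sub>x - \<epsilon>\<close> at \<open>x\<close>, which is possible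
  because the flux limiter is at most \<open>L 0\<close>, and the linear terms integrate to zero in the limit.\<close>


section \<open>Absolutely continuous curves\<close>

text \<open>The integrand is not lower semicontinuous in position and velocity: at a vertex it
  equals |q|^2/2 + c, which for q other than 0 may exceed the Lagrangians of the nearby arcs. So the
  classical theorem for integrands convex in the velocity cannot be quoted. Near a vertex the
  approximating curves may moreover oscillate between arcs, and each arc needs its own slope \<mu>.
  Ambient velocities cannot separate the arcs, since several of them may leave a vertex in equal or
  dependent directions; the scalar coordinate of each arc can. Its velocity integrated over an
  interval is an increment of the coordinate, and this is how pointwise convergence enters the
  linear terms. The lower bound m on the arc lengths makes everything local: a curve short compared
  with m meets at most one vertex. The recurring factor 2 between parameter and curve length comes
  from comparing chords with arcs whose unit tangent varies by less than 1/2. Adding a constant A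
  makes all integrands nonnegative, so that arguments of Fatou type run in \<open>ennreal\<close>,
  infinite actions included.\<close>

definition nonoverlapping :: "real \<Rightarrow> real \<Rightarrow> 'i set \<Rightarrow> ('i \<Rightarrow> real) \<Rightarrow> ('i \<Rightarrow> real) \<Rightarrow> bool" where
  "nonoverlapping a b I u v \<longleftrightarrow> finite I \<and> (\<forall>i\<in>I. a \<le> u i \<and> u i \<le> v i \<and> v i \<le> b) \<and>
     (\<forall>i\<in>I. \<forall>j\<in>I. i \<noteq> j \<longrightarrow> {u i<..<v i} \<inter> {u j<..<v j} = {})"

text \<open>A bijection from \<open>{..<card I}\<close> onto \<open>I\<close> frees the definition
  from its numbering by naturals. The index sets used later are pairs (steps of chains chosen in
  several intervals) and sets of reals (the intervals themselves).\<close>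

lemma absolutely_continuous_curveD:
  assumes "absolutely_continuous_curve a b f" "e > 0"
  obtains d where "d > 0"
    "\<forall>(I::'i set) u v. nonoverlapping a b I u v \<longrightarrow>
      (\<Sum>i\<in>I. v i - u i) < d \<longrightarrow> (\<Sum>i\<in>I. dist (f (u i)) (f (v i))) < e"
proof -
  from assms(1)[unfolded absolutely_continuous_curve_def, rule_format, OF assms(2)]
  obtain d where "d > 0" and d: "\<forall>(n::nat) u v.
        (\<forall>i<n. a \<le> u i \<and> u i \<le> v i \<and> v i \<le> b) \<and>
        (\<forall>i<n. \<forall>j<n. i \<noteq> j \<longrightarrow> {u i<..<v i} \<inter> {u j<..<v j} = {}) \<and>
        (\<Sum>i<n. v i - u i) < d \<longrightarrow> (\<Sum>i<n. dist (f (u i)) (f (v i))) < e"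
    by (elim exE conjE)
  show ?thesis
  proof (rule that[OF \<open>d > 0\<close>], intro allI impI)
    fix I :: "'i set" and u v
    assume "nonoverlapping a b I u v" and I4: "(\<Sum>i\<in>I. v i - u i) < d"
    then have I: "finite I" "\<And>i. i \<in> I \<Longrightarrow> a \<le> u i \<and> u i \<le> v i \<and> v i \<le> b"
      "\<And>i j. i \<in> I \<Longrightarrow> j \<in> I \<Longrightarrow> i \<noteq> j \<Longrightarrow> {u i<..<v i} \<inter> {u j<..<v j} = {}"
      unfolding nonoverlapping_def by blast+
    obtain h where h: "bij_betw h {..<card I} I"
      using ex_bij_betw_nat_finite[OF I(1)] by (auto simp: atLeast0LessThan)
    have hI: "h i \<in> I" if "i < card I" for i
      using h that by (auto simp: bij_betw_def)
    have "(\<Sum>i<card I. dist (f (u (h i))) (f (v (h i)))) < e"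
    proof (rule d[rule_format], intro conjI allI impI)
      fix i j assume ij: "i < card I" "j < card I" "i \<noteq> j"
      then have "h i \<noteq> h j" using h by (auto simp: bij_betw_def inj_on_def)
      then show "{u (h i)<..<v (h i)} \<inter> {u (h j)<..<v (h j)} = {}"
        using ij hI I(3) by blast
    next
      show "(\<Sum>i<card I. v (h i) - u (h i)) < d"
        using I4 sum.reindex_bij_betw[OF h, of "\<lambda>i. v i - u i"] by simp
    qed (use hI I(2) in auto)
    then show "(\<Sum>i\<in>I. dist (f (u i)) (f (v i))) < e"
      using sum.reindex_bij_betw[OF h, of "\<lambda>i. dist (f (u i)) (f (v i))"] by simp
  qed
qed

lemma absolutely_continuous_curve_controlled:
  assumes "absolutely_continuous_curve a b f" "K \<ge> 0"
    "\<And>u v. a \<le> u \<Longrightarrow> u \<le> v \<Longrightarrow> v \<le> b \<Longrightarrow> dist (g u) (g v) \<le> K * dist (f u) (f v)"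
  shows "absolutely_continuous_curve a b g"
  unfolding absolutely_continuous_curve_def
proof (intro allI impI)
  fix e :: real assume "e > 0"
  \<comment> \<open>Dividing by K + 1 instead of K admits K = 0 and makes the final inequality
    strict.\<close>
  then have e: "e / (K + 1) > 0" using assms(2) by simp
  obtain d where "d > 0" and d: "\<And>(I::nat set) u v. nonoverlapping a b I u v \<Longrightarrow>
      (\<Sum>i\<in>I. v i - u i) < d \<Longrightarrow> (\<Sum>i\<in>I. dist (f (u i)) (f (v i))) < e / (K + 1)"
    by (rule absolutely_continuous_curveD[OF assms(1) e, where 'i=nat]) blast
  show "\<exists>\<delta>>0. \<forall>(n::nat) u v.
        (\<forall>i<n. a \<le> u i \<and> u i \<le> v i \<and> v i \<le> b) \<and>
        (\<forall>i<n. \<forall>j<n. i \<noteq> j \<longrightarrow> {u i<..<v i} \<inter> {u j<..<v j} = {}) \<and>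
        (\<Sum>i<n. v i - u i) < \<delta> \<longrightarrow> (\<Sum>i<n. dist (g (u i)) (g (v i))) < e"
  proof (intro exI[of _ d] conjI \<open>d > 0\<close> allI impI)
    fix n :: nat and u v
    assume *: "(\<forall>i<n. a \<le> u i \<and> u i \<le> v i \<and> v i \<le> b) \<and>
        (\<forall>i<n. \<forall>j<n. i \<noteq> j \<longrightarrow> {u i<..<v i} \<inter> {u j<..<v j} = {}) \<and> (\<Sum>i<n. v i - u i) < d"
    have "(\<Sum>i<n. dist (g (u i)) (g (v i))) \<le> (\<Sum>i<n. K * dist (f (u i)) (f (v i)))"
      using * assms(3) by (intro sum_mono) auto
    also have "\<dots> = K * (\<Sum>i<n. dist (f (u i)) (f (v i)))" by (simp add: sum_distrib_left)
    also have "\<dots> \<le> K * (e / (K + 1))"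
      using d[of "{..<n}" u v] * assms(2) unfolding nonoverlapping_def by (intro mult_left_mono) auto
    also have "\<dots> < e" using \<open>e > 0\<close> assms(2) by (simp add: field_simps)
    finally show "(\<Sum>i<n. dist (g (u i)) (g (v i))) < e" .
  qed
qed

lemma absolutely_continuous_curve_continuous:
  assumes "absolutely_continuous_curve a b f"
  shows "continuous_on {a..b} f"
  unfolding continuous_on_iff
proof (intro ballI allI impI)
  fix x e :: real assume x: "x \<in> {a..b}" and e: "e > 0"
  obtain d where "d > 0" and d: "\<And>(I::nat set) u v. nonoverlapping a b I u v \<Longrightarrow>
      (\<Sum>i\<in>I. v i - u i) < d \<Longrightarrow> (\<Sum>i\<in>I. dist (f (u i)) (f (v i))) < e"
    by (rule absolutely_continuous_curveD[OF assms e, where 'i=nat]) blast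
  show "\<exists>d>0. \<forall>x'\<in>{a..b}. dist x' x < d \<longrightarrow> dist (f x') (f x) < e"
  proof (intro exI[of _ d] conjI \<open>d > 0\<close> ballI impI)
    fix y assume y: "y \<in> {a..b}" "dist y x < d"
    show "dist (f y) (f x) < e"
      using d[of "{0}" "\<lambda>_. x" "\<lambda>_. y"] d[of "{0}" "\<lambda>_. y" "\<lambda>_. x"] x y unfolding nonoverlapping_def
      by (cases "x \<le> y") (auto simp: dist_real_def dist_commute)
  qed
qed

section \<open>Total variation of an absolutely continuous curve\<close>

text \<open>Chains are weakly increasing and need not reach the endpoints. Hence clamping a chain at
  a point keeps its number of steps, and no refinements of partitions have to be formed.\<close>

definition chain_on :: "real \<Rightarrow> real \<Rightarrow> nat \<Rightarrow> (nat \<Rightarrow> real) \<Rightarrow> bool" where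
  "chain_on a t n u \<longleftrightarrow> a \<le> u 0 \<and> u n \<le> t \<and> (\<forall>i<n. u i \<le> u (Suc i))"

definition chain_sum :: "(real \<Rightarrow> 'a::metric_space) \<Rightarrow> nat \<Rightarrow> (nat \<Rightarrow> real) \<Rightarrow> real" where
  "chain_sum f n u = (\<Sum>i<n. dist (f (u i)) (f (u (Suc i))))"

text \<open>The total variation of \<open>f\<close> on \<open>[a,t]\<close>. Being a real supremum,
  it is informative only once the chain sums are known to be bounded.\<close>

definition chain_var :: "(real \<Rightarrow> 'a::metric_space) \<Rightarrow> real \<Rightarrow> real \<Rightarrow> real" where
  "chain_var f a t = Sup {chain_sum f n u | n u. chain_on a t n u}"

lemma chain_on_mono:
  assumes "chain_on a t n u" "i \<le> j" "j \<le> n" shows "u i \<le> u j"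
  using assms(2,3)
proof (induction j rule: dec_induct)
  case (step j) then show ?case using assms(1) unfolding chain_on_def by (meson Suc_le_lessD less_imp_le_nat order_trans)
qed simp

lemma chain_on_bounds:
  assumes "chain_on a t n u" "i \<le> n" shows "a \<le> u i" "u i \<le> t"
  using assms chain_on_mono[OF assms(1), of 0 i] chain_on_mono[OF assms(1), of i n]
  unfolding chain_on_def by auto

lemma chain_disjoint:
  assumes "chain_on a t n u" "i < n" "j < n" "i \<noteq> j"
  shows "{u i<..<u (Suc i)} \<inter> {u j<..<u (Suc j)} = {}"
proof -
  have "{u i<..<u (Suc i)} \<inter> {u j<..<u (Suc j)} = {}" if "i < j" "j < n" for i j
    using chain_on_mono[OF assms(1), of "Suc i" j] that by auto
  then show ?thesis using assms by (metis Int_commute linorder_neqE_nat)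
qed

text \<open>Clamp the chain at \<open>c\<close> from above and from below. A step on one side of
  \<open>c\<close> survives in one of the two chains and degenerates in the other; a step across
  \<open>c\<close> is cut in two, and the triangle inequality pays for it.\<close>

lemma chain_split:
  assumes "chain_on a t n u" "a \<le> c" "c \<le> t"
  shows "chain_on a c n (\<lambda>i. min (u i) c)" "chain_on c t n (\<lambda>i. max (u i) c)"
    "chain_sum f n u \<le> chain_sum f n (\<lambda>i. min (u i) c) + chain_sum f n (\<lambda>i. max (u i) c)"
proof -
  show "chain_on a c n (\<lambda>i. min (u i) c)" "chain_on c t n (\<lambda>i. max (u i) c)"
    using assms unfolding chain_on_def by (auto simp: min_def max_def intro: order_trans)
  have "dist (f (u i)) (f (u (Suc i))) \<le> dist (f (min (u i) c)) (f (min (u (Suc i)) c)) +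
     dist (f (max (u i) c)) (f (max (u (Suc i)) c))" if "i < n" for i
    using assms(1) that dist_triangle[of "f (u i)" "f (u (Suc i))" "f c"] unfolding chain_on_def
    by (auto simp: min_def max_def)
  then show "chain_sum f n u \<le> chain_sum f n (\<lambda>i. min (u i) c) + chain_sum f n (\<lambda>i. max (u i) c)"
    unfolding chain_sum_def sum.distrib[symmetric] by (intro sum_mono) auto
qed

lemma chain_sum_length: "(\<Sum>i<n. u (Suc i) - u i) = u n - (u 0 :: real)"
  by (simp add: sum_lessThan_telescope)

text \<open>If d answers to the tolerance 1, then every chain sum within an interval of length d/2
  is below 1, and finitely many such intervals cover \<open>[a,b]\<close>.\<close>

lemma chain_sum_bdd:
  assumes ac: "absolutely_continuous_curve a b f"
  shows "\<exists>B. \<forall>n u. chain_on a b n u \<longrightarrow> chain_sum f n u \<le> B"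
proof (cases "a \<le> b")
  case True
  obtain d where "d > 0" and d: "\<And>(I::nat set) u v. nonoverlapping a b I u v \<Longrightarrow>
      (\<Sum>i\<in>I. v i - u i) < d \<Longrightarrow> (\<Sum>i\<in>I. dist (f (u i)) (f (v i))) < 1"
    by (rule absolutely_continuous_curveD[OF ac zero_less_one, where 'i=nat]) blast
  have short: "chain_sum f n u \<le> 1" if u: "chain_on c t n u" "a \<le> c" "t \<le> b" "t - c \<le> d/2" for n u c t
  proof -
    have uc: "c \<le> u 0" "u n \<le> t" "\<And>i. i < n \<Longrightarrow> u i \<le> u (Suc i)"
      using u(1) unfolding chain_on_def by auto
    have "u n - u 0 \<le> t - c" using uc by linarith
    then have "(\<Sum>i<n. u (Suc i) - u i) < d"
      unfolding chain_sum_length using u(4) \<open>d > 0\<close> by linarith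
    moreover have "a \<le> u i \<and> u i \<le> u (Suc i) \<and> u (Suc i) \<le> b" if "i < n" for i
      using chain_on_bounds[OF u(1), of i] chain_on_bounds[OF u(1), of "Suc i"] uc(3)[OF that] u(2,3) that
      by simp
    ultimately have "chain_sum f n u < 1"
      unfolding chain_sum_def using chain_disjoint[OF u(1)] by (intro d) (auto simp: nonoverlapping_def)
    then show ?thesis by simp
  qed
  have "\<forall>n u t. t \<le> a + real k * (d/2) \<longrightarrow> t \<le> b \<longrightarrow> chain_on a t n u \<longrightarrow> chain_sum f n u \<le> real k + 1" for k
  proof (induction k)
    case 0
    then show ?case using short[of a] \<open>d > 0\<close> by auto
  next
    case (Suc k)
    show ?case
    proof (intro allI impI)
      fix n u t assume t: "t \<le> a + real (Suc k) * (d/2)" "t \<le> b" "chain_on a t n u"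
      have at: "a \<le> t" using chain_on_bounds[OF t(3), of 0] by simp
      \<comment> \<open>A last piece of length at most d/2 is cut off; the minimum covers the case
        that \<open>t\<close> lies within the first k pieces already.\<close>
      define c where "c = min t (a + real k * (d/2))"
      have c: "a \<le> c" "c \<le> t" "t - c \<le> d/2"
        using at t(1) \<open>d > 0\<close> by (auto simp: c_def min_def algebra_simps add_divide_distrib)
      note sp = chain_split[OF t(3) c(1,2)]
      have "chain_sum f n (\<lambda>i. min (u i) c) \<le> real k + 1"
        by (rule Suc.IH[rule_format, OF _ _ sp(1)]) (use t(2) in \<open>auto simp: c_def\<close>)
      moreover have "chain_sum f n (\<lambda>i. max (u i) c) \<le> 1"
        using short[OF sp(2)] c t by auto
      ultimately show "chain_sum f n u \<le> real (Suc k) + 1"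
        using sp(3)[of f] by simp
    qed
  qed
  moreover obtain k where "(b - a) / (d/2) \<le> real k" using real_arch_simple by blast
  then have "b \<le> a + real k * (d/2)" using \<open>d > 0\<close> by (simp add: field_simps)
  ultimately show ?thesis by blast
next
  case False
  then have "\<not> chain_on a b n u" for n u
    using chain_on_bounds[of a b n u 0] by auto
  then show ?thesis by blast
qed

lemma chain_on_subset: "chain_on a t n u \<Longrightarrow> a' \<le> a \<Longrightarrow> t \<le> t' \<Longrightarrow> chain_on a' t' n u"
  unfolding chain_on_def by auto

lemma chain_var_upper:
  assumes ac: "absolutely_continuous_curve a b f" and "a \<le> c" "t \<le> b" "chain_on c t n u"
  shows "chain_sum f n u \<le> chain_var f c t"
proof -
  obtain B where "\<And>n u. chain_on a b n u \<Longrightarrow> chain_sum f n u \<le> B"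
    using chain_sum_bdd[OF ac] by blast
  then have "\<And>n u. chain_on c t n u \<Longrightarrow> chain_sum f n u \<le> B"
    using chain_on_subset assms by blast
  then show ?thesis
    unfolding chain_var_def using assms by (intro cSup_upper) (auto intro!: bdd_aboveI[of _ B])
qed

lemma chain_var_split:
  assumes ac: "absolutely_continuous_curve a b f" and "a \<le> c" "c \<le> t" "t \<le> b"
  shows "chain_var f a t \<le> chain_var f a c + chain_var f c t"
  unfolding chain_var_def[of f a t]
proof (rule cSup_least)
  show "{chain_sum f n u |n u. chain_on a t n u} \<noteq> {}"
    using assms by (auto simp: chain_on_def intro!: exI[of _ 0] exI[of _ "\<lambda>_. a"])
next
  fix x assume "x \<in> {chain_sum f n u |n u. chain_on a t n u}"
  then obtain n u where x: "x = chain_sum f n u" and u: "chain_on a t n u" by auto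
  note sp = chain_split[OF u assms(2,3)]
  show "x \<le> chain_var f a c + chain_var f c t"
    using sp(3)[of f] chain_var_upper[OF ac _ _ sp(1)] chain_var_upper[OF ac _ _ sp(2)] assms x
    by auto
qed

text \<open>Any chain up to \<open>c\<close> can be prolonged by \<open>c\<close> and
  \<open>t\<close>. In this form the lemma gives monotonicity of the variation and bounds the
  increments of \<open>f\<close> by those of its variation.\<close>

lemma chain_var_step:
  assumes ac: "absolutely_continuous_curve a b f" and "a \<le> c" "c \<le> t" "t \<le> b"
  shows "chain_var f a c + dist (f c) (f t) \<le> chain_var f a t"
proof -
  have "chain_var f a c \<le> chain_var f a t - dist (f c) (f t)"
    unfolding chain_var_def[of f a c]
  proof (rule cSup_least)
    show "{chain_sum f n u |n u. chain_on a c n u} \<noteq> {}"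
      using assms by (auto simp: chain_on_def intro!: exI[of _ 0] exI[of _ "\<lambda>_. a"])
  next
    fix x assume "x \<in> {chain_sum f n u |n u. chain_on a c n u}"
    then obtain n u where x: "x = chain_sum f n u" and u: "chain_on a c n u" by auto
    let ?w = "\<lambda>i. if i \<le> n then u i else if i = Suc n then c else t"
    have "chain_on a t (Suc (Suc n)) ?w"
      using u assms unfolding chain_on_def by (auto simp: less_Suc_eq)
    then have "chain_sum f (Suc (Suc n)) ?w \<le> chain_var f a t"
      using assms by (intro chain_var_upper[OF ac]) auto
    moreover have "chain_sum f (Suc (Suc n)) ?w = x + dist (f (u n)) (f c) + dist (f c) (f t)"
      by (simp add: chain_sum_def x)
    ultimately show "x \<le> chain_var f a t - dist (f c) (f t)"
      using zero_le_dist[of "f (u n)" "f c"] by linarith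
  qed
  then show ?thesis by simp
qed

text \<open>In each given interval pick a nearly optimal chain. All their steps together form a
  nonoverlapping family of no greater total length, so absolute continuity of \<open>f\<close>
  bounds the sum of all the chain sums.\<close>

lemma chain_var_absolutely_continuous:
  assumes ac: "absolutely_continuous_curve a b f"
  shows "absolutely_continuous_curve a b (chain_var f a)"
  unfolding absolutely_continuous_curve_def
proof (intro allI impI)
  fix e :: real assume "e > 0"
  then have e: "e/2 > 0" by simp
  obtain d where "d > 0" and d: "\<And>(I::(nat\<times>nat) set) u v. nonoverlapping a b I u v \<Longrightarrow>
      (\<Sum>i\<in>I. v i - u i) < d \<Longrightarrow> (\<Sum>i\<in>I. dist (f (u i)) (f (v i))) < e/2"
    by (rule absolutely_continuous_curveD[OF ac e, where 'i="nat\<times>nat"]) blast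
  show "\<exists>\<delta>>0. \<forall>(n::nat) u v.
        (\<forall>i<n. a \<le> u i \<and> u i \<le> v i \<and> v i \<le> b) \<and>
        (\<forall>i<n. \<forall>j<n. i \<noteq> j \<longrightarrow> {u i<..<v i} \<inter> {u j<..<v j} = {}) \<and>
        (\<Sum>i<n. v i - u i) < \<delta> \<longrightarrow> (\<Sum>i<n. dist (chain_var f a (u i)) (chain_var f a (v i))) < e"
  proof (intro exI[of _ d] conjI \<open>d > 0\<close> allI impI)
    fix n :: nat and u v
    assume *: "(\<forall>i<n. a \<le> u i \<and> u i \<le> v i \<and> v i \<le> b) \<and>
        (\<forall>i<n. \<forall>j<n. i \<noteq> j \<longrightarrow> {u i<..<v i} \<inter> {u j<..<v j} = {}) \<and> (\<Sum>i<n. v i - u i) < d"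
    \<comment> \<open>A defect of e / (2 (n + 1)) per interval adds up to at most e/2 over n
      intervals; the other half of e is left for the steps of the chains.\<close>
    have "\<forall>i\<in>{..<n}. \<exists>p. chain_on (u i) (v i) (fst p) (snd p) \<and>
        chain_var f (u i) (v i) - e / (2 * (real n + 1)) < chain_sum f (fst p) (snd p)"
    proof
      fix i assume i: "i \<in> {..<n}"
      have 1: "chain_var f (u i) (v i) - e / (2 * (real n + 1)) < Sup {chain_sum f k w |k w. chain_on (u i) (v i) k w}"
        unfolding chain_var_def using \<open>e > 0\<close> by simp
      have 2: "{chain_sum f k w |k w. chain_on (u i) (v i) k w} \<noteq> {}"
        using * i by (auto simp: chain_on_def intro!: exI[of _ 0] exI[of _ "\<lambda>_. u i"])
      obtain k w where kw: "chain_on (u i) (v i) k w"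
        "chain_var f (u i) (v i) - e / (2 * (real n + 1)) < chain_sum f k w"
        using less_cSupD[OF 2 1] by auto
      show "\<exists>p. chain_on (u i) (v i) (fst p) (snd p) \<and>
        chain_var f (u i) (v i) - e / (2 * (real n + 1)) < chain_sum f (fst p) (snd p)"
        by (rule exI[of _ "(k, w)"]) (use kw in simp)
    qed
    from bchoice[OF this] obtain p where p: "\<And>i. i < n \<Longrightarrow> chain_on (u i) (v i) (fst (p i)) (snd (p i))"
        "\<And>i. i < n \<Longrightarrow> chain_var f (u i) (v i) - e / (2 * (real n + 1)) < chain_sum f (fst (p i)) (snd (p i))"
      by auto
    define k where "k i = fst (p i)" for i
    define w where "w i = snd (p i)" for i
    have w: "\<And>i. i < n \<Longrightarrow> chain_on (u i) (v i) (k i) (w i)"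
      and w2: "\<And>i. i < n \<Longrightarrow> chain_var f (u i) (v i) - e / (2 * (real n + 1)) < chain_sum f (k i) (w i)"
      using p by (auto simp: k_def w_def)
    let ?I = "Sigma {..<n} (\<lambda>i. {..<k i})"
    have "(\<Sum>p\<in>?I. dist (f (w (fst p) (snd p))) (f (w (fst p) (Suc (snd p))))) < e/2"
    proof (rule d, unfold nonoverlapping_def, intro conjI ballI impI)
      fix p assume "p \<in> ?I"
      then have p: "fst p < n" "snd p < k (fst p)" by auto
      have uv: "a \<le> u (fst p)" "v (fst p) \<le> b" using * p(1) by auto
      show "a \<le> w (fst p) (snd p)"
        using chain_on_bounds(1)[OF w[OF p(1)], of "snd p"] p(2) uv by simp
      show "w (fst p) (snd p) \<le> w (fst p) (Suc (snd p))"
        using w[OF p(1)] p(2) by (simp add: chain_on_def)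
      show "w (fst p) (Suc (snd p)) \<le> b"
        using chain_on_bounds(2)[OF w[OF p(1)], of "Suc (snd p)"] p(2) uv by simp
    next
      fix p q assume pq: "p \<in> ?I" "q \<in> ?I" "p \<noteq> q"
      show "{w (fst p) (snd p)<..<w (fst p) (Suc (snd p))} \<inter> {w (fst q) (snd q)<..<w (fst q) (Suc (snd q))} = {}"
      proof (cases "fst p = fst q")
        case True
        then show ?thesis using chain_disjoint[OF w, of "fst q" "snd p" "snd q"] pq by (auto simp: prod_eq_iff)
      next
        case False
        have "{w (fst p) (snd p)<..<w (fst p) (Suc (snd p))} \<subseteq> {u (fst p)<..<v (fst p)}" if "p \<in> ?I" for p
          using chain_on_bounds[OF w, of "fst p" "snd p"] chain_on_bounds[OF w, of "fst p" "Suc (snd p)"] that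
          by fastforce
        moreover have "{u (fst p)<..<v (fst p)} \<inter> {u (fst q)<..<v (fst q)} = {}" using * pq False by auto
        ultimately show ?thesis using pq by blast
      qed
    next
      have "(\<Sum>p\<in>?I. w (fst p) (Suc (snd p)) - w (fst p) (snd p)) = (\<Sum>i<n. \<Sum>j<k i. w i (Suc j) - w i j)"
        by (simp add: sum.Sigma split_beta)
      also have "\<dots> \<le> (\<Sum>i<n. v i - u i)"
        unfolding chain_sum_length using w unfolding chain_on_def by (intro sum_mono) (meson diff_mono lessThan_iff)
      finally show "(\<Sum>p\<in>?I. w (fst p) (Suc (snd p)) - w (fst p) (snd p)) < d" using * by linarith
    qed simp
    then have S: "(\<Sum>i<n. chain_sum f (k i) (w i)) < e/2"
      by (simp add: sum.Sigma split_beta chain_sum_def)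
    have "(\<Sum>i<n. dist (chain_var f a (u i)) (chain_var f a (v i))) \<le> (\<Sum>i<n. chain_sum f (k i) (w i) + e / (2 * (real n + 1)))"
    proof (rule sum_mono)
      fix i assume i: "i \<in> {..<n}"
      then have uv: "a \<le> u i" "u i \<le> v i" "v i \<le> b" using * by auto
      have "chain_var f a (u i) \<le> chain_var f a (v i)"
        using chain_var_step[OF ac uv] zero_le_dist[of "f (u i)" "f (v i)"] by linarith
      then show "dist (chain_var f a (u i)) (chain_var f a (v i)) \<le> chain_sum f (k i) (w i) + e / (2 * (real n + 1))"
        using chain_var_split[OF ac uv] w2[of i] i by (simp add: dist_real_def)
    qed
    also have "\<dots> = (\<Sum>i<n. chain_sum f (k i) (w i)) + n * (e / (2 * (real n + 1)))" by (simp add: sum.distrib)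
    also have "n * (e / (2 * (real n + 1))) \<le> e/2" using \<open>e > 0\<close> by (simp add: field_simps)
    finally show "(\<Sum>i<n. dist (chain_var f a (u i)) (chain_var f a (v i))) < e" using S by linarith
  qed
qed


section \<open>Differentiation of integrals and the density of an absolutely continuous
  function\<close>

text \<open>\<open>integrable_ccontinuous_explicit\<close> controls averages over boxes whose lower
  corner is the given point, that is, right-hand averages. Applied to the reflected function as
  well, it yields the left-hand ones and hence a two-sided derivative.\<close>

lemma vector_derivative_of_integral_ae:
  fixes p :: "real \<Rightarrow> 'a::euclidean_space"
  assumes p: "p absolutely_integrable_on {a..b}"
  obtains N where "negligible N"
    "\<And>t. t \<in> {a<..<b} - N \<Longrightarrow> ((\<lambda>s. integral {a..s} p) has_vector_derivative p t) (at t)"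
proof -
  define q where "q t = (if t \<in> {a..b} then p t else 0)" for t
  define q' where "q' t = q (- t)" for t
  have "q absolutely_integrable_on UNIV"
    unfolding q_def using p by (simp only: absolutely_integrable_restrict_UNIV)
  then have "q absolutely_integrable_on cbox u v" for u v
    by (rule set_integrable_subset) auto
  then have qi: "q integrable_on cbox u v" for u v
    using set_lebesgue_integral_eq_integral(1) by blast
  then have q'i: "q' integrable_on cbox u v" for u v
    using integrable_reflect[of q "-u" "-v"] unfolding q'_def by simp
  obtain N1 where N1: "negligible N1" "\<And>x e. \<lbrakk>x \<notin> N1; 0 < e\<rbrakk> \<Longrightarrow>
      \<exists>d>0. \<forall>h. 0 < h \<and> h < d \<longrightarrow> norm (integral (cbox x (x + h *\<^sub>R One)) q /\<^sub>R h ^ DIM(real) - q x) < e"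
    using integrable_ccontinuous_explicit[OF qi] by blast
  obtain N2 where N2: "negligible N2" "\<And>x e. \<lbrakk>x \<notin> N2; 0 < e\<rbrakk> \<Longrightarrow>
      \<exists>d>0. \<forall>h. 0 < h \<and> h < d \<longrightarrow> norm (integral (cbox x (x + h *\<^sub>R One)) q' /\<^sub>R h ^ DIM(real) - q' x) < e"
    using integrable_ccontinuous_explicit[OF q'i] by blast
  have neg: "negligible (N1 \<union> uminus ` N2)"
    using N1(1) negligible_differentiable_image_negligible[OF order_refl N2(1), of uminus]
    by (auto intro!: negligible_Un derivative_intros)
  show ?thesis
  proof (rule that[OF neg])
    fix t assume t: "t \<in> {a<..<b} - (N1 \<union> uminus ` N2)"
    then have tN: "t \<notin> N1" "-t \<notin> N2" "a < t" "t < b" by force+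
    have pi: "p integrable_on {a..b}" using p set_lebesgue_integral_eq_integral(1) by blast
    have pint: "integral {u..v} q = integral {a..v} p - integral {a..u} p"
      if "a \<le> u" "u \<le> v" "v \<le> b" for u v
    proof -
      have "integral {u..v} q = integral {u..v} p"
        using that by (intro integral_cong) (auto simp: q_def)
      moreover have "integral {a..u} p + integral {u..v} p = integral {a..v} p"
        using that pi by (intro Henstock_Kurzweil_Integration.integral_combine integrable_on_subinterval[OF pi]) auto
      ultimately show ?thesis by (metis add_diff_cancel_left')
    qed
    show "((\<lambda>s. integral {a..s} p) has_vector_derivative p t) (at t)"
      unfolding has_vector_derivative_def has_derivative_at_alt
    proof (intro conjI allI impI)
      show "bounded_linear (\<lambda>x. x *\<^sub>R p t)" by (rule bounded_linear_scaleR_left)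
      fix e :: real assume "e > 0"
      obtain d1 where d1: "d1 > 0" "\<And>h. 0 < h \<Longrightarrow> h < d1 \<Longrightarrow> norm (integral {t..t + h} q /\<^sub>R h - q t) < e"
        using N1(2)[OF tN(1) \<open>e > 0\<close>] by (auto simp: box_real)
      obtain d2 where d2: "d2 > 0" "\<And>h. 0 < h \<Longrightarrow> h < d2 \<Longrightarrow> norm (integral {-t..-t + h} q' /\<^sub>R h - q' (-t)) < e"
        using N2(2)[OF tN(2) \<open>e > 0\<close>] by (auto simp: box_real)
      have qt: "q t = p t" using tN by (simp add: q_def)
      show "\<exists>d>0. \<forall>y. norm (y - t) < d \<longrightarrow>
          norm (integral {a..y} p - integral {a..t} p - (y - t) *\<^sub>R p t) \<le> e * norm (y - t)"
      proof (intro exI[of _ "min (min d1 d2) (min (t - a) (b - t))"] conjI allI impI)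
        show "0 < min (min d1 d2) (min (t - a) (b - t))" using d1 d2 tN by auto
        fix y assume y: "norm (y - t) < min (min d1 d2) (min (t - a) (b - t))"
        have scale: "norm (I - h *\<^sub>R p t) \<le> e * h" if "h > 0" "norm (I /\<^sub>R h - p t) < e" for h I
        proof -
          have "I - h *\<^sub>R p t = h *\<^sub>R (I /\<^sub>R h - p t)" using that(1) by (simp add: algebra_simps)
          then show ?thesis using that by (simp add: mult.commute)
        qed
        consider "y = t" | "y > t" | "y < t" by linarith
        then show "norm (integral {a..y} p - integral {a..t} p - (y - t) *\<^sub>R p t) \<le> e * norm (y - t)"
        proof cases
          case 2
          then have "norm (integral {t..y} q /\<^sub>R (y - t) - p t) < e"
            using d1(2)[of "y - t"] y qt by auto
          then show ?thesis using scale[of "y - t"] 2 y tN pint[of t y] by auto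
        next
          case 3
          have "integral {-t..-y} q' = integral {y..t} q"
            unfolding q'_def by simp
          then have "norm (integral {y..t} q /\<^sub>R (t - y) - p t) < e"
            using d2(2)[of "t - y"] y qt 3 by (auto simp: q'_def)
          then have "norm (integral {a..t} p - integral {a..y} p - (t - y) *\<^sub>R p t) \<le> e * (t - y)"
            using scale[of "t - y"] 3 y tN pint[of y t] by auto
          moreover have "integral {a..y} p - integral {a..t} p - (y - t) *\<^sub>R p t =
             - (integral {a..t} p - integral {a..y} p - (t - y) *\<^sub>R p t)"
            by (simp add: algebra_simps)
          ultimately show ?thesis using 3 by (metis norm_minus_cancel real_norm_def abs_minus_commute abs_of_pos diff_gt_0_iff_gt)
        qed simp
      qed
    qed
  qed
qed

text \<open>A Lebesgue null set lies in an open \<open>U\<close> of measure below d and is covered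
  by countably many nonoverlapping intervals inside \<open>U\<close>. Finitely many of these have
  total length below d, hence Stieltjes measure at most e by absolute continuity of
  \<open>F\<close>; the countable union follows by a monotone limit.\<close>

lemma interval_measure_null_set_small:
  fixes F :: "real \<Rightarrow> real"
  assumes ac: "absolutely_continuous_curve a b F" and ab: "a \<le> b"
    and N: "N \<in> null_sets lborel" and "e > 0"
  defines "G \<equiv> \<lambda>x. F (max a (min b x))"
  assumes mG: "mono G" and cG: "continuous_on UNIV G"
  shows "emeasure (interval_measure G) (N \<inter> {-real k..real k}) \<le> ennreal e"
proof -
  let ?\<nu> = "interval_measure G"
  have Icc: "emeasure (interval_measure G) {u..v} = ennreal (G v - G u)" if "u \<le> v" for u v
    using cG mG by (intro emeasure_interval_measure_Icc that) (auto dest: monoD intro: continuous_on_subset)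
  obtain d where "d > 0" and d: "\<And>(I::real set set) u v. nonoverlapping a b I u v \<Longrightarrow>
    (\<Sum>i\<in>I. v i - u i) < d \<Longrightarrow> (\<Sum>i\<in>I. dist (F (u i)) (F (v i))) < e"
    by (rule absolutely_continuous_curveD[OF ac \<open>e > 0\<close>, where 'i="real set"]) blast
  have "N \<in> sets borel" using N by auto
  then obtain U where U: "open U" "N \<subseteq> U" "emeasure lborel (U - N) < ennreal d"
    using outer_regular_lborel \<open>d > 0\<close> by metis
  have "emeasure lborel U \<le> emeasure lborel (U - N) + emeasure lborel N"
    using U N by (subst emeasure_Un_null_set[symmetric]) (auto intro!: emeasure_mono simp: null_sets_def)
  then have Ud: "emeasure lborel U < ennreal d" using U(3) N by (simp add: null_setsD1)
  \<comment> \<open>The tags of the covering intervals lie in \<open>N\<close>, hence in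
    \<open>U\<close>, so each interval stays inside \<open>U\<close>. The value off \<open>U\<close>
    is a default.\<close>
  define g where "g x = (if x \<in> U then U else UNIV)" for x
  have "gauge g" unfolding gauge_def g_def using U(1) by auto
  \<comment> \<open>The box is enlarged by 1 because the covering lemma wants a nonempty interior,
    also for k = 0.\<close>
  let ?c = "-real k - 1" and ?d = "real k + 1"
  have S: "N \<inter> {-real k..real k} \<subseteq> cbox ?c ?d" "box ?c ?d \<noteq> {}" by (auto simp: box_real)
  have "\<exists>\<D>. countable \<D> \<and> \<Union>\<D> \<subseteq> cbox ?c ?d \<and>
    (\<forall>K\<in>\<D>. interior K \<noteq> {} \<and> (\<exists>c d. K = cbox c d)) \<and>
    pairwise (\<lambda>A B. interior A \<inter> interior B = {}) \<D> \<and>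
    (\<forall>K\<in>\<D>. \<exists>x \<in> (N \<inter> {-real k..real k}) \<inter> K. K \<subseteq> g x) \<and>
    N \<inter> {-real k..real k} \<subseteq> \<Union>\<D>"
  proof (rule covering_lemma[OF S \<open>gauge g\<close>], goal_cases)
    case (1 \<D>)
    show ?case by (intro exI[of _ \<D>] conjI ballI) (use 1 in blast)+
  qed
  then obtain \<D> where D: "countable \<D>" "\<Union>\<D> \<subseteq> cbox ?c ?d"
    "\<forall>K\<in>\<D>. interior K \<noteq> {} \<and> (\<exists>c d. K = cbox c d)"
    "pairwise (\<lambda>A B. interior A \<inter> interior B = {}) \<D>"
    "\<forall>K\<in>\<D>. \<exists>x \<in> (N \<inter> {-real k..real k}) \<inter> K. K \<subseteq> g x"
    "N \<inter> {-real k..real k} \<subseteq> \<Union>\<D>"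
    by (elim exE conjE)
  have DU: "K \<subseteq> U" if "K \<in> \<D>" for K
    using bspec[OF D(5) that] U(2) by (auto simp: g_def split: if_splits)
  have KD: "K = {Inf K..Sup K} \<and> Inf K < Sup K" if KD: "K \<in> \<D>" for K
  proof -
    obtain c d where K: "K = {c..d}" using bspec[OF D(3) KD] by (auto simp: box_real)
    then have "c < d" using bspec[OF D(3) KD] by (auto simp: interior_atLeastAtMost_real)
    then show ?thesis using K by simp
  qed
  have fin: "(\<Sum>K\<in>D'. emeasure ?\<nu> K) \<le> ennreal e" if D': "finite D'" "D' \<subseteq> \<D>" for D'
  proof -
    \<comment> \<open>Clamping to \<open>[a,b]\<close> brings the intervals into the domain of
      \<open>F\<close>. It only shrinks them and leaves the increments of \<open>G\<close> as they
      are.\<close>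
    let ?cl = "\<lambda>x. max a (min b x)"
    have dj: "{Inf K<..<Sup K} \<inter> {Inf K'<..<Sup K'} = {}" if "K \<in> D'" "K' \<in> D'" "K \<noteq> K'" for K K'
    proof -
      have "interior K \<inter> interior K' = {}" using D(4) that D'(2) by (auto simp: pairwise_def)
      moreover have "interior K = {Inf K<..<Sup K}" if "K \<in> \<D>" for K
        using KD[OF that] by (metis interior_atLeastAtMost_real)
      ultimately show ?thesis using that D'(2) by (metis subsetD)
    qed
    have "ennreal (\<Sum>K\<in>D'. Sup K - Inf K) = (\<Sum>K\<in>D'. emeasure lborel {Inf K<..<Sup K})"
    proof -
      have "Inf K \<le> Sup K" if "K \<in> D'" for K using KD[of K] that D'(2) by auto
      then show ?thesis by (subst sum_ennreal[symmetric]) auto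
    qed
    also have "\<dots> = emeasure lborel (\<Union>K\<in>D'. {Inf K<..<Sup K})"
      using dj D'(1) by (intro sum_emeasure) (auto simp: disjoint_family_on_def)
    also have "\<dots> \<le> emeasure lborel U"
    proof (rule emeasure_mono)
      show "(\<Union>K\<in>D'. {Inf K<..<Sup K}) \<subseteq> U"
      proof
        fix x assume "x \<in> (\<Union>K\<in>D'. {Inf K<..<Sup K})"
        then obtain K where "K \<in> D'" "x \<in> {Inf K..Sup K}" by auto
        then show "x \<in> U" using DU KD D'(2) by blast
      qed
    qed (use U(1) in auto)
    finally have len: "(\<Sum>K\<in>D'. Sup K - Inf K) < d" using Ud
      using \<open>d > 0\<close> by (metis ennreal_less_iff ennreal_leI leD le_less_trans less_le_not_le linorder_not_less)
    have "(\<Sum>K\<in>D'. dist (F (?cl (Inf K))) (F (?cl (Sup K)))) < e"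
    proof (rule d)
      have "{?cl (Inf K)<..<?cl (Sup K)} \<subseteq> {Inf K<..<Sup K}" for K by (auto simp: max_def min_def split: if_splits)
      then have "{?cl (Inf K)<..<?cl (Sup K)} \<inter> {?cl (Inf K')<..<?cl (Sup K')} = {}"
        if "K \<in> D'" "K' \<in> D'" "K \<noteq> K'" for K K'
        using dj[OF that] by blast
      moreover have "?cl (Inf K) \<le> ?cl (Sup K)" if "K \<in> D'" for K
      proof -
        have "Inf K \<le> Sup K" using KD that D'(2) by force
        then show ?thesis by (auto simp: max_def min_def)
      qed
      ultimately show "nonoverlapping a b D' (\<lambda>K. ?cl (Inf K)) (\<lambda>K. ?cl (Sup K))"
        unfolding nonoverlapping_def using D'(1) ab by auto
      have "(\<Sum>K\<in>D'. ?cl (Sup K) - ?cl (Inf K)) \<le> (\<Sum>K\<in>D'. Sup K - Inf K)"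
      proof (rule sum_mono)
        fix K assume "K \<in> D'"
        then have "Inf K \<le> Sup K" using KD D'(2) by force
        then show "?cl (Sup K) - ?cl (Inf K) \<le> Sup K - Inf K" using ab by (auto simp: max_def min_def)
      qed
      then show "(\<Sum>K\<in>D'. ?cl (Sup K) - ?cl (Inf K)) < d" using len by linarith
    qed
    moreover have "dist (F (?cl (Inf K))) (F (?cl (Sup K))) = G (Sup K) - G (Inf K)" if "K \<in> D'" for K
      using KD[of K] that D'(2) monoD[OF mG, of "Inf K" "Sup K"] by (auto simp: G_def dist_real_def)
    ultimately have "(\<Sum>K\<in>D'. G (Sup K) - G (Inf K)) < e" by simp
    moreover have "(\<Sum>K\<in>D'. emeasure ?\<nu> K) = ennreal (\<Sum>K\<in>D'. G (Sup K) - G (Inf K))"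
    proof -
      have "emeasure ?\<nu> K = ennreal (G (Sup K) - G (Inf K))" if "K \<in> D'" for K
        using KD[of K] that D'(2) Icc[of "Inf K" "Sup K"] by auto
      moreover have "0 \<le> G (Sup K) - G (Inf K)" if "K \<in> D'" for K
        using KD[of K] that D'(2) monoD[OF mG, of "Inf K" "Sup K"] by auto
      ultimately show ?thesis by (simp add: sum_ennreal)
    qed
    ultimately show ?thesis by (simp add: ennreal_leI)
  qed
  have "emeasure ?\<nu> (N \<inter> {-real k..real k}) \<le> emeasure ?\<nu> (\<Union>\<D>)"
  proof (rule emeasure_mono[OF D(6)])
    have "closed K" if "K \<in> \<D>" for K using KD[OF that] by (metis closed_atLeastAtMost)
    then show "\<Union>\<D> \<in> sets ?\<nu>"
      using D(1) by (auto intro!: sets.countable_Union)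
  qed
  also have "\<dots> \<le> ennreal e"
  proof (cases "\<D> = {}")
    case False
    define A where "A n = (\<Union>K\<in>from_nat_into \<D> ` {..<n}. K)" for n
    have fD: "from_nat_into \<D> ` {..<n} \<subseteq> \<D>" for n using from_nat_into[OF False] by auto
    have bor: "K \<in> sets borel" if "K \<in> \<D>" for K using KD[OF that] by (metis borel_closed closed_atLeastAtMost)
    have "(\<Union>n. A n) = \<Union>(range (from_nat_into \<D>))"
      unfolding A_def by (auto intro: lessI)
    then have "\<Union>\<D> = (\<Union>n. A n)"
      by (simp only: range_from_nat_into[OF False D(1)])
    moreover have "(SUP n. emeasure ?\<nu> (A n)) = emeasure ?\<nu> (\<Union>n. A n)"
    proof (rule SUP_emeasure_incseq)
      show "range A \<subseteq> sets ?\<nu>" unfolding A_def using bor fD by (auto intro!: sets.finite_UN)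
      show "incseq A" unfolding A_def by (auto simp: incseq_def intro: less_le_trans)
    qed
    moreover have "emeasure ?\<nu> (A n) \<le> ennreal e" for n
    proof -
      have "emeasure ?\<nu> (A n) \<le> (\<Sum>K\<in>from_nat_into \<D> ` {..<n}. emeasure ?\<nu> K)"
        unfolding A_def using bor fD by (intro emeasure_subadditive_finite) auto
      then show ?thesis using fin[OF _ fD[of n]] by (meson finite_imageI finite_lessThan order_trans)
    qed
    ultimately show ?thesis by (metis SUP_least)
  qed simp
  finally show ?thesis .
qed

text \<open>Continued by constants outside \<open>[a,b]\<close>, \<open>F\<close> is the
  distribution function of a measure on the line. Absolute continuity of the function turns into
  absolute continuity of the measure, which is what Radon-Nikodym asks for; null sets are exhausted
  by their bounded parts.\<close>

lemma interval_measure_absolutely_continuous: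
  fixes F :: "real \<Rightarrow> real"
  assumes ac: "absolutely_continuous_curve a b F" and ab: "a \<le> b" and mono: "mono_on {a..b} F"
  defines "G \<equiv> \<lambda>x. F (max a (min b x))"
  shows "mono G" "continuous_on UNIV G" "absolutely_continuous lborel (interval_measure G)"
proof -
  show mG: "mono G"
    unfolding G_def using ab by (intro monoI mono_onD[OF mono]) auto
  show cG: "continuous_on UNIV G"
    unfolding G_def
    by (rule continuous_on_compose2[OF absolutely_continuous_curve_continuous[OF ac]])
       (use ab in \<open>auto intro!: continuous_intros\<close>)
  let ?\<nu> = "interval_measure G"
  have small: "emeasure ?\<nu> (N \<inter> {-real k..real k}) \<le> ennreal e"
    if "N \<in> null_sets lborel" "e > 0" for N k e
    using interval_measure_null_set_small[OF ac ab that] mG cG unfolding G_def by blast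
  show "absolutely_continuous lborel ?\<nu>"
    unfolding absolutely_continuous_def
  proof
    fix N :: "real set" assume N: "N \<in> null_sets lborel"
    have "N \<inter> {-real k..real k} \<in> null_sets ?\<nu>" for k
    proof -
      have "emeasure ?\<nu> (N \<inter> {-real k..real k}) \<le> 0"
        by (rule ennreal_le_epsilon) (use small[OF N] in auto)
      then show ?thesis using N by (auto simp: null_sets_def)
    qed
    then have "(\<Union>k. N \<inter> {-real k..real k}) \<in> null_sets ?\<nu>" by (rule null_sets_UN)
    moreover have "(\<Union>k. N \<inter> {-real k..real k}) = N"
    proof -
      have "\<exists>k. x \<in> {-real k..real k}" for x :: real
      proof -
        obtain k where "\<bar>x\<bar> \<le> real k" using real_arch_simple by blast
        then show ?thesis by (intro exI[of _ k]) (simp add: abs_le_iff)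
      qed
      then show ?thesis by blast
    qed
    ultimately show "N \<in> null_sets ?\<nu>" by simp
  qed
qed

text \<open>The density is the Radon-Nikodym derivative of the Stieltjes measure of
  \<open>F\<close>.\<close>

lemma mono_absolutely_continuous_density:
  fixes F :: "real \<Rightarrow> real"
  assumes ac: "absolutely_continuous_curve a b F" and ab: "a \<le> b" and mono: "mono_on {a..b} F"
  obtains p where "p absolutely_integrable_on {a..b}"
    "\<And>t. t \<in> {a..b} \<Longrightarrow> F t - F a = integral {a..t} p"
proof -
  define G where "G = (\<lambda>x. F (max a (min b x)))"
  note G = interval_measure_absolutely_continuous[OF assms, folded G_def]
  obtain f where f: "f \<in> borel_measurable lborel" "density lborel f = interval_measure G"
    using sigma_finite_measure.Radon_Nikodym[OF sigma_finite_lborel G(3)] by auto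
  have Icc: "(\<integral>\<^sup>+x. f x * indicator {a..t} x \<partial>lborel) = ennreal (F t - F a)" if "t \<in> {a..b}" for t
  proof -
    have "(\<integral>\<^sup>+x. f x * indicator {a..t} x \<partial>lborel) = emeasure (interval_measure G) {a..t}"
      unfolding f(2)[symmetric] using f(1) by (simp add: emeasure_density)
    also have "\<dots> = ennreal (G t - G a)"
      using G that by (intro emeasure_interval_measure_Icc) (auto dest: monoD intro: continuous_on_subset)
    also have "G t - G a = F t - F a" using that by (simp add: G_def)
    finally show ?thesis .
  qed
  have fm: "(\<lambda>x. f x * indicator {a..b} x) \<in> borel_measurable lborel" using f(1) by measurable
  \<comment> \<open>The density has the finite integral F b - F a over \<open>[a,b]\<close>, so it
    is finite almost everywhere there and \<open>enn2real\<close> loses nothing.\<close>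
  have AE: "AE x in lborel. f x * indicator {a..b} x \<noteq> \<infinity>"
    by (rule nn_integral_PInf_AE[OF fm]) (use Icc[of b] ab in auto)
  define p where "p x = enn2real (f x)" for x
  have pm: "p \<in> borel_measurable lborel" unfolding p_def using f(1) by measurable
  have p_nonneg: "0 \<le> p x" for x by (simp add: p_def)
  have nn: "(\<integral>\<^sup>+x. ennreal (indicator {a..t} x *\<^sub>R p x) \<partial>lborel) = ennreal (F t - F a)" if "t \<in> {a..b}" for t
    unfolding Icc[OF that, symmetric]
  proof (rule nn_integral_cong_AE)
    show "AE x in lborel. ennreal (indicator {a..t} x *\<^sub>R p x) = f x * indicator {a..t} x"
      using AE
    proof eventually_elim
      case (elim x)
      then show ?case using that
        by (cases "x \<in> {a..t}") (auto simp: p_def indicator_def less_top)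
    qed
  qed
  have Ft: "0 \<le> F t - F a" if "t \<in> {a..b}" for t using mono_onD[OF mono, of a t] that ab by auto
  have si: "set_integrable lborel {a..t} p" if "t \<in> {a..b}" for t
    unfolding set_integrable_def
  proof (rule integrableI_nonneg)
    show "(\<lambda>x. indicator {a..t} x *\<^sub>R p x) \<in> borel_measurable lborel" using pm by measurable
  qed (use nn[OF that] in \<open>auto simp: p_def\<close>)
  show ?thesis
  proof (rule that)
    have "set_integrable lborel {a..b} p" using si[of b] ab by auto
    then show "p absolutely_integrable_on {a..b}"
      unfolding set_integrable_def using pm by (subst integrable_completion) auto
    fix t assume t: "t \<in> {a..b}"
    have "integral {a..t} p = (LINT x:{a..t}|lborel. p x)"
      using set_borel_integral_eq_integral(2)[OF si[OF t]] by simp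
    also have "\<dots> = enn2real (\<integral>\<^sup>+x. ennreal (indicator {a..t} x *\<^sub>R p x) \<partial>lborel)"
      unfolding set_lebesgue_integral_def using pm
      by (intro integral_eq_nn_integral) (auto simp: p_nonneg)
    also have "\<dots> = F t - F a" using nn[OF t] Ft[OF t] by simp
    finally show "F t - F a = integral {a..t} p" by simp
  qed
qed

text \<open>Jordan decomposition: the variation V and the sum V + f are both increasing and
  absolutely continuous, and f is their difference.\<close>

lemma absolutely_continuous_density_real:
  fixes f :: "real \<Rightarrow> real"
  assumes ac: "absolutely_continuous_curve a b f" and ab: "a \<le> b"
  obtains p where "p absolutely_integrable_on {a..b}"
    "\<And>t. t \<in> {a..b} \<Longrightarrow> f t - f a = integral {a..t} p"
proof -
  let ?V = "chain_var f a"
  have step: "dist (f c) (f t) \<le> ?V t - ?V c" if "a \<le> c" "c \<le> t" "t \<le> b" for c t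
    using chain_var_step[OF ac that] by linarith
  have Vac: "absolutely_continuous_curve a b ?V" by (rule chain_var_absolutely_continuous[OF ac])
  have ac2: "absolutely_continuous_curve a b (\<lambda>t. ?V t + f t)"
  \<comment> \<open>Increments of \<open>f\<close> are dominated by those of V, so those of the sum
    are dominated by twice those of V.\<close>
  proof (rule absolutely_continuous_curve_controlled[OF Vac, of 2])
    fix u v assume "a \<le> u" "u \<le> v" "v \<le> b"
    then show "dist (?V u + f u) (?V v + f v) \<le> 2 * dist (?V u) (?V v)"
      using step[of u v] unfolding dist_real_def by (auto simp: abs_if split: if_splits)
  qed simp
  have m1: "mono_on {a..b} ?V"
  proof (rule mono_onI)
    fix r s assume "r \<in> {a..b}" "s \<in> {a..b}" "r \<le> s"
    then show "?V r \<le> ?V s" using step[of r s] zero_le_dist[of "f r" "f s"] by (simp del: zero_le_dist)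
  qed
  have m2: "mono_on {a..b} (\<lambda>t. ?V t + f t)"
  proof (rule mono_onI)
    fix r s assume "r \<in> {a..b}" "s \<in> {a..b}" "r \<le> s"
    then show "?V r + f r \<le> ?V s + f s" using step[of r s] by (simp add: dist_real_def)
  qed
  obtain p1 where p1: "p1 absolutely_integrable_on {a..b}"
    "\<And>t. t \<in> {a..b} \<Longrightarrow> ?V t - ?V a = integral {a..t} p1"
    using mono_absolutely_continuous_density[OF Vac ab m1] by metis
  obtain p2 where p2: "p2 absolutely_integrable_on {a..b}"
    "\<And>t. t \<in> {a..b} \<Longrightarrow> ?V t + f t - (?V a + f a) = integral {a..t} p2"
    using mono_absolutely_continuous_density[OF ac2 ab m2] by metis
  show ?thesis
  proof (rule that)
    show "(\<lambda>x. p2 x - p1 x) absolutely_integrable_on {a..b}"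
      using p1(1) p2(1) by (rule set_integral_diff(1)[rotated])
    fix t assume t: "t \<in> {a..b}"
    have "p1 integrable_on {a..t}" "p2 integrable_on {a..t}"
      using p1(1) p2(1) t by (auto intro!: set_lebesgue_integral_eq_integral(1) intro: set_integrable_subset)
    then have "integral {a..t} (\<lambda>x. p2 x - p1 x) = integral {a..t} p2 - integral {a..t} p1"
      by (intro integral_diff)
    then show "f t - f a = integral {a..t} (\<lambda>x. p2 x - p1 x)"
      using p1(2)[OF t] p2(2)[OF t] by linarith
  qed
qed

text \<open>The densities of the components are assembled into \<open>p\<close>. Differentiating the
  integral of \<open>p\<close> shows that \<open>velocity f\<close> agrees with \<open>p\<close>
  almost everywhere, so what holds for the integrals of \<open>p\<close> passes to the
  velocity.\<close>

theorem absolutely_continuous_FTC: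
  fixes f :: "real \<Rightarrow> 'a::euclidean_space"
  assumes ac: "absolutely_continuous_curve a b f" and ab: "a \<le> b"
  shows "\<exists>N. negligible N \<and> (\<forall>t\<in>{a<..<b} - N. (f has_vector_derivative velocity f t) (at t))"
    and "velocity f absolutely_integrable_on {a..b}"
    and "\<And>u v. a \<le> u \<Longrightarrow> u \<le> v \<Longrightarrow> v \<le> b \<Longrightarrow> f v - f u = integral {u..v} (velocity f)"
proof -
  have "\<exists>p. p absolutely_integrable_on {a..b} \<and> (\<forall>t\<in>{a..b}. f t \<bullet> i - f a \<bullet> i = integral {a..t} p)" for i :: 'a
  proof -
    have "absolutely_continuous_curve a b (\<lambda>t. f t \<bullet> i)"
    proof (rule absolutely_continuous_curve_controlled[OF ac, of "norm i"])
      fix u v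
      have "\<bar>(f u - f v) \<bullet> i\<bar> \<le> norm (f u - f v) * norm i" by (rule Cauchy_Schwarz_ineq2)
      then show "dist (f u \<bullet> i) (f v \<bullet> i) \<le> norm i * dist (f u) (f v)"
        by (simp add: dist_real_def dist_norm inner_diff_left mult.commute)
    qed simp
    then show ?thesis using absolutely_continuous_density_real ab by metis
  qed
  then obtain P where P: "\<And>i. P i absolutely_integrable_on {a..b}"
    "\<And>i t. t \<in> {a..b} \<Longrightarrow> f t \<bullet> i - f a \<bullet> i = integral {a..t} (P i)" by metis
  define p where "p t = (\<Sum>i\<in>Basis. P i t *\<^sub>R i)" for t
  have p: "p absolutely_integrable_on {a..b}"
  proof (rule absolutely_integrable_componentwise)
    fix i :: 'a assume "i \<in> Basis"
    then have "(\<lambda>x. p x \<bullet> i) = P i" by (simp add: p_def fun_eq_iff)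
    then show "(\<lambda>x. p x \<bullet> i) absolutely_integrable_on {a..b}" using P(1)[of i] by simp
  qed
  have pa: "f t = f a + integral {a..t} p" if t: "t \<in> {a..b}" for t
  proof (rule euclidean_eqI)
    fix i :: 'a assume i: "i \<in> Basis"
    have "p integrable_on {a..t}"
      using p t by (auto intro!: set_lebesgue_integral_eq_integral(1) intro: set_integrable_subset)
    then have "integral {a..t} p \<bullet> i = integral {a..t} (\<lambda>t. p t \<bullet> i)"
      by (simp add: integral_component_eq)
    also have "\<dots> = integral {a..t} (P i)" using i by (simp add: p_def inner_sum_left_Basis)
    finally show "f t \<bullet> i = (f a + integral {a..t} p) \<bullet> i"
      using P(2)[OF t, of i] by (simp add: inner_add_left)
  qed
  obtain N where N: "negligible N"
    "\<And>t. t \<in> {a<..<b} - N \<Longrightarrow> ((\<lambda>s. integral {a..s} p) has_vector_derivative p t) (at t)"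
    using vector_derivative_of_integral_ae[OF p] by blast
  have D: "(f has_vector_derivative p t) (at t)" if "t \<in> {a<..<b} - N" for t
  proof (rule has_vector_derivative_transform_within_open)
    show "((\<lambda>s. f a + integral {a..s} p) has_vector_derivative p t) (at t)"
      using N(2)[OF that] by (auto intro!: derivative_eq_intros)
    show "open {a<..<b}" "t \<in> {a<..<b}" using that by auto
    show "f a + integral {a..s} p = f s" if "s \<in> {a<..<b}" for s
      using that by (intro pa[symmetric]) simp
  qed
  then have vel: "velocity f t = p t" if "t \<in> {a<..<b} - N" for t
    using that by (simp add: vector_derivative_at)
  show "\<exists>N. negligible N \<and> (\<forall>t\<in>{a<..<b} - N. (f has_vector_derivative velocity f t) (at t))"
    using N(1) D vel by metis
  \<comment> \<open>At the endpoints a two-sided derivative depends on values of \<open>f\<close>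
    outside \<open>[a,b]\<close>, so they join the exceptional set.\<close>
  let ?N = "N \<union> {a, b}"
  have nN: "negligible ?N" using N(1) by auto
  have eq: "velocity f x = p x" if "x \<in> {a..b} - ?N" for x
    using vel[of x] that by force
  show "velocity f absolutely_integrable_on {a..b}"
    by (rule absolutely_integrable_spike[OF p nN eq])
  fix u v assume uv: "a \<le> u" "u \<le> v" "v \<le> b"
  have pi: "p integrable_on {a..b}" using p set_lebesgue_integral_eq_integral(1) by blast
  have "integral {u..v} (velocity f) = integral {u..v} p"
    by (rule integral_spike[OF nN, symmetric]) (use eq uv in auto)
  also have "\<dots> = integral {a..v} p - integral {a..u} p"
  proof -
    have "integral {a..u} p + integral {u..v} p = integral {a..v} p"
      using uv pi by (intro Henstock_Kurzweil_Integration.integral_combine integrable_on_subinterval[OF pi]) auto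
    then show ?thesis by (metis add_diff_cancel_left')
  qed
  also have "\<dots> = f v - f u" using pa[of u] pa[of v] uv by simp
  finally show "f v - f u = integral {u..v} (velocity f)" by simp
qed


section \<open>Velocities almost everywhere and arc length\<close>

lemma ae_lebesgue_onI:
  assumes "negligible N" "\<And>t. t \<in> S - N \<Longrightarrow> P t" "S \<in> sets lebesgue"
  shows "AE t in lebesgue_on S. P t"
proof -
  have "AE t in lebesgue. t \<notin> N"
    using assms(1) by (intro AE_not_in) (simp add: negligible_iff_null_sets)
  then have "AE t in lebesgue. t \<in> S \<longrightarrow> P t"
    by eventually_elim (use assms(2) in blast)
  then show ?thesis using assms(3) by (simp add: AE_restrict_space_iff)
qed

lemma absolutely_continuous_ae_differentiable:
  fixes f :: "real \<Rightarrow> 'a::euclidean_space"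
  assumes ac: "absolutely_continuous_curve a b f" and ab: "a \<le> b"
  shows "AE t in lebesgue_on {a..b}. t \<in> {a<..<b} \<and> (f has_vector_derivative velocity f t) (at t)"
proof -
  obtain N where "negligible N" "\<forall>t\<in>{a<..<b} - N. (f has_vector_derivative velocity f t) (at t)"
    using absolutely_continuous_FTC(1)[OF ac ab] by blast
  then show ?thesis by (intro ae_lebesgue_onI[of "N \<union> {a,b}"]) force+
qed

text \<open>An isolated point is the only point of \<open>S\<close> in some interval with rational
  ends, and there are only countably many such intervals.\<close>

lemma countable_isolated_points:
  fixes S :: "real set"
  shows "countable {x \<in> S. \<not> x islimpt S}"
proof -
  have "{x \<in> S. \<not> x islimpt S} \<subseteq> (\<Union>(p, q)\<in>\<rat> \<times> \<rat>. {x. S \<inter> {p<..<q} = {x}})"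
  proof
    fix x assume x: "x \<in> {x \<in> S. \<not> x islimpt S}"
    then obtain e where e: "e > 0" "\<And>y. y \<in> S \<Longrightarrow> dist y x < e \<Longrightarrow> y = x"
      by (auto simp: islimpt_approachable)
    obtain p where p: "p \<in> \<rat>" "x - e < p" "p < x" using Rats_dense_in_real[of "x - e" x] e by auto
    obtain q where q: "q \<in> \<rat>" "x < q" "q < x + e" using Rats_dense_in_real[of x "x + e"] e by auto
    have "S \<inter> {p<..<q} = {x}"
    proof
      show "S \<inter> {p<..<q} \<subseteq> {x}" using e(2) p q by (auto simp: dist_real_def abs_less_iff)
    qed (use x p q in auto)
    then show "x \<in> (\<Union>(p, q)\<in>\<rat> \<times> \<rat>. {x. S \<inter> {p<..<q} = {x}})" using p q by auto
  qed
  moreover have "countable (\<Union>(p, q)\<in>\<rat> \<times> \<rat>. {x. S \<inter> {p<..<q} = {x}})"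
  proof (intro countable_UN)
    show "countable ((\<rat>::real set) \<times> (\<rat>::real set))" by (intro countable_SIGMA countable_rat)
    fix y :: "real \<times> real"
    have "x = z" if "S \<inter> {fst y<..<snd y} = {x}" "S \<inter> {fst y<..<snd y} = {z}" for x z
      using that by blast
    then have "\<exists>z. {x. S \<inter> {fst y<..<snd y} = {x}} \<subseteq> {z}" by blast
    then obtain z where "{x. S \<inter> {fst y<..<snd y} = {x}} \<subseteq> {z}" by blast
    then have "countable {x. S \<inter> {fst y<..<snd y} = {x}}" by (rule countable_subset) simp
    then show "countable (case y of (p, q) \<Rightarrow> {x. S \<inter> {p<..<q} = {x}})"
      by (simp add: case_prod_beta)
  qed
  ultimately show ?thesis by (rule countable_subset)
qed

text \<open>Up to the countably many isolated points of the level set, t is a limit of times with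
  the same value of \<open>f\<close>, and difference quotients along these are zero.\<close>

lemma velocity_zero_on_level_set:
  fixes f :: "real \<Rightarrow> 'a::euclidean_space"
  assumes ac: "absolutely_continuous_curve a b f" and ab: "a \<le> b"
  shows "AE t in lebesgue_on {a..b}. f t = c \<longrightarrow> velocity f t = 0"
proof -
  let ?S = "{t. f t = c}"
  let ?I = "{x \<in> ?S. \<not> x islimpt ?S}"
  have neg: "negligible ?I" by (intro negligible_iff_null_sets[THEN iffD2] null_sets_completionI countable_imp_null_set_lborel countable_isolated_points)
  have "AE t in lebesgue_on {a..b}. t \<notin> ?I" by (rule ae_lebesgue_onI[OF neg]) auto
  with absolutely_continuous_ae_differentiable[OF ac ab] show ?thesis
  proof eventually_elim
    case (elim t)
    show ?case
    proof
      assume t: "f t = c"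
      then have lim: "t islimpt ?S" using elim by auto
      have D: "(f has_vector_derivative velocity f t) (at t)" using elim by blast
      then have "((\<lambda>y. (f y - f t - (y - t) *\<^sub>R velocity f t) /\<^sub>R norm (y - t)) \<longlongrightarrow> 0) (at t)"
        unfolding has_vector_derivative_def has_derivative_at_within by (simp add: divide_inverse_commute)
      then have lim0: "((\<lambda>y. (f y - f t - (y - t) *\<^sub>R velocity f t) /\<^sub>R norm (y - t)) \<longlongrightarrow> 0) (at t within ?S)"
        by (rule tendsto_within_subset) auto
      have "((\<lambda>y. norm ((f y - f t - (y - t) *\<^sub>R velocity f t) /\<^sub>R norm (y - t))) \<longlongrightarrow> 0) (at t within ?S)"
        using tendsto_norm[OF lim0] by simp
      \<comment> \<open>Along the level set the remainder of the first-order expansion is -(y - t)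
        times the velocity. After division its norm is the constant |velocity|, although it tends to
        0.\<close>
      moreover have "\<forall>\<^sub>F y in at t within ?S. norm ((f y - f t - (y - t) *\<^sub>R velocity f t) /\<^sub>R norm (y - t)) = norm (velocity f t)"
        by (rule eventually_at_topological[THEN iffD2]) (intro exI[of _ UNIV], use t in \<open>auto simp: abs_mult\<close>)
      ultimately have "((\<lambda>y. norm (velocity f t)) \<longlongrightarrow> 0) (at t within ?S)"
        by (simp add: tendsto_cong)
      moreover have "at t within ?S \<noteq> bot" using lim by (simp add: trivial_limit_within)
      ultimately show "velocity f t = 0" by (simp add: tendsto_const_iff)
    qed
  qed
qed

definition arclength :: "real \<Rightarrow> (real \<Rightarrow> 'a::euclidean_space) \<Rightarrow> real \<Rightarrow> real" where
  "arclength a f t = integral {a..t} (\<lambda>s. norm (velocity f s))"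

text \<open>Two functions whose increments bound distances along a curve are used below: the
  variation, known to be absolutely continuous, and the arc length, whose derivative is the
  speed.\<close>

lemma
  fixes f :: "real \<Rightarrow> 'a::euclidean_space"
  assumes ac: "absolutely_continuous_curve a b f" and ab: "a \<le> b"
  shows dist_le_arclength: "\<And>u v. a \<le> u \<Longrightarrow> u \<le> v \<Longrightarrow> v \<le> b \<Longrightarrow> dist (f u) (f v) \<le> arclength a f v - arclength a f u"
    and arclength_continuous: "continuous_on {a..b} (arclength a f)"
    and arclength_derivative: "AE t in lebesgue_on {a..b}. (arclength a f has_vector_derivative norm (velocity f t)) (at t)"
    and arclength_eq_curve_length: "arclength a f b = curve_length a b f"
proof -
  let ?n = "\<lambda>s. norm (velocity f s)"
  have v: "velocity f absolutely_integrable_on {a..b}" by (rule absolutely_continuous_FTC(2)[OF ac ab])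
  then have n: "?n absolutely_integrable_on {a..b}" by (rule absolutely_integrable_norm[unfolded o_def])
  have ni: "?n integrable_on {a..b}" using n set_lebesgue_integral_eq_integral(1) by blast
  have vi: "velocity f integrable_on {a..b}" using v set_lebesgue_integral_eq_integral(1) by blast
  fix u v assume uv: "a \<le> u" "u \<le> v" "v \<le> b"
  have "arclength a f u + integral {u..v} ?n = arclength a f v"
    unfolding arclength_def
    using uv ni by (intro Henstock_Kurzweil_Integration.integral_combine integrable_on_subinterval[OF ni]) auto
  moreover have "norm (integral {u..v} (velocity f)) \<le> integral {u..v} ?n"
    using uv by (intro integral_norm_bound_integral integrable_on_subinterval[OF ni] integrable_on_subinterval[OF vi]) auto
  moreover have "f v - f u = integral {u..v} (velocity f)"
    by (rule absolutely_continuous_FTC(3)[OF ac ab uv])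
  ultimately show "dist (f u) (f v) \<le> arclength a f v - arclength a f u"
    by (simp add: dist_norm norm_minus_commute[of "f u"])
next
  let ?n = "\<lambda>s. norm (velocity f s)"
  have v: "velocity f absolutely_integrable_on {a..b}" by (rule absolutely_continuous_FTC(2)[OF ac ab])
  then have n: "?n absolutely_integrable_on {a..b}" by (rule absolutely_integrable_norm[unfolded o_def])
  have ni: "?n integrable_on {a..b}" using n set_lebesgue_integral_eq_integral(1) by blast
  show "continuous_on {a..b} (arclength a f)"
    unfolding arclength_def by (rule indefinite_integral_continuous_1[OF ni])
  obtain N where "negligible N"
    "\<And>t. t \<in> {a<..<b} - N \<Longrightarrow> ((\<lambda>s. integral {a..s} ?n) has_vector_derivative ?n t) (at t)"
    using vector_derivative_of_integral_ae[OF n] by blast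
  then show "AE t in lebesgue_on {a..b}. (arclength a f has_vector_derivative norm (velocity f t)) (at t)"
    unfolding arclength_def by (intro ae_lebesgue_onI[of "N \<union> {a,b}"]) force+
  show "arclength a f b = curve_length a b f"
    unfolding arclength_def curve_length_def
    using n by (intro lebesgue_integral_eq_integral[symmetric]) (auto simp: integrable_restrict_space set_integrable_def)
qed

text \<open>At almost every time both functions are differentiable, so it suffices to compare their
  difference quotients for positive increments.\<close>

lemma velocity_bound_of_arclength:
  fixes f :: "real \<Rightarrow> 'a::euclidean_space" and g :: "real \<Rightarrow> real"
  assumes f: "absolutely_continuous_curve a b f" and g: "absolutely_continuous_curve a b g" and ab: "a \<le> b"
    and K: "\<And>u v. a \<le> u \<Longrightarrow> u \<le> v \<Longrightarrow> v \<le> b \<Longrightarrow> dist (g u) (g v) \<le> K * (arclength a f v - arclength a f u)"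
  shows "AE t in lebesgue_on {a..b}. \<bar>velocity g t\<bar> \<le> K * norm (velocity f t)"
  using absolutely_continuous_ae_differentiable[OF g ab] arclength_derivative[OF f ab]
proof eventually_elim
  case (elim t)
  have tend: "((\<lambda>h. (F (t + h) - F t) / h) \<longlongrightarrow> D) (at_right 0)"
    if "(F has_vector_derivative D) (at t)" for F :: "real \<Rightarrow> real" and D
  proof -
    have "(F has_field_derivative D) (at t)"
      using that by (simp add: has_real_derivative_iff_has_vector_derivative)
    then have "((\<lambda>h. (F (t + h) - F t) / h) \<longlongrightarrow> D) (at 0)"
      by (simp add: DERIV_def)
    then show ?thesis by (rule tendsto_within_subset) auto
  qed
  have 1: "((\<lambda>h. \<bar>(g (t + h) - g t) / h\<bar>) \<longlongrightarrow> \<bar>velocity g t\<bar>) (at_right 0)"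
    using elim by (intro tendsto_rabs tend) auto
  have 2: "((\<lambda>h. K * ((arclength a f (t + h) - arclength a f t) / h)) \<longlongrightarrow> K * norm (velocity f t)) (at_right 0)"
    using elim by (intro tendsto_mult_left tend) auto
  show ?case
  proof (rule tendsto_le[OF _ 2 1])
    have "\<forall>\<^sub>F h in at_right 0. h \<in> {0<..<b - t}"
      using elim eventually_at_right_real[of 0 "b - t"] by auto
    then show "\<forall>\<^sub>F h in at_right 0. \<bar>(g (t + h) - g t) / h\<bar> \<le> K * ((arclength a f (t + h) - arclength a f t) / h)"
    proof eventually_elim
      case (elim h)
      then have "\<bar>g (t + h) - g t\<bar> \<le> K * (arclength a f (t + h) - arclength a f t)"
        using K[of t "t + h"] \<open>t \<in> {a<..<b} \<and> _\<close> by (auto simp: dist_real_def abs_minus_commute)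
      then show ?case using elim by (simp add: abs_divide divide_right_mono)
    qed
  qed simp
qed

lemma lipschitz_absolutely_continuous:
  assumes "L-lipschitz_on {a..b} f"
  shows "absolutely_continuous_curve a b f"
proof (rule absolutely_continuous_curve_controlled[of _ _ "\<lambda>x. x" L])
  show "absolutely_continuous_curve a b (\<lambda>x. x)"
    unfolding absolutely_continuous_curve_def by (auto simp: dist_real_def abs_minus_commute intro!: exI)
qed (use assms lipschitz_on_nonneg lipschitz_onD in force)+


section \<open>Geometry of the network\<close>

abbreviation arc_trace :: "'a arc \<Rightarrow> 'a set" where
  "arc_trace \<gamma> \<equiv> arc_pt \<gamma> ` {0..arc_len \<gamma>}"

lemma arc_len_inverse [simp]: "arc_len (inverse_arc \<gamma>) = arc_len \<gamma>"
  by (simp add: inverse_arc_def)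

lemma arc_pt_inverse [simp]: "s \<in> {0..arc_len \<gamma>} \<Longrightarrow> arc_pt (inverse_arc \<gamma>) s = arc_pt \<gamma> (arc_len \<gamma> - s)"
  by (simp add: inverse_arc_def)

section \<open>A single arc: parameters against points\<close>

text \<open>Mean value inequality for x \<mapsto> \<gamma>(x) - x w. With w = 0 it gives the
  Lipschitz bound, with w the velocity at one end the local expansion.\<close>

lemma regular_arc_taylor:
  fixes \<gamma> :: "'a::euclidean_space arc"
  assumes reg: "regular_arc \<gamma>" and "s \<in> {0..arc_len \<gamma>}" "s' \<in> {0..arc_len \<gamma>}"
    "\<And>x. x \<in> closed_segment s s' \<Longrightarrow> norm (arc_vel \<gamma> x - w) \<le> B"
  shows "norm (arc_pt \<gamma> s' - arc_pt \<gamma> s - (s' - s) *\<^sub>R w) \<le> \<bar>s' - s\<bar> * B"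
proof -
  let ?S = "closed_segment s s'"
  have sub: "?S \<subseteq> {0..arc_len \<gamma>}" using assms(2,3) by (auto simp: closed_segment_eq_real_ivl split: if_splits)
  have "norm ((arc_pt \<gamma> s' - s' *\<^sub>R w) - (arc_pt \<gamma> s - s *\<^sub>R w) - (s' - s) *\<^sub>R (arc_vel \<gamma> s - arc_vel \<gamma> s)) \<le> norm (s' - s) * B"
  proof -
    have d: "((\<lambda>x. arc_pt \<gamma> x - x *\<^sub>R w) has_derivative (\<lambda>h. h *\<^sub>R (arc_vel \<gamma> x - w))) (at x within ?S)" if "x \<in> ?S" for x
    proof -
      have "(arc_pt \<gamma> has_vector_derivative arc_vel \<gamma> x) (at x within ?S)"
        using reg sub that unfolding regular_arc_def by (meson has_vector_derivative_within_subset subsetD)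
      then show ?thesis
        by (auto simp: has_vector_derivative_def scaleR_diff_right intro!: derivative_eq_intros)
    qed
    have "norm ((arc_pt \<gamma> s' - s' *\<^sub>R w) - (arc_pt \<gamma> s - s *\<^sub>R w)) \<le> B * norm (s' - s)"
    proof (rule differentiable_bound[OF _ d])
      fix x assume "x \<in> ?S"
      then show "onorm (\<lambda>h. h *\<^sub>R (arc_vel \<gamma> x - w)) \<le> B"
        using assms(4) by (intro onorm_le) (auto simp: mult.commute[of B] intro!: mult_left_mono)
    qed auto
    then show ?thesis by (simp add: mult.commute)
  qed
  then show ?thesis by (simp add: algebra_simps)
qed

lemma regular_arc_lipschitz:
  fixes \<gamma> :: "'a::euclidean_space arc"
  assumes reg: "regular_arc \<gamma>" shows "1-lipschitz_on {0..arc_len \<gamma>} (arc_pt \<gamma>)"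
proof (rule lipschitz_onI)
  fix s s' assume s: "s \<in> {0..arc_len \<gamma>}" "s' \<in> {0..arc_len \<gamma>}"
  have "norm (arc_pt \<gamma> s - arc_pt \<gamma> s' - (s - s') *\<^sub>R 0) \<le> \<bar>s - s'\<bar> * 1"
  proof (rule regular_arc_taylor[OF reg s(2,1)])
    fix x assume "x \<in> closed_segment s' s"
    then have "x \<in> {0..arc_len \<gamma>}" using s by (auto simp: closed_segment_eq_real_ivl split: if_splits)
    then show "norm (arc_vel \<gamma> x - 0) \<le> 1" using reg by (simp add: regular_arc_def)
  qed
  then show "dist (arc_pt \<gamma> s) (arc_pt \<gamma> s') \<le> 1 * dist s s'" by (simp add: dist_norm)
qed simp

text \<open>By uniform continuity the velocity varies by less than 1/2 over parameter distances
  below \<delta>; as the speed is 1, a chord is at least half the parameter distance. A global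
  version cannot be expected, since an arc may be a loop.\<close>

lemma regular_arc_expanding:
  fixes \<gamma> :: "'a::euclidean_space arc"
  assumes reg: "regular_arc \<gamma>"
  obtains \<delta> where "\<delta> > 0" "\<And>s s'. s \<in> {0..arc_len \<gamma>} \<Longrightarrow> s' \<in> {0..arc_len \<gamma>} \<Longrightarrow> \<bar>s - s'\<bar> < \<delta> \<Longrightarrow>
     \<bar>s - s'\<bar> \<le> 2 * dist (arc_pt \<gamma> s) (arc_pt \<gamma> s')"
proof -
  have "uniformly_continuous_on {0..arc_len \<gamma>} (arc_vel \<gamma>)"
    using reg by (intro compact_uniformly_continuous) (auto simp: regular_arc_def)
  then obtain \<delta> where d: "\<delta> > 0" "\<And>x x'. x \<in> {0..arc_len \<gamma>} \<Longrightarrow> x' \<in> {0..arc_len \<gamma>} \<Longrightarrow> dist x' x < \<delta> \<Longrightarrow>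
      dist (arc_vel \<gamma> x') (arc_vel \<gamma> x) < 1/2"
    unfolding uniformly_continuous_on_def by (metis half_gt_zero zero_less_one)
  show ?thesis
  proof (rule that[OF d(1)])
    fix s s' assume s: "s \<in> {0..arc_len \<gamma>}" "s' \<in> {0..arc_len \<gamma>}" "\<bar>s - s'\<bar> < \<delta>"
    have "norm (arc_pt \<gamma> s' - arc_pt \<gamma> s - (s' - s) *\<^sub>R arc_vel \<gamma> s) \<le> \<bar>s' - s\<bar> * (1/2)"
    proof (rule regular_arc_taylor[OF reg s(1,2)])
      fix x assume "x \<in> closed_segment s s'"
      then have "x \<in> {0..arc_len \<gamma>}" "dist x s < \<delta>"
        using s by (auto simp: closed_segment_eq_real_ivl dist_real_def split: if_splits)
      then show "norm (arc_vel \<gamma> x - arc_vel \<gamma> s) \<le> 1/2"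
        using d(2)[OF s(1)] by (simp add: dist_norm less_imp_le)
    qed
    moreover have "norm ((s' - s) *\<^sub>R arc_vel \<gamma> s) = \<bar>s' - s\<bar>" using reg s by (simp add: regular_arc_def)
    ultimately have "\<bar>s' - s\<bar> \<le> norm (arc_pt \<gamma> s' - arc_pt \<gamma> s) + \<bar>s' - s\<bar> * (1/2)"
      by (smt (verit, best) norm_triangle_ineq3)
    then show "\<bar>s - s'\<bar> \<le> 2 * dist (arc_pt \<gamma> s) (arc_pt \<gamma> s')"
      by (simp add: dist_norm norm_minus_commute abs_minus_commute)
  qed
qed

text \<open>Bounds over steps shorter than \<delta> add up because the right-hand sides telescope.
  This turns local estimates of parameters and coordinates into estimates over whole
  intervals.\<close>

lemma local_increments_imp_global:
  fixes \<sigma> \<omega> :: "real \<Rightarrow> real"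
  assumes "\<delta> > 0" "u \<le> v"
    and loc: "\<And>s t. u \<le> s \<Longrightarrow> s \<le> t \<Longrightarrow> t \<le> v \<Longrightarrow> t - s < \<delta> \<Longrightarrow> \<bar>\<sigma> t - \<sigma> s\<bar> \<le> \<omega> t - \<omega> s"
  shows "\<bar>\<sigma> v - \<sigma> u\<bar> \<le> \<omega> v - \<omega> u"
proof -
  have "\<forall>t. u \<le> t \<longrightarrow> t \<le> v \<longrightarrow> t - u \<le> real n * (\<delta>/2) \<longrightarrow> \<bar>\<sigma> t - \<sigma> u\<bar> \<le> \<omega> t - \<omega> u" for n
  proof (induction n)
    case (Suc n)
    show ?case
    proof (intro allI impI)
      fix t assume t: "u \<le> t" "t \<le> v" "t - u \<le> real (Suc n) * (\<delta>/2)"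
      define t' where "t' = max u (t - \<delta>/2)"
      have t': "u \<le> t'" "t' \<le> t" "t - t' < \<delta>" using t(1) assms(1) by (auto simp: t'_def)
      have "t' - u \<le> real n * (\<delta>/2)" using t(3) assms(1) by (auto simp: t'_def max_def algebra_simps add_divide_distrib)
      then have "\<bar>\<sigma> t' - \<sigma> u\<bar> \<le> \<omega> t' - \<omega> u" using Suc t' t by auto
      moreover have "\<bar>\<sigma> t - \<sigma> t'\<bar> \<le> \<omega> t - \<omega> t'" using loc[of t' t] t' t by auto
      ultimately show "\<bar>\<sigma> t - \<sigma> u\<bar> \<le> \<omega> t - \<omega> u" by linarith
    qed
  qed auto
  moreover obtain n where "(v - u) / (\<delta>/2) \<le> real n" using real_arch_simple by blast
  then have "v - u \<le> real n * (\<delta>/2)" using assms(1) by (simp add: field_simps)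
  ultimately show ?thesis using assms(2) by blast
qed

lemma connected_subset_of_closed_cover:
  assumes "connected C" "closed A" "closed B" "C \<subseteq> A \<union> B" "A \<inter> B \<inter> C = {}" "A \<inter> C \<noteq> {}"
  shows "C \<subseteq> A"
proof (rule ccontr)
  assume "\<not> C \<subseteq> A"
  then have "B \<inter> C \<noteq> {}" using assms(4) by auto
  then show False using assms connected_closedD[of C A B] by auto
qed

section \<open>Incidence of arcs, vertices and interior points\<close>

text \<open>The lower bound m of the arc lengths is fixed as a parameter: below this scale the
  network looks like a segment or like a star around one vertex.\<close>

locale metric_network =
  fixes E :: "'a::euclidean_space arc set" and m :: real
  assumes net: "network E" and m_pos: "m > 0" and m_le: "\<And>\<gamma>. \<gamma> \<in> E \<Longrightarrow> m \<le> arc_len \<gamma>"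
begin

lemmas net_unfolded = net[unfolded network_def]

lemmas countable_arcs = net_unfolded[THEN conjunct1]
lemmas reg = net_unfolded[THEN conjunct2, THEN conjunct1, THEN bspec]
lemmas inv_in = net_unfolded[THEN conjunct2, THEN conjunct2, THEN conjunct1, THEN bspec]
lemmas arcs_disjoint = net_unfolded[THEN conjunct2, THEN conjunct2, THEN conjunct2, THEN conjunct1,
    THEN bspec, THEN bspec, THEN mp, OF _ _ conjI]
lemmas arcs_connected = net_unfolded[THEN conjunct2, THEN conjunct2, THEN conjunct2, THEN conjunct2, THEN conjunct1,
    THEN bspec, THEN bspec]
lemmas finite_arcs_from = net_unfolded[THEN conjunct2, THEN conjunct2, THEN conjunct2, THEN conjunct2, THEN conjunct2,
    THEN conjunct1, THEN bspec]

lemma len_pos: "\<gamma> \<in> E \<Longrightarrow> 0 < arc_len \<gamma>"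
  using reg[of \<gamma>] by (simp add: regular_arc_def)

lemma arc_continuous: "\<gamma> \<in> E \<Longrightarrow> continuous_on {0..arc_len \<gamma>} (arc_pt \<gamma>)"
  using regular_arc_lipschitz[OF reg] lipschitz_on_continuous_on by blast

lemma compact_arc_trace: "\<gamma> \<in> E \<Longrightarrow> compact (arc_trace \<gamma>)"
  using arc_continuous compact_continuous_image compact_Icc by blast

lemma closed_arc_trace: "\<gamma> \<in> E \<Longrightarrow> closed (arc_trace \<gamma>)"
  using compact_arc_trace compact_imp_closed by blast

lemma trace_inverse: "arc_trace (inverse_arc \<gamma>) = arc_trace \<gamma>"
proof -
  have "arc_trace (inverse_arc \<gamma>) = (\<lambda>s. arc_pt \<gamma> (arc_len \<gamma> - s)) ` {0..arc_len \<gamma>}"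
    by (rule image_cong) auto
  also have "\<dots> = arc_pt \<gamma> ` ((\<lambda>s. arc_len \<gamma> - s) ` {0..arc_len \<gamma>})" by (simp only: image_image)
  also have "(\<lambda>s. arc_len \<gamma> - s) ` {0..arc_len \<gamma>} = {0..arc_len \<gamma>}" by (simp add: image_diff_atLeastAtMost)
  finally show ?thesis .
qed

lemma same_arc_interior:
  assumes "\<gamma> \<in> E" "s \<in> {0<..<arc_len \<gamma>}" "s' \<in> {0..arc_len \<gamma>}" "arc_pt \<gamma> s = arc_pt \<gamma> s'"
  shows "s = s'"
proof -
  have "\<forall>s\<in>{0..arc_len \<gamma>}. \<forall>s'\<in>{0..arc_len \<gamma>}. arc_pt \<gamma> s = arc_pt \<gamma> s' \<longrightarrow> s = s' \<or> {s, s'} = {0, arc_len \<gamma>}"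
    using reg[OF assms(1)] unfolding regular_arc_def by blast
  then have "s = s' \<or> {s, s'} = {0, arc_len \<gamma>}" using assms by auto
  then show ?thesis using assms(2) by (auto simp: doubleton_eq_iff)
qed

text \<open>Disjointness of distinct arcs leaves only \<gamma> and its inverse, and simplicity fixes
  the parameter. Coordinates along arcs and the choice in the overall Lagrangian are well defined
  for this reason.\<close>

lemma interior_point_unique:
  assumes "\<gamma> \<in> E" "\<gamma>' \<in> E" "s \<in> {0<..<arc_len \<gamma>}" "s' \<in> {0..arc_len \<gamma>'}" "arc_pt \<gamma> s = arc_pt \<gamma>' s'"
  shows "\<gamma>' = \<gamma> \<and> s' = s \<or> \<gamma>' = inverse_arc \<gamma> \<and> s' = arc_len \<gamma> - s"
proof -
  have "arc_pt \<gamma> ` {0<..<arc_len \<gamma>} \<inter> arc_trace \<gamma>' \<noteq> {}" using assms by blast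
  then consider "\<gamma>' = \<gamma>" | "\<gamma>' = inverse_arc \<gamma>"
    using arcs_disjoint[OF assms(1,2)] by blast
  then show ?thesis
  proof cases
    case 1 then show ?thesis using same_arc_interior assms by blast
  next
    case 2
    then have "arc_pt \<gamma> s = arc_pt \<gamma> (arc_len \<gamma> - s')" using assms by auto
    then have "s = arc_len \<gamma> - s'" using same_arc_interior[of \<gamma> s "arc_len \<gamma> - s'"] assms 2 by auto
    then show ?thesis using 2 by auto
  qed
qed

lemma vertices_eq: "vertices E = {arc_pt \<gamma> 0 | \<gamma>. \<gamma> \<in> E}"
proof
  show "vertices E \<subseteq> {arc_pt \<gamma> 0 | \<gamma>. \<gamma> \<in> E}"
  proof
    fix x assume "x \<in> vertices E"
    then obtain \<gamma> where g: "\<gamma> \<in> E" "x = arc_pt \<gamma> 0 \<or> x = arc_pt \<gamma> (arc_len \<gamma>)"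
      unfolding vertices_def by auto
    moreover have "arc_pt (inverse_arc \<gamma>) 0 = arc_pt \<gamma> (arc_len \<gamma>)" using len_pos[OF g(1)] by simp
    ultimately show "x \<in> {arc_pt \<gamma> 0 | \<gamma>. \<gamma> \<in> E}" using inv_in by (metis (mono_tags, lifting) mem_Collect_eq)
  qed
qed (auto simp: vertices_def)

lemma start_vertex: "\<gamma> \<in> E \<Longrightarrow> arc_pt \<gamma> 0 \<in> vertices E"
  and end_vertex: "\<gamma> \<in> E \<Longrightarrow> arc_pt \<gamma> (arc_len \<gamma>) \<in> vertices E"
  by (auto simp: vertices_def)

lemma vertex_on_arc:
  assumes "\<gamma> \<in> E" "s \<in> {0..arc_len \<gamma>}" "arc_pt \<gamma> s \<in> vertices E"
  shows "s = 0 \<or> s = arc_len \<gamma>"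
proof (rule ccontr)
  assume "\<not> ?thesis"
  then have s: "s \<in> {0<..<arc_len \<gamma>}" using assms(2) by auto
  obtain \<gamma>' where g: "\<gamma>' \<in> E" "arc_pt \<gamma> s = arc_pt \<gamma>' 0" using assms(3) vertices_eq by auto
  have "0 \<in> {0..arc_len \<gamma>'}" using len_pos[OF g(1)] by simp
  from interior_point_unique[OF assms(1) g(1) s this g(2)] s show False by auto
qed

text \<open>Replacing the arc by its inverse if necessary turns a vertex on it into its start, so
  that only outgoing arcs have to be considered.\<close>

lemma vertex_start_reparam:
  assumes "\<gamma> \<in> E" "s \<in> {0..arc_len \<gamma>}" "s0 \<in> {0..arc_len \<gamma>}" "arc_pt \<gamma> s0 \<in> vertices E"
  obtains \<gamma>' s' where "\<gamma>' \<in> E" "s' \<in> {0..arc_len \<gamma>'}" "arc_pt \<gamma>' s' = arc_pt \<gamma> s"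
    "arc_pt \<gamma>' 0 = arc_pt \<gamma> s0" "s' = \<bar>s - s0\<bar>"
proof -
  consider "s0 = 0" | "s0 = arc_len \<gamma>" using vertex_on_arc[OF assms(1,3,4)] by blast
  then show ?thesis
  proof cases
    case 1 then show ?thesis using that[of \<gamma> s] assms by auto
  next
    case 2
    show ?thesis
      by (rule that[of "inverse_arc \<gamma>" "arc_len \<gamma> - s"]) (use 2 assms inv_in len_pos[OF assms(1)] in auto)
  qed
qed

lemma finite_vertices_on:
  assumes "finite S" "S \<subseteq> E" shows "finite (vertices E \<inter> (\<Union>\<gamma>\<in>S. arc_trace \<gamma>))"
proof (rule finite_subset)
  show "vertices E \<inter> (\<Union>\<gamma>\<in>S. arc_trace \<gamma>) \<subseteq> (\<Union>\<gamma>\<in>S. {arc_pt \<gamma> 0, arc_pt \<gamma> (arc_len \<gamma>)})"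
  proof
    fix x assume "x \<in> vertices E \<inter> (\<Union>\<gamma>\<in>S. arc_trace \<gamma>)"
    then obtain \<gamma> s where *: "\<gamma> \<in> S" "s \<in> {0..arc_len \<gamma>}" "x = arc_pt \<gamma> s" "arc_pt \<gamma> s \<in> vertices E" by auto
    then have "s = 0 \<or> s = arc_len \<gamma>" using vertex_on_arc assms(2) by blast
    then show "x \<in> (\<Union>\<gamma>\<in>S. {arc_pt \<gamma> 0, arc_pt \<gamma> (arc_len \<gamma>)})" using * by auto
  qed
qed (use assms in auto)

section \<open>Pieces of a curve that avoid the vertices\<close>

text \<open>Away from vertices the trace of one arc and the union of the others separate the curve,
  so by connectedness it stays on one arc up to reversal. Its parameter there is continuous, hence
  by local expansion increases at most twice as much as \<omega>. The ends \<open>a\<close> and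
  \<open>b\<close> may be vertices, where a loop has two parameters; they are reached by
  limits.\<close>

lemma edge_estimate:
  fixes \<eta> :: "real \<Rightarrow> 'a" and a b :: real
  assumes S: "finite S" "S \<subseteq> E" and ab: "a < b" and cont: "continuous_on {a..b} \<eta>"
    and im: "\<eta> ` {a..b} \<subseteq> (\<Union>\<gamma>\<in>S. arc_trace \<gamma>)"
    and nov: "\<And>t. t \<in> {a<..<b} \<Longrightarrow> \<eta> t \<notin> vertices E"
    and om: "\<And>u v. a \<le> u \<Longrightarrow> u \<le> v \<Longrightarrow> v \<le> b \<Longrightarrow> dist (\<eta> u) (\<eta> v) \<le> \<omega> v - \<omega> u"
  obtains \<gamma> s s' where "\<gamma> \<in> S" "s \<in> {0..arc_len \<gamma>}" "s' \<in> {0..arc_len \<gamma>}"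
    "\<eta> a = arc_pt \<gamma> s" "\<eta> b = arc_pt \<gamma> s'" "\<bar>s - s'\<bar> \<le> 2 * (\<omega> b - \<omega> a)"
proof -
  define t0 where "t0 = (a + b) / 2"
  have t0: "t0 \<in> {a<..<b}" using ab by (auto simp: t0_def)
  then have "t0 \<in> {a..b}" by auto
  then have "\<eta> t0 \<in> (\<Union>\<gamma>\<in>S. arc_trace \<gamma>)" using im by blast
  then obtain \<gamma> where g: "\<gamma> \<in> S" "\<eta> t0 \<in> arc_trace \<gamma>" by auto
  have gE: "\<gamma> \<in> E" using g S by auto
  let ?B = "\<Union>\<gamma>'\<in>S - {\<gamma>, inverse_arc \<gamma>}. arc_trace \<gamma>'"
  have inter: "s \<in> {0<..<arc_len \<gamma>}" if "t \<in> {a<..<b}" "\<eta> t = arc_pt \<gamma> s" "s \<in> {0..arc_len \<gamma>}" for s t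
    using nov[OF that(1)] that start_vertex[OF gE] end_vertex[OF gE]
    by (metis atLeastAtMost_iff greaterThanLessThan_iff less_eq_real_def)
  have conn: "connected (\<eta> ` {a<..<b})"
    using cont by (intro connected_continuous_image connected_Ioo) (auto intro: continuous_on_subset)
  have "arc_trace \<gamma> \<inter> ?B \<inter> \<eta> ` {a<..<b} = {}"
  proof (rule ccontr)
    assume "\<not> ?thesis"
    then obtain p where p: "p \<in> arc_trace \<gamma>" "p \<in> ?B" "p \<in> \<eta> ` {a<..<b}" by blast
    from p(3) obtain t where t: "t \<in> {a<..<b}" "p = \<eta> t" by blast
    from p(1) obtain s where s: "s \<in> {0..arc_len \<gamma>}" "p = arc_pt \<gamma> s" by blast
    from p(2) obtain \<gamma>' where g': "\<gamma>' \<in> S" "\<gamma>' \<noteq> \<gamma>" "\<gamma>' \<noteq> inverse_arc \<gamma>" "p \<in> arc_trace \<gamma>'" by blast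
    from g'(4) obtain s' where s': "s' \<in> {0..arc_len \<gamma>'}" "p = arc_pt \<gamma>' s'" by blast
    note * = t(1) trans[OF t(2)[symmetric] s(2)] s(1) g'(1-3) s'(1) trans[OF t(2)[symmetric] s'(2)]
    have "\<gamma>' \<in> E" "arc_pt \<gamma> s = arc_pt \<gamma>' s'" using g'(1) S s(2) s'(2) by auto
    from interior_point_unique[OF gE this(1) inter[OF *(1-3)] *(7) this(2)] g'(2,3) show False by blast
  qed
  moreover have "\<eta> ` {a<..<b} \<subseteq> arc_trace \<gamma> \<union> ?B"
  proof
    fix p assume "p \<in> \<eta> ` {a<..<b}"
    then have "p \<in> \<eta> ` {a..b}" by auto
    then obtain \<gamma>' where "\<gamma>' \<in> S" "p \<in> arc_trace \<gamma>'" using im by blast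
    then show "p \<in> arc_trace \<gamma> \<union> ?B" using trace_inverse[of \<gamma>] by blast
  qed
  moreover have "closed ?B" using S by (intro closed_UN) (auto intro: closed_arc_trace)
  moreover have "arc_trace \<gamma> \<inter> \<eta> ` {a<..<b} \<noteq> {}" using g(2) t0 by blast
  ultimately have sub: "\<eta> ` {a<..<b} \<subseteq> arc_trace \<gamma>"
    using connected_subset_of_closed_cover[OF conn closed_arc_trace[OF gE]] by simp
  have on: "\<exists>s. s \<in> {0..arc_len \<gamma>} \<and> \<eta> t = arc_pt \<gamma> s" if "t \<in> {a<..<b}" for t
    using subsetD[OF sub imageI[OF that]] by blast
  define \<sigma> where "\<sigma> t = (SOME s. s \<in> {0..arc_len \<gamma>} \<and> \<eta> t = arc_pt \<gamma> s)" for t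
  have sig: "\<sigma> t \<in> {0..arc_len \<gamma>}" "\<eta> t = arc_pt \<gamma> (\<sigma> t)" if "t \<in> {a<..<b}" for t
    using someI_ex[OF on[OF that]] unfolding \<sigma>_def by auto
  have uniq: "s = \<sigma> t" if "t \<in> {a<..<b}" "s \<in> {0..arc_len \<gamma>}" "\<eta> t = arc_pt \<gamma> s" for s t
    using same_arc_interior[OF gE inter[OF that(1) that(3) that(2)] sig(1)[OF that(1)]] sig(2)[OF that(1)] that by simp
  \<comment> \<open>As interior parameters are unique, the preimage under \<sigma> of a closed set
    of parameters is the preimage under \<eta> of its compact image on the arc.\<close>
  have sc: "continuous_on {a<..<b} \<sigma>"
    unfolding continuous_on_closed_invariant
  proof (intro allI impI)
    fix C :: "real set" assume "closed C"
    let ?A = "{a..b} \<inter> \<eta> -` (arc_pt \<gamma> ` (C \<inter> {0..arc_len \<gamma>}))"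
    have "compact (C \<inter> {0..arc_len \<gamma>})" using \<open>closed C\<close> by (simp add: closed_Int_compact)
    then have "compact (arc_pt \<gamma> ` (C \<inter> {0..arc_len \<gamma>}))"
      using arc_continuous[OF gE] by (auto intro!: compact_continuous_image intro: continuous_on_subset)
    then have "closed ?A"
      using cont compact_imp_closed by (intro continuous_closed_preimage) auto
    moreover have "?A \<inter> {a<..<b} = \<sigma> -` C \<inter> {a<..<b}"
    proof
      show "?A \<inter> {a<..<b} \<subseteq> \<sigma> -` C \<inter> {a<..<b}" using uniq by fastforce
      show "\<sigma> -` C \<inter> {a<..<b} \<subseteq> ?A \<inter> {a<..<b}" using sig by fastforce
    qed
    ultimately show "\<exists>A. closed A \<and> A \<inter> {a<..<b} = \<sigma> -` C \<inter> {a<..<b}" by blast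
  qed
  obtain \<delta> where \<delta>: "\<delta> > 0" "\<And>s s'. s \<in> {0..arc_len \<gamma>} \<Longrightarrow> s' \<in> {0..arc_len \<gamma>} \<Longrightarrow> \<bar>s - s'\<bar> < \<delta> \<Longrightarrow>
     \<bar>s - s'\<bar> \<le> 2 * dist (arc_pt \<gamma> s) (arc_pt \<gamma> s')"
    using regular_arc_expanding[OF reg[OF gE]] by metis
  have est: "\<bar>\<sigma> v - \<sigma> u\<bar> \<le> 2 * \<omega> v - 2 * \<omega> u" if uv: "a < u" "u \<le> v" "v < b" for u v
  proof -
    have sub: "{u..v} \<subseteq> {a<..<b}" using uv by auto
    have "uniformly_continuous_on {u..v} \<sigma>"
      using continuous_on_subset[OF sc sub] by (intro compact_uniformly_continuous) auto
    then obtain d where d: "d > 0" "\<And>x x'. x \<in> {u..v} \<Longrightarrow> x' \<in> {u..v} \<Longrightarrow> dist x' x < d \<Longrightarrow> dist (\<sigma> x') (\<sigma> x) < \<delta>"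
      unfolding uniformly_continuous_on_def using \<delta>(1) by metis
    show ?thesis
    proof (rule local_increments_imp_global[OF d(1) uv(2), of \<sigma> "\<lambda>t. 2 * \<omega> t"])
      fix s t assume st: "u \<le> s" "s \<le> t" "t \<le> v" "t - s < d"
      then have "dist (\<sigma> t) (\<sigma> s) < \<delta>" by (intro d(2)) (auto simp: dist_real_def)
      then have "\<bar>\<sigma> t - \<sigma> s\<bar> \<le> 2 * dist (\<eta> t) (\<eta> s)"
        using \<delta>(2)[of "\<sigma> t" "\<sigma> s"] sig[of s] sig[of t] st uv by (auto simp: dist_real_def)
      also have "dist (\<eta> t) (\<eta> s) \<le> \<omega> t - \<omega> s" using om[of s t] st uv by (simp add: dist_commute)
      finally show "\<bar>\<sigma> t - \<sigma> s\<bar> \<le> 2 * \<omega> t - 2 * \<omega> s" by simp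
    qed
  qed
  \<comment> \<open>The 3 keeps the offset below half of b - a, so that the inner interval from a +
    e n to b - e n is never reversed.\<close>
  define e where "e n = (b - a) / (real n + 3)" for n
  have e1: "0 < e n" for n using ab unfolding e_def by simp
  have e2: "e n \<le> (b - a) / 3" for n
    unfolding e_def by (rule divide_left_mono) (use ab in simp_all)
  note e = e1 e2
  have e0: "e \<longlonglongrightarrow> 0" unfolding e_def by (rule real_tendsto_divide_at_top) (auto intro!: filterlim_tendsto_add_at_top filterlim_real_sequentially tendsto_const simp: add.commute[of _ 3])
  define U where "U n = a + e n" for n
  define W where "W n = b - e n" for n
  have UW: "a < U n" "U n \<le> W n" "W n < b" for n
    using e1[of n] e2[of n] ab by (auto simp: U_def W_def field_simps)
  have "seq_compact ({0..arc_len \<gamma>} \<times> {0..arc_len \<gamma>})"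
    by (intro compact_imp_seq_compact compact_Times) auto
  moreover have "\<forall>n. (\<sigma> (U n), \<sigma> (W n)) \<in> {0..arc_len \<gamma>} \<times> {0..arc_len \<gamma>}"
  proof
    fix n
    have "U n \<in> {a<..<b}" "W n \<in> {a<..<b}" using UW[of n] by auto
    then show "(\<sigma> (U n), \<sigma> (W n)) \<in> {0..arc_len \<gamma>} \<times> {0..arc_len \<gamma>}" using sig(1) by blast
  qed
  \<comment> \<open>The parameters at the two inner ends converge along a common subsequence; the
    limits are the \<open>s\<close> and \<open>s'\<close> to be produced.\<close>
  ultimately obtain l r where l: "l \<in> {0..arc_len \<gamma>} \<times> {0..arc_len \<gamma>}" "strict_mono r"
    "((\<lambda>n. (\<sigma> (U n), \<sigma> (W n))) \<circ> r) \<longlonglongrightarrow> l"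
    by (rule seq_compactE[where f="\<lambda>n. (\<sigma> (U n), \<sigma> (W n))"])
  obtain s s' where ss: "l = (s, s')" by force
  have ls: "s \<in> {0..arc_len \<gamma>}" "s' \<in> {0..arc_len \<gamma>}" using l(1) ss by auto
  have lim: "(\<lambda>n. \<sigma> (U (r n))) \<longlonglongrightarrow> s" "(\<lambda>n. \<sigma> (W (r n))) \<longlonglongrightarrow> s'"
    using tendsto_fst[OF l(3)] tendsto_snd[OF l(3)] ss by (auto simp: o_def)
  have er: "(\<lambda>n. e (r n)) \<longlonglongrightarrow> 0" using LIMSEQ_subseq_LIMSEQ[OF e0 l(2)] by (simp add: o_def)
  have endpt: "\<eta> x = arc_pt \<gamma> z"
    if "(\<lambda>n. \<sigma> (y n)) \<longlonglongrightarrow> z" "z \<in> {0..arc_len \<gamma>}" "y \<longlonglongrightarrow> x" "\<And>n. y n \<in> {a<..<b}" "x \<in> {a..b}" for x y z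
  proof (rule LIMSEQ_unique)
    show "(\<lambda>n. \<eta> (y n)) \<longlonglongrightarrow> \<eta> x"
      by (rule continuous_on_tendsto_compose[OF cont that(3) that(5)])
         (intro always_eventually allI greaterThanLessThan_subseteq_atLeastAtMost_iff[THEN iffD2, THEN subsetD, OF _ that(4)], simp)
    have "(\<lambda>n. arc_pt \<gamma> (\<sigma> (y n))) \<longlonglongrightarrow> arc_pt \<gamma> z"
      by (rule continuous_on_tendsto_compose[OF arc_continuous[OF gE] that(1) that(2)]) (use sig(1) that(4) in auto)
    then show "(\<lambda>n. \<eta> (y n)) \<longlonglongrightarrow> arc_pt \<gamma> z" using sig(2) that(4) by (simp add: tendsto_cong)
  qed
  show ?thesis
  proof (rule that[OF g(1) ls])
    have "U n \<in> {a<..<b}" "W n \<in> {a<..<b}" for n using UW[of n] by auto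
    then show "\<eta> a = arc_pt \<gamma> s" "\<eta> b = arc_pt \<gamma> s'"
      using ab tendsto_add[OF tendsto_const er, of a] tendsto_diff[OF tendsto_const er, of b]
      by (auto intro!: endpt[OF lim(1) ls(1)] endpt[OF lim(2) ls(2)] simp: U_def W_def)
    show "\<bar>s - s'\<bar> \<le> 2 * (\<omega> b - \<omega> a)"
    proof (rule LIMSEQ_le_const2)
      show "(\<lambda>n. \<bar>\<sigma> (U (r n)) - \<sigma> (W (r n))\<bar>) \<longlonglongrightarrow> \<bar>s - s'\<bar>" by (intro tendsto_intros lim)
      have "\<bar>\<sigma> (U n) - \<sigma> (W n)\<bar> \<le> 2 * (\<omega> b - \<omega> a)" for n
      proof -
        have "0 \<le> \<omega> (U n) - \<omega> a" "0 \<le> \<omega> b - \<omega> (W n)"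
          using om[of a "U n"] om[of "W n" b] UW[of n] zero_le_dist order_trans by (smt (verit))+
        then show ?thesis using est[of "U n" "W n"] UW[of n] by (simp add: abs_minus_commute)
      qed
      then show "\<exists>N. \<forall>n\<ge>N. \<bar>\<sigma> (U (r n)) - \<sigma> (W (r n))\<bar> \<le> 2 * (\<omega> b - \<omega> a)" by blast
    qed
  qed
qed

end


section \<open>Short curves and combinatorial closeness\<close>

context metric_network
begin

text \<open>Nearness without mention of paths: through one arc, or through two arcs with a common
  start. Routes through several vertices are not covered; curves short compared with m do not need
  them.\<close>

definition close_points :: "real \<Rightarrow> 'a \<Rightarrow> 'a \<Rightarrow> bool" where
  "close_points r p q \<longleftrightarrow>
     (\<exists>\<gamma>\<in>E. \<exists>s\<in>{0..arc_len \<gamma>}. \<exists>s'\<in>{0..arc_len \<gamma>}.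
        p = arc_pt \<gamma> s \<and> q = arc_pt \<gamma> s' \<and> \<bar>s - s'\<bar> \<le> r) \<or>
     (\<exists>\<gamma>\<in>E. \<exists>\<gamma>'\<in>E. \<exists>s\<in>{0..arc_len \<gamma>}. \<exists>s'\<in>{0..arc_len \<gamma>'}.
        arc_pt \<gamma> 0 = arc_pt \<gamma>' 0 \<and> p = arc_pt \<gamma> s \<and> q = arc_pt \<gamma>' s' \<and> s + s' \<le> r)"

lemma close_pointsI1:
  "\<gamma> \<in> E \<Longrightarrow> s \<in> {0..arc_len \<gamma>} \<Longrightarrow> s' \<in> {0..arc_len \<gamma>} \<Longrightarrow> p = arc_pt \<gamma> s \<Longrightarrow> q = arc_pt \<gamma> s' \<Longrightarrow>
    \<bar>s - s'\<bar> \<le> r \<Longrightarrow> close_points r p q"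
  unfolding close_points_def by blast

lemma close_pointsI2:
  "\<gamma> \<in> E \<Longrightarrow> \<gamma>' \<in> E \<Longrightarrow> s \<in> {0..arc_len \<gamma>} \<Longrightarrow> s' \<in> {0..arc_len \<gamma>'} \<Longrightarrow> arc_pt \<gamma> 0 = arc_pt \<gamma>' 0 \<Longrightarrow>
    p = arc_pt \<gamma> s \<Longrightarrow> q = arc_pt \<gamma>' s' \<Longrightarrow> s + s' \<le> r \<Longrightarrow> close_points r p q"
  unfolding close_points_def by blast

lemma close_pointsE:
  assumes "close_points r p q"
  obtains (one) \<gamma> s s' where "\<gamma> \<in> E" "s \<in> {0..arc_len \<gamma>}" "s' \<in> {0..arc_len \<gamma>}" "p = arc_pt \<gamma> s"
     "q = arc_pt \<gamma> s'" "\<bar>s - s'\<bar> \<le> r"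
   | (two) \<gamma> \<gamma>' s s' where "\<gamma> \<in> E" "\<gamma>' \<in> E" "s \<in> {0..arc_len \<gamma>}" "s' \<in> {0..arc_len \<gamma>'}"
     "arc_pt \<gamma> 0 = arc_pt \<gamma>' 0" "p = arc_pt \<gamma> s" "q = arc_pt \<gamma>' s'" "s + s' \<le> r"
  using assms unfolding close_points_def by blast

lemma close_points_mono: "close_points r p q \<Longrightarrow> r \<le> r' \<Longrightarrow> close_points r' p q"
  by (elim close_pointsE) (auto intro: close_pointsI1 close_pointsI2)

lemma close_points_sym:
  assumes "close_points r p q" shows "close_points r q p"
  using assms
proof (cases rule: close_pointsE)
  case (one \<gamma> s s')
  show ?thesis by (rule close_pointsI1[of \<gamma> s' s]) (use one in \<open>auto simp: abs_minus_commute\<close>)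
next
  case (two \<gamma> \<gamma>' s s')
  show ?thesis by (rule close_pointsI2[of \<gamma>' \<gamma> s' s]) (use two in auto)
qed

lemma network_pointE:
  assumes "p \<in> network_points E"
  obtains \<gamma> s where "\<gamma> \<in> E" "s \<in> {0..arc_len \<gamma>}" "p = arc_pt \<gamma> s"
  using assms unfolding network_points_def by blast

text \<open>Passing between two different vertices uses up a whole arc, of length at least m, which
  a short curve cannot afford. So all its vertex visits are at one vertex, and the parts before the
  first and after the last visit run on single arcs; whatever happens in between is
  discarded.\<close>

lemma finitely_many_arcs_close_endpoints:
  fixes \<eta> :: "real \<Rightarrow> 'a" and a b :: real
  assumes S: "finite S" "S \<subseteq> E" and ab: "a \<le> b" and cont: "continuous_on {a..b} \<eta>"
    and im: "\<eta> ` {a..b} \<subseteq> (\<Union>\<gamma>\<in>S. arc_trace \<gamma>)"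
    and om: "\<And>u v. a \<le> u \<Longrightarrow> u \<le> v \<Longrightarrow> v \<le> b \<Longrightarrow> dist (\<eta> u) (\<eta> v) \<le> \<omega> v - \<omega> u"
    and short: "2 * (\<omega> b - \<omega> a) < m"
  shows "close_points (2 * (\<omega> b - \<omega> a)) (\<eta> a) (\<eta> b)"
proof -
  have mono: "\<omega> u \<le> \<omega> v" if "a \<le> u" "u \<le> v" "v \<le> b" for u v
    using om[OF that] zero_le_dist[of "\<eta> u" "\<eta> v"] by linarith
  have on: "\<eta> t \<in> (\<Union>\<gamma>\<in>S. arc_trace \<gamma>)" if "a \<le> t" "t \<le> b" for t
    using that by (intro subsetD[OF im imageI]) simp
  let ?V = "vertices E \<inter> (\<Union>\<gamma>\<in>S. arc_trace \<gamma>)"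
  have finV: "finite ?V" by (rule finite_vertices_on[OF S])
  \<comment> \<open>Only finitely many vertices lie on the arcs in \<open>S\<close>, so the times of
    visits to any set of them are compact and extreme visits exist.\<close>
  have clos: "compact {t \<in> {u..v}. \<eta> t \<in> W}" if "W \<subseteq> ?V" "a \<le> u" "v \<le> b" for u v W
  proof -
    have "finite W" using finV that(1) by (rule finite_subset[rotated])
    moreover have "continuous_on {u..v} \<eta>" using cont that by (auto intro: continuous_on_subset)
    ultimately have "closed ({u..v} \<inter> \<eta> -` W)"
      by (intro continuous_closed_preimage) (auto intro: finite_imp_closed)
    moreover have "{u..v} \<inter> \<eta> -` W = {t \<in> {u..v}. \<eta> t \<in> W}" by auto
    moreover have "bounded {t \<in> {u..v}. \<eta> t \<in> W}"
      by (rule bounded_subset[OF bounded_closed_interval[of u v]]) auto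
    ultimately show ?thesis by (simp add: compact_eq_bounded_closed)
  qed
  have edge: "\<exists>\<gamma> s s'. \<gamma> \<in> E \<and> s \<in> {0..arc_len \<gamma>} \<and> s' \<in> {0..arc_len \<gamma>} \<and>
    \<eta> u = arc_pt \<gamma> s \<and> \<eta> v = arc_pt \<gamma> s' \<and> \<bar>s - s'\<bar> \<le> 2 * (\<omega> v - \<omega> u)"
    if uv: "a \<le> u" "u < v" "v \<le> b" "\<And>t. t \<in> {u<..<v} \<Longrightarrow> \<eta> t \<notin> vertices E" for u v
  proof (rule edge_estimate[OF S uv(2), where \<omega> = \<omega>])
    show "continuous_on {u..v} \<eta>" by (rule continuous_on_subset[OF cont]) (use uv in auto)
    show "\<eta> ` {u..v} \<subseteq> (\<Union>\<gamma>\<in>S. arc_trace \<gamma>)"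
      by (rule order_trans[OF image_mono im]) (use uv in auto)
    show "\<eta> t \<notin> vertices E" if "t \<in> {u<..<v}" for t by (rule uv(4)[OF that])
    show "dist (\<eta> x) (\<eta> y) \<le> \<omega> y - \<omega> x" if "u \<le> x" "x \<le> y" "y \<le> v" for x y
      using om[of x y] that uv by linarith
  next
    fix \<gamma> s s'
    assume "\<gamma> \<in> S" "s \<in> {0..arc_len \<gamma>}" "s' \<in> {0..arc_len \<gamma>}"
      "\<eta> u = arc_pt \<gamma> s" "\<eta> v = arc_pt \<gamma> s'" "\<bar>s - s'\<bar> \<le> 2 * (\<omega> v - \<omega> u)"
    then show ?thesis using S(2) by (intro exI[of _ \<gamma>] exI[of _ s] exI[of _ s'] conjI subsetD[OF S(2)])
  qed
  \<comment> \<open>Between the last visit to the vertex \<eta> u and the first later visit to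
    another vertex no vertex is met, so this stretch runs along one arc from end to end.\<close>
  have const: "\<eta> u = \<eta> v" if uv: "a \<le> u" "u \<le> v" "v \<le> b" "\<eta> u \<in> vertices E" "\<eta> v \<in> vertices E" for u v
  proof (rule ccontr)
    assume ne: "\<eta> u \<noteq> \<eta> v"
    have inV: "\<eta> u \<in> ?V" "\<eta> v \<in> ?V" using uv on[of u] on[of v] by (simp_all del: UN_iff)
    let ?Z1 = "{t \<in> {u..v}. \<eta> t \<in> {\<eta> u}}"
    have "compact ?Z1" using clos[of "{\<eta> u}" u v] inV uv by auto
    moreover have "?Z1 \<noteq> {}" using uv by auto
    ultimately obtain \<tau>1 where \<tau>1: "\<tau>1 \<in> ?Z1" "\<And>t. t \<in> ?Z1 \<Longrightarrow> t \<le> \<tau>1"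
      using compact_attains_sup[of ?Z1] by blast
    have 1: "u \<le> \<tau>1" "\<tau>1 \<le> v" "\<eta> \<tau>1 = \<eta> u" using \<tau>1(1) by auto
    let ?Z2 = "{t \<in> {\<tau>1..v}. \<eta> t \<in> ?V - {\<eta> u}}"
    have "compact ?Z2" using clos[of "?V - {\<eta> u}" \<tau>1 v] uv 1 by auto
    moreover have "v \<in> ?Z2" using 1(2) inV(2) ne by (simp del: UN_iff)
    then have "?Z2 \<noteq> {}" by blast
    ultimately obtain \<tau>2 where \<tau>2: "\<tau>2 \<in> ?Z2" "\<And>t. t \<in> ?Z2 \<Longrightarrow> \<tau>2 \<le> t"
      using compact_attains_inf[of ?Z2] by blast
    have 2: "\<tau>1 \<le> \<tau>2" "\<tau>2 \<le> v" "\<eta> \<tau>2 \<in> vertices E" "\<eta> \<tau>2 \<noteq> \<eta> u" using \<tau>2(1) by auto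
    then have lt: "\<tau>1 < \<tau>2" using 1(3) by (cases "\<tau>1 = \<tau>2") auto
    have nov: "\<eta> t \<notin> vertices E" if t: "t \<in> {\<tau>1<..<\<tau>2}" for t
    proof
      assume v: "\<eta> t \<in> vertices E"
      have tt: "t \<in> {a..b}" "t \<in> {u..v}" "t \<in> {\<tau>1..v}" using t 1 2 uv by auto
      have "\<eta> t \<noteq> \<eta> u" using \<tau>1(2)[of t] tt(2) t by auto
      moreover have "\<eta> t \<in> ?V" using v on[of t] tt(1) by (simp del: UN_iff)
      ultimately have "\<tau>2 \<le> t" using \<tau>2(2)[of t] tt(3) by blast
      then show False using t by auto
    qed
    obtain \<gamma> s s' where g: "\<gamma> \<in> E" "s \<in> {0..arc_len \<gamma>}" "s' \<in> {0..arc_len \<gamma>}"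
      "\<eta> \<tau>1 = arc_pt \<gamma> s" "\<eta> \<tau>2 = arc_pt \<gamma> s'" "\<bar>s - s'\<bar> \<le> 2 * (\<omega> \<tau>2 - \<omega> \<tau>1)"
      using edge[of \<tau>1 \<tau>2] lt nov 1 2 uv by auto
    have "s = 0 \<or> s = arc_len \<gamma>" using vertex_on_arc[OF g(1,2)] g(4) 1(3) uv(4) by simp
    moreover have "s' = 0 \<or> s' = arc_len \<gamma>" using vertex_on_arc[OF g(1,3)] g(5) 2(3) by simp
    moreover have "s \<noteq> s'" using g(4,5) 1(3) 2(4) by auto
    ultimately have "arc_len \<gamma> \<le> \<bar>s - s'\<bar>" by auto
    also have "\<dots> \<le> 2 * (\<omega> b - \<omega> a)" using g(6) mono[of \<tau>2 b] mono[of a \<tau>1] 1 2 uv by auto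
    finally show False using m_le[OF g(1)] short by simp
  qed
  show ?thesis
  proof (cases "\<exists>t\<in>{a..b}. \<eta> t \<in> vertices E")
    case False
    show ?thesis
    proof (cases "a = b")
      case True
      have "\<eta> a \<in> (\<Union>\<gamma>\<in>S. arc_trace \<gamma>)" using on[of a] ab by (simp del: UN_iff)
      then obtain \<gamma> s where g: "\<gamma> \<in> S" "s \<in> {0..arc_len \<gamma>}" "\<eta> a = arc_pt \<gamma> s" by blast
      then show ?thesis using True S by (intro close_pointsI1[of \<gamma> s s]) auto
    next
      case False2: False
      then obtain \<gamma> s s' where g: "\<gamma> \<in> E" "s \<in> {0..arc_len \<gamma>}" "s' \<in> {0..arc_len \<gamma>}"
        "\<eta> a = arc_pt \<gamma> s" "\<eta> b = arc_pt \<gamma> s'" "\<bar>s - s'\<bar> \<le> 2 * (\<omega> b - \<omega> a)"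
        using edge[of a b] ab False by auto
      then show ?thesis by (intro close_pointsI1)
    qed
  next
    case True
    let ?Z = "{t \<in> {a..b}. \<eta> t \<in> ?V}"
    have Zc: "compact ?Z" using clos[of ?V a b] by auto
    have Zne: "?Z \<noteq> {}"
    proof -
      obtain t where "t \<in> {a..b}" "\<eta> t \<in> vertices E" using True by blast
      then have "t \<in> ?Z" using on[of t] by (simp del: UN_iff)
      then show ?thesis by blast
    qed
    obtain t0 where t0: "t0 \<in> ?Z" "\<And>t. t \<in> ?Z \<Longrightarrow> t0 \<le> t" using compact_attains_inf[OF Zc Zne] by blast
    obtain t1 where t1: "t1 \<in> ?Z" "\<And>t. t \<in> ?Z \<Longrightarrow> t \<le> t1" using compact_attains_sup[OF Zc Zne] by blast
    have le: "a \<le> t0" "t0 \<le> t1" "t1 \<le> b" using t0(1) t1(1) t0(2)[OF t1(1)] by auto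
    have vx: "\<eta> t0 \<in> vertices E" "\<eta> t1 \<in> vertices E" using t0(1) t1(1) by auto
    have same: "\<eta> t0 = \<eta> t1" by (rule const) (use le vx in auto)
    have nov: "\<eta> t \<notin> vertices E" if t: "t \<in> {a..<t0} \<union> {t1<..b}" for t
    proof
      assume v: "\<eta> t \<in> vertices E"
      have tt: "t \<in> {a..b}" using t le by auto
      then have "\<eta> t \<in> ?V" using v on[of t] tt by (simp del: UN_iff)
      then show False using t t0(2)[of t] t1(2)[of t] tt by auto
    qed
    \<comment> \<open>Both outer parts are treated at once: \<open>w\<close> is the time of the
      vertex visit, \<open>z\<close> the end of the curve. The arc is oriented away from the
      vertex.\<close>
    have arm: "\<exists>\<gamma> s. \<gamma> \<in> E \<and> s \<in> {0..arc_len \<gamma>} \<and> arc_pt \<gamma> 0 = \<eta> w \<and> \<eta> z = arc_pt \<gamma> s \<and> s \<le> 2 * \<bar>\<omega> z - \<omega> w\<bar>"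
      if wz: "(w = t0 \<and> z = a) \<or> (w = t1 \<and> z = b)" for w z
    proof (cases "w = z")
      case True
      obtain \<gamma> where g: "\<gamma> \<in> E" "arc_pt \<gamma> 0 = \<eta> w" using vx wz vertices_eq by auto
      then show ?thesis using True len_pos[OF g(1)] by (intro exI[of _ \<gamma>] exI[of _ 0]) auto
    next
      case False
      obtain \<gamma> s s0 where g: "\<gamma> \<in> E" "s \<in> {0..arc_len \<gamma>}" "s0 \<in> {0..arc_len \<gamma>}"
        "\<eta> z = arc_pt \<gamma> s" "\<eta> w = arc_pt \<gamma> s0" "\<bar>s - s0\<bar> \<le> 2 * \<bar>\<omega> z - \<omega> w\<bar>"
      proof (cases "w = t0 \<and> z = a")
        case True
        then have lt: "a < t0" using False le by auto
        obtain \<gamma> s s' where "\<gamma> \<in> E" "s \<in> {0..arc_len \<gamma>}" "s' \<in> {0..arc_len \<gamma>}"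
          "\<eta> a = arc_pt \<gamma> s" "\<eta> t0 = arc_pt \<gamma> s'" "\<bar>s - s'\<bar> \<le> 2 * (\<omega> t0 - \<omega> a)"
          using edge[of a t0] lt le nov by auto
        then show ?thesis using True by (intro that[of \<gamma> s s']) auto
      next
        case f: False
        then have *: "w = t1" "z = b" using wz by auto
        then have lt: "t1 < b" using False le by auto
        obtain \<gamma> s s' where "\<gamma> \<in> E" "s \<in> {0..arc_len \<gamma>}" "s' \<in> {0..arc_len \<gamma>}"
          "\<eta> t1 = arc_pt \<gamma> s" "\<eta> b = arc_pt \<gamma> s'" "\<bar>s - s'\<bar> \<le> 2 * (\<omega> b - \<omega> t1)"
          using edge[of t1 b] lt le nov by auto
        then show ?thesis using * by (intro that[of \<gamma> s' s]) auto
      qed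
      have "arc_pt \<gamma> s0 \<in> vertices E" using g(5) vx wz by auto
      then obtain \<gamma>' s' where g': "\<gamma>' \<in> E" "s' \<in> {0..arc_len \<gamma>'}" "arc_pt \<gamma>' s' = arc_pt \<gamma> s"
        "arc_pt \<gamma>' 0 = arc_pt \<gamma> s0" "s' = \<bar>s - s0\<bar>"
        using vertex_start_reparam[OF g(1,2,3)] by metis
      show ?thesis by (intro exI[of _ \<gamma>'] exI[of _ s'] conjI) (use g g' in simp_all)
    qed
    obtain \<gamma> s where g: "\<gamma> \<in> E" "s \<in> {0..arc_len \<gamma>}" "arc_pt \<gamma> 0 = \<eta> t0" "\<eta> a = arc_pt \<gamma> s" "s \<le> 2 * \<bar>\<omega> a - \<omega> t0\<bar>"
      using arm[of t0 a] by auto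
    obtain \<gamma>' s' where g': "\<gamma>' \<in> E" "s' \<in> {0..arc_len \<gamma>'}" "arc_pt \<gamma>' 0 = \<eta> t1" "\<eta> b = arc_pt \<gamma>' s'" "s' \<le> 2 * \<bar>\<omega> b - \<omega> t1\<bar>"
      using arm[of t1 b] by auto
    show ?thesis
    proof (rule close_pointsI2[OF g(1) g'(1) g(2) g'(2) _ g(4) g'(4)])
      show "arc_pt \<gamma> 0 = arc_pt \<gamma>' 0" using g(3) g'(3) same by simp
      show "s + s' \<le> 2 * (\<omega> b - \<omega> a)"
        using g(5) g'(5) mono[of a t0] mono[of t0 t1] mono[of t1 b] le by auto
    qed
  qed
qed

text \<open>The arcs, up to reversal, that a short curve starting on \<gamma> can reach. Local
  finiteness of the network makes them finitely many.\<close>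

definition adjacent_arcs :: "'a arc \<Rightarrow> 'a arc set" where
  "adjacent_arcs \<gamma> = insert \<gamma> (insert (inverse_arc \<gamma>) (arcs_from E (arc_pt \<gamma> 0) \<union> arcs_from E (arc_pt \<gamma> (arc_len \<gamma>))))"

lemma adjacent_arcs: "\<gamma> \<in> E \<Longrightarrow> finite (adjacent_arcs \<gamma>)" "\<gamma> \<in> E \<Longrightarrow> adjacent_arcs \<gamma> \<subseteq> E"
  unfolding adjacent_arcs_def using finite_arcs_from start_vertex end_vertex inv_in
  by (auto simp: arcs_from_def)

text \<open>If \<open>p\<close> is an interior point, its arc is \<gamma> up to reversal. If
  \<open>p\<close> is a vertex, r < m prevents it from being the far end of the first of two
  arcs.\<close>

lemma close_points_adjacent:
  assumes g: "\<gamma> \<in> E" "p \<in> arc_trace \<gamma>" and cl: "close_points r p q" and r: "r < m"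
  shows "q \<in> (\<Union>\<gamma>'\<in>adjacent_arcs \<gamma>. arc_trace \<gamma>')"
proof -
  obtain s0 where s0: "s0 \<in> {0..arc_len \<gamma>}" "p = arc_pt \<gamma> s0" using g(2) by blast
  have end_in: "\<gamma>' \<in> adjacent_arcs \<gamma>" if "\<gamma>' \<in> E" "arc_pt \<gamma>' 0 = arc_pt \<gamma> 0 \<or> arc_pt \<gamma>' 0 = arc_pt \<gamma> (arc_len \<gamma>)" for \<gamma>'
    using that unfolding adjacent_arcs_def arcs_from_def by blast
  have pv: "p = arc_pt \<gamma> 0 \<or> p = arc_pt \<gamma> (arc_len \<gamma>)" if "p \<in> vertices E"
    using vertex_on_arc[OF g(1) s0(1)] that s0(2) by auto
  have int: "s0 \<in> {0<..<arc_len \<gamma>}" if "p \<notin> vertices E"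
    using that s0 start_vertex[OF g(1)] end_vertex[OF g(1)]
    by (metis atLeastAtMost_iff greaterThanLessThan_iff less_eq_real_def)
  from cl show ?thesis
  proof (cases rule: close_pointsE)
    case (one \<gamma>1 s s')
    show ?thesis
    proof (cases "p \<in> vertices E")
      case True
      then have "arc_pt \<gamma>1 s \<in> vertices E" using one by simp
      then obtain \<gamma>' s'' where *: "\<gamma>' \<in> E" "s'' \<in> {0..arc_len \<gamma>'}" "arc_pt \<gamma>' s'' = arc_pt \<gamma>1 s'"
        "arc_pt \<gamma>' 0 = arc_pt \<gamma>1 s"
        using vertex_start_reparam[OF one(1,3,2)] by metis
      have "\<gamma>' \<in> adjacent_arcs \<gamma>" using end_in[OF *(1)] pv[OF True] *(4) one(4) by metis
      moreover have "q \<in> arc_trace \<gamma>'" using *(2,3) one(5) by (metis imageI)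
      ultimately show ?thesis by blast
    next
      case False
      have "arc_pt \<gamma> s0 = arc_pt \<gamma>1 s" using s0(2) one(4) by simp
      then have "\<gamma>1 = \<gamma> \<or> \<gamma>1 = inverse_arc \<gamma>"
        using interior_point_unique[OF g(1) one(1) int[OF False] one(2)] by blast
      then have "\<gamma>1 \<in> adjacent_arcs \<gamma>" unfolding adjacent_arcs_def by blast
      then show ?thesis using one by blast
    qed
  next
    case (two \<gamma>1 \<gamma>2 s s')
    have "\<gamma>2 \<in> adjacent_arcs \<gamma>"
    proof (cases "p \<in> vertices E")
      case True
      then have "s = 0 \<or> s = arc_len \<gamma>1" using vertex_on_arc[OF two(1,3)] two(6) by simp
      then have "s = 0" using two(4,8) r m_le[OF two(1)] by auto
      then have "arc_pt \<gamma>2 0 = p" using two by simp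
      then show ?thesis using end_in[OF two(2)] pv[OF True] by metis
    next
      case False
      have "arc_pt \<gamma> s0 = arc_pt \<gamma>1 s" using s0(2) two(6) by simp
      then have "\<gamma>1 = \<gamma> \<or> \<gamma>1 = inverse_arc \<gamma>"
        using interior_point_unique[OF g(1) two(1) int[OF False] two(3)] by blast
      then have "arc_pt \<gamma>1 0 = arc_pt \<gamma> 0 \<or> arc_pt \<gamma>1 0 = arc_pt \<gamma> (arc_len \<gamma>)"
        using len_pos[OF g(1)] by auto
      then show ?thesis using end_in[OF two(2)] two(5) by metis
    qed
    then show ?thesis using two by blast
  qed
qed

end


section \<open>Every curve meets finitely many arcs\<close>

context metric_network
begin

text \<open>The set \<open>F\<close> of times near which the curve is not covered by finitely many arcs is closed. By
  Baire's theorem some portion of \<open>F\<close> is mapped into a single arc, and the short excursions in the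
  gaps of that portion stay in the finitely many adjacent arcs. Hence \<open>F\<close> is empty.\<close>

lemma curve_covered_by_finitely_many_arcs:
  fixes \<eta> :: "real \<Rightarrow> 'a" and a b :: real
  assumes cont: "continuous_on {a..b} \<eta>" and im: "\<eta> ` {a..b} \<subseteq> network_points E"
    and om: "\<And>u v. a \<le> u \<Longrightarrow> u \<le> v \<Longrightarrow> v \<le> b \<Longrightarrow> dist (\<eta> u) (\<eta> v) \<le> \<omega> v - \<omega> u"
    and omc: "continuous_on {a..b} \<omega>"
  shows "\<exists>S. finite S \<and> S \<subseteq> E \<and> \<eta> ` {a..b} \<subseteq> (\<Union>\<gamma>\<in>S. arc_trace \<gamma>)"
proof -
  define covered where "covered I \<longleftrightarrow> (\<exists>S. finite S \<and> S \<subseteq> E \<and> \<eta> ` I \<subseteq> (\<Union>\<gamma>\<in>S. arc_trace \<gamma>))" for I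
  have cov_sub: "covered J" if "covered I" "J \<subseteq> I" for I J
    using that unfolding covered_def by (meson image_mono order_trans)
  have cov_Un: "covered (\<Union>C)" if "finite C" "\<forall>I\<in>C. covered I" for C
    using that
  proof (induction C)
    case empty show ?case unfolding covered_def by (intro exI[of _ "{}"]) simp
  next
    case (insert I C)
    then obtain S S' where "finite S" "S \<subseteq> E" "\<eta> ` I \<subseteq> (\<Union>\<gamma>\<in>S. arc_trace \<gamma>)"
      "finite S'" "S' \<subseteq> E" "\<eta> ` \<Union>C \<subseteq> (\<Union>\<gamma>\<in>S'. arc_trace \<gamma>)"
      unfolding covered_def by (meson insert_iff)
    then show ?case unfolding covered_def
      by (intro exI[of _ "S \<union> S'"] conjI) (simp_all add: image_Un UN_Un le_supI1 le_supI2)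
  qed
  define \<U> where "\<U> = {ball t e | t e. covered ({a..b} \<inter> ball t e)}"
  define F where "F = {a..b} - \<Union>\<U>"
  have clF: "closed F" unfolding F_def \<U>_def by (intro closed_Diff) auto
  have cov_compact: "covered K" if K: "compact K" "K \<subseteq> {a..b}" "K \<inter> F = {}" for K
  proof -
    have KU: "K \<subseteq> \<Union>\<U>" using K unfolding F_def by auto
    obtain C where C: "C \<subseteq> \<U>" "finite C" "K \<subseteq> \<Union>C"
    proof (rule compactE[OF K(1) KU])
      show "open B" if "B \<in> \<U>" for B using that unfolding \<U>_def by blast
    qed
    have "covered (\<Union>((\<lambda>B. {a..b} \<inter> B) ` C))"
      by (rule cov_Un) (use C in \<open>auto simp: \<U>_def\<close>)
    then show ?thesis by (rule cov_sub) (use C(3) K(2) in auto)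
  qed
  have "F = {}"
  proof (rule ccontr)
    assume Fne: "F \<noteq> {}"
    define A where "A \<gamma> = {a..b} \<inter> \<eta> -` arc_trace \<gamma>" for \<gamma>
    have clA: "closed (A \<gamma>)" if "\<gamma> \<in> E" for \<gamma>
      unfolding A_def using cont closed_arc_trace[OF that] by (intro continuous_closed_preimage) auto
    have inA: "\<exists>\<gamma>\<in>E. t \<in> A \<gamma>" if "t \<in> {a..b}" for t
    proof -
      have "\<eta> t \<in> network_points E" using im that by blast
      then show ?thesis using that unfolding A_def network_points_def by blast
    qed
    \<comment> \<open>Otherwise each \<open>F - A \<gamma>\<close> would be relatively open and
      dense in \<open>F\<close>. By Baire the countable intersection would be dense, but it is empty
      because every time belongs to some \<open>A \<gamma>\<close>.\<close>
    have "\<exists>\<gamma>\<in>E. \<not> F \<subseteq> closure (F - A \<gamma>)"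
    proof (rule ccontr)
      assume "\<not> ?thesis"
      then have dense: "\<And>\<gamma>. \<gamma> \<in> E \<Longrightarrow> F \<subseteq> closure (F - A \<gamma>)" by blast
      have "F \<subseteq> closure (\<Inter>((\<lambda>\<gamma>. F - A \<gamma>) ` E))"
      proof (rule Baire[OF clF])
        show "countable ((\<lambda>\<gamma>. F - A \<gamma>) ` E)" using countable_arcs by simp
        fix T assume "T \<in> (\<lambda>\<gamma>. F - A \<gamma>) ` E"
        then obtain \<gamma> where g: "\<gamma> \<in> E" "T = F - A \<gamma>" by blast
        have "openin (top_of_set F) (F \<inter> - A \<gamma>)" using clA[OF g(1)] by (intro openin_open_Int) auto
        then show "openin (top_of_set F) T \<and> F \<subseteq> closure T"
          using dense[OF g(1)] g(2) by (simp add: Diff_eq)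
      qed
      moreover have "\<Inter>((\<lambda>\<gamma>. F - A \<gamma>) ` E) = {}"
      proof (rule ccontr)
        assume ne: "\<Inter>((\<lambda>\<gamma>. F - A \<gamma>) ` E) \<noteq> {}"
        obtain t0 where "t0 \<in> {a..b}" using Fne unfolding F_def by blast
        then have "E \<noteq> {}" using inA by blast
        then obtain t where t: "t \<in> F" "\<And>\<gamma>. \<gamma> \<in> E \<Longrightarrow> t \<notin> A \<gamma>" using ne by blast
        then show False using inA[of t] unfolding F_def by blast
      qed
      ultimately show False using Fne by simp
    qed
    then obtain \<gamma> x where g: "\<gamma> \<in> E" and x: "x \<in> F" "x \<notin> closure (F - A \<gamma>)" by blast
    obtain e where e: "e > 0" "\<And>y. y \<in> F \<Longrightarrow> dist y x < e \<Longrightarrow> y \<in> A \<gamma>"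
      using x(2) unfolding closure_approachable by blast
    have xab: "x \<in> {a..b}" using x(1) unfolding F_def by blast
    \<comment> \<open>Values of \<omega> at two times within d of \<open>x\<close> differ by less
      than m/4, so that pieces of the curve between such times count as short.\<close>
    obtain d where d: "d > 0" "\<And>t. t \<in> {a..b} \<Longrightarrow> dist t x < d \<Longrightarrow> dist (\<omega> t) (\<omega> x) < m/8"
      using omc xab m_pos unfolding continuous_on_iff by (metis zero_less_divide_iff zero_less_numeral)
    define \<rho> where "\<rho> = min e d"
    have \<rho>: "\<rho> > 0" using e d by (simp add: \<rho>_def)
    have seg: "\<exists>r<m. close_points r (\<eta> p) (\<eta> q)"
      if pq: "p \<in> {a..b}" "q \<in> {a..b}" "dist p x < \<rho>" "dist q x < \<rho>" and cov: "covered (closed_segment p q)" for p q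
    proof -
      define lo hi where "lo = min p q" and "hi = max p q"
      have lh: "a \<le> lo" "lo \<le> hi" "hi \<le> b" using pq by (auto simp: lo_def hi_def)
      have cs: "closed_segment p q = {lo..hi}" by (auto simp: closed_segment_eq_real_ivl lo_def hi_def)
      have small: "2 * (\<omega> hi - \<omega> lo) < m"
      proof -
        have "dist (\<omega> p) (\<omega> x) < m/8" "dist (\<omega> q) (\<omega> x) < m/8"
          using d(2)[of p] d(2)[of q] pq by (auto simp: \<rho>_def)
        then show ?thesis using m_pos by (auto simp: lo_def hi_def min_def max_def dist_real_def abs_if split: if_splits)
      qed
      obtain S where S: "finite S" "S \<subseteq> E" "\<eta> ` {lo..hi} \<subseteq> (\<Union>\<gamma>\<in>S. arc_trace \<gamma>)"
        using cov unfolding covered_def cs by blast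
      have "close_points (2 * (\<omega> hi - \<omega> lo)) (\<eta> lo) (\<eta> hi)"
      proof (rule finitely_many_arcs_close_endpoints[OF S(1,2) lh(2) _ S(3) _ small])
        show "continuous_on {lo..hi} \<eta>" by (rule continuous_on_subset[OF cont]) (use lh in auto)
        show "dist (\<eta> u) (\<eta> v) \<le> \<omega> v - \<omega> u" if "lo \<le> u" "u \<le> v" "v \<le> hi" for u v
          using om[of u v] that lh by linarith
      qed
      then have "close_points (2 * (\<omega> hi - \<omega> lo)) (\<eta> p) (\<eta> q)"
        by (cases "p \<le> q") (auto simp: lo_def hi_def intro: close_points_sym)
      then show ?thesis using small by blast
    qed
    have "\<eta> u \<in> (\<Union>\<gamma>'\<in>adjacent_arcs \<gamma>. arc_trace \<gamma>')" if u: "u \<in> {a..b} \<inter> ball x \<rho>" for u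
    proof (cases "u \<in> F")
      case True
      then have "u \<in> A \<gamma>" using e(2) u by (auto simp: \<rho>_def dist_commute)
      moreover have "\<gamma> \<in> adjacent_arcs \<gamma>" by (simp add: adjacent_arcs_def)
      ultimately show ?thesis unfolding A_def by blast
    next
      case False
      have "closed (F \<inter> closed_segment x u)" using clF by (intro closed_Int) auto
      moreover have "F \<inter> closed_segment x u \<noteq> {}" using x(1) by auto
      \<comment> \<open>The point of \<open>F\<close> between \<open>x\<close> and \<open>u\<close>
        that is nearest to \<open>u\<close>; the gap from \<open>c\<close> to \<open>u\<close>
        avoids \<open>F\<close> except at \<open>c\<close>.\<close>
      ultimately obtain c where c: "c \<in> F \<inter> closed_segment x u"
        "\<And>y. y \<in> F \<inter> closed_segment x u \<Longrightarrow> dist u c \<le> dist u y"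
        using distance_attains_inf[of "F \<inter> closed_segment x u" u] by blast
      have cu: "c \<noteq> u" using False c by auto
      have cxu: "c \<in> closed_segment x u" "c \<in> F" using c(1) by auto
      then have cx: "dist c x < \<rho>" "c \<in> {a..b}"
        using u xab by (auto simp: closed_segment_eq_real_ivl dist_real_def split: if_splits)
      have ux: "dist u x < \<rho>" "u \<in> {a..b}" using u by (auto simp: dist_commute)
      have gap: "t \<notin> F" if "t \<in> closed_segment c u" "t \<noteq> c" for t
      proof
        assume "t \<in> F"
        moreover have "t \<in> closed_segment x u" "dist u t < dist u c"
          using that cxu(1) cu by (auto simp: closed_segment_eq_real_ivl dist_real_def split: if_splits)
        ultimately show False using c(2)[of t] by auto
      qed
      obtain \<gamma>u where gu: "\<gamma>u \<in> E" "\<eta> u \<in> arc_trace \<gamma>u" using inA[OF ux(2)] unfolding A_def by blast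
      let ?T = "\<Union>\<gamma>'\<in>adjacent_arcs \<gamma>u. arc_trace \<gamma>'"
      have clT: "closed ?T"
        using adjacent_arcs[OF gu(1)] by (intro closed_UN) (auto intro: closed_arc_trace)
      \<comment> \<open>A segment that stops short of \<open>c\<close> is compact and avoids
        \<open>F\<close>, hence is covered; this puts \<eta> c' on an arc adjacent to that of \<eta>
        u. As these arcs form a closed set independent of c', the passage to the closure covers the
        segment up to and including \<open>c\<close>.\<close>
      have inT: "\<eta> c' \<in> ?T" if c': "c' \<in> open_segment c u" for c'
      proof -
        have c'u: "closed_segment c' u \<subseteq> closed_segment c u" "c \<notin> closed_segment c' u" "c' \<in> closed_segment c u"
          using c' by (auto simp: closed_segment_eq_real_ivl open_segment_eq_real_ivl split: if_splits)
        have sub: "closed_segment c u \<subseteq> {a..b}" "\<And>t. t \<in> closed_segment c u \<Longrightarrow> dist t x < \<rho>"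
          using cx ux by (auto simp: closed_segment_eq_real_ivl dist_real_def split: if_splits)
        have "covered (closed_segment c' u)"
        proof (rule cov_compact)
          show "closed_segment c' u \<subseteq> {a..b}" using c'u sub by blast
          show "closed_segment c' u \<inter> F = {}" using gap c'u by blast
        qed auto
        then obtain r where "r < m" "close_points r (\<eta> c') (\<eta> u)"
          using seg[of c' u] ux sub c'u(3) by blast
        then show ?thesis using close_points_adjacent[OF gu close_points_sym] by blast
      qed
      have "\<eta> ` closure (open_segment c u) \<subseteq> ?T"
      proof (rule image_closure_subset[OF _ clT])
        have "closure (open_segment c u) \<subseteq> {a..b}"
          using cu cx ux by (auto simp: closed_segment_eq_real_ivl split: if_splits)
        then show "continuous_on (closure (open_segment c u)) \<eta>" by (rule continuous_on_subset[OF cont])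
        show "\<eta> ` open_segment c u \<subseteq> ?T" using inT by blast
      qed
      then have "\<eta> ` closed_segment c u \<subseteq> ?T" using cu by simp
      then have "covered (closed_segment c u)"
        unfolding covered_def using adjacent_arcs[OF gu(1)] by blast
      then obtain r where "r < m" "close_points r (\<eta> c) (\<eta> u)" using seg[of c u] ux cx by blast
      moreover have "\<eta> c \<in> arc_trace \<gamma>"
        using e(2)[OF cxu(2)] cx(1) unfolding A_def \<rho>_def by auto
      ultimately show ?thesis using close_points_adjacent[OF g] by blast
    qed
    then have "covered ({a..b} \<inter> ball x \<rho>)"
      unfolding covered_def using adjacent_arcs[OF g] by blast
    then have "ball x \<rho> \<in> \<U>" unfolding \<U>_def by blast
    then show False using x(1) \<rho> unfolding F_def by (auto dest: bspec[of _ _ "ball x \<rho>"])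
  qed
  then have "covered {a..b}" by (intro cov_compact) auto
  then show ?thesis unfolding covered_def .
qed

lemma short_curve_close_endpoints:
  fixes \<eta> :: "real \<Rightarrow> 'a" and a b :: real
  assumes ab: "a \<le> b" and cont: "continuous_on {a..b} \<eta>" and im: "\<eta> ` {a..b} \<subseteq> network_points E"
    and om: "\<And>u v. a \<le> u \<Longrightarrow> u \<le> v \<Longrightarrow> v \<le> b \<Longrightarrow> dist (\<eta> u) (\<eta> v) \<le> \<omega> v - \<omega> u"
    and omc: "continuous_on {a..b} \<omega>" and short: "2 * (\<omega> b - \<omega> a) < m"
  shows "close_points (2 * (\<omega> b - \<omega> a)) (\<eta> a) (\<eta> b)"
proof -
  obtain S where S: "finite S" "S \<subseteq> E" "\<eta> ` {a..b} \<subseteq> (\<Union>\<gamma>\<in>S. arc_trace \<gamma>)"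
    using curve_covered_by_finitely_many_arcs[OF cont im om omc] by blast
  show ?thesis by (rule finitely_many_arcs_close_endpoints[OF S(1,2) ab cont S(3) om short])
qed

section \<open>Geodesic distance\<close>

text \<open>Serves to show that the set of lengths in \<open>geodesic_dist\<close> is nonempty,
  since the infimum of an empty set of reals carries no information. Lipschitz paths concatenate
  easily and are absolutely continuous.\<close>

definition lipschitz_joined :: "'a \<Rightarrow> 'a \<Rightarrow> bool" where
  "lipschitz_joined p q \<longleftrightarrow> (\<exists>L \<eta>. L-lipschitz_on {0..1::real} \<eta> \<and> \<eta> ` {0..1} \<subseteq> network_points E \<and> \<eta> 0 = p \<and> \<eta> 1 = q)"

lemma lipschitz_joined_trans:
  assumes "lipschitz_joined p q" "lipschitz_joined q r" shows "lipschitz_joined p r"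
proof -
  obtain L f where f: "L-lipschitz_on {0..1::real} f" "f ` {0..1} \<subseteq> network_points E" "f 0 = p" "f 1 = q"
    using assms(1) unfolding lipschitz_joined_def by blast
  obtain M g where g: "M-lipschitz_on {0..1::real} g" "g ` {0..1} \<subseteq> network_points E" "g 0 = q" "g 1 = r"
    using assms(2) unfolding lipschitz_joined_def by blast
  let ?h = "\<lambda>x::real. if x \<le> 1/2 then f (2 * x) else g (2 * x - 1)"
  have "(L * 2)-lipschitz_on {0..1/2} (\<lambda>x. f (2 * x))"
  proof (rule lipschitz_on_compose2[where f="\<lambda>x. 2 * x" and g=f])
    show "2-lipschitz_on {0..1/2} (\<lambda>x::real. 2 * x)" by (rule lipschitz_onI) (auto simp: dist_real_def abs_if)
    show "L-lipschitz_on ((\<lambda>x. 2 * x) ` {0..1/2}) f" by (rule lipschitz_on_subset[OF f(1)]) auto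
  qed
  moreover have "(M * 2)-lipschitz_on {1/2..1} (\<lambda>x. g (2 * x - 1))"
  proof (rule lipschitz_on_compose2[where f="\<lambda>x. 2 * x - 1" and g=g])
    show "2-lipschitz_on {1/2..1} (\<lambda>x::real. 2 * x - 1)" by (rule lipschitz_onI) (auto simp: dist_real_def abs_if)
    show "M-lipschitz_on ((\<lambda>x. 2 * x - 1) ` {1/2..1}) g" by (rule lipschitz_on_subset[OF g(1)]) auto
  qed
  ultimately have "(max (L * 2) (M * 2))-lipschitz_on {0..1} ?h"
    by (rule lipschitz_on_concat_max) (use f g in auto)
  moreover have "?h ` {0..1} \<subseteq> network_points E"
  proof -
    have "?h x \<in> network_points E" if "x \<in> {0..1}" for x
    proof (cases "x \<le> 1/2")
      case True
      have "f (2 * x) \<in> network_points E" by (rule subsetD[OF f(2) imageI]) (use True that in auto)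
      then show ?thesis using True by simp
    next
      case False
      have "g (2 * x - 1) \<in> network_points E" by (rule subsetD[OF g(2) imageI]) (use False that in auto)
      then show ?thesis using False by simp
    qed
    then show ?thesis by blast
  qed
  ultimately show ?thesis unfolding lipschitz_joined_def
    by (intro exI[of _ "max (L * 2) (M * 2)"] exI[of _ ?h]) (use f g in auto)
qed

lemma lipschitz_joined_arc:
  assumes g: "\<gamma> \<in> E" "s \<in> {0..arc_len \<gamma>}" "s' \<in> {0..arc_len \<gamma>}"
  shows "lipschitz_joined (arc_pt \<gamma> s) (arc_pt \<gamma> s')"
proof -
  let ?k = "\<lambda>x::real. s + x * (s' - s)"
  have sub: "?k ` {0..1} \<subseteq> {0..arc_len \<gamma>}"
  proof
    fix y assume "y \<in> ?k ` {0..1}"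
    then obtain x where x: "x \<in> {0..1}" "y = ?k x" by blast
    have "y = (1 - x) * s + x * s'" using x(2) by (simp add: algebra_simps)
    moreover have "(1 - x) * s \<le> (1 - x) * arc_len \<gamma>" "x * s' \<le> x * arc_len \<gamma>"
      using g(2,3) x(1) by (auto intro: mult_left_mono)
    moreover have "(1 - x) * arc_len \<gamma> + x * arc_len \<gamma> = arc_len \<gamma>" by (simp add: algebra_simps)
    moreover have "0 \<le> (1 - x) * s" "0 \<le> x * s'" using g(2,3) x(1) by auto
    ultimately show "y \<in> {0..arc_len \<gamma>}" by simp
  qed
  have "(1 * \<bar>s' - s\<bar>)-lipschitz_on {0..1} (\<lambda>x. arc_pt \<gamma> (?k x))"
  proof (rule lipschitz_on_compose2[where f="?k" and g="arc_pt \<gamma>"])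
    have "dist (s + x * (s' - s)) (s + y * (s' - s)) = \<bar>s' - s\<bar> * dist x y" for x y :: real
      by (simp add: dist_real_def flip: abs_mult) (simp add: algebra_simps)
    then show "\<bar>s' - s\<bar>-lipschitz_on {0..1} ?k" by (intro lipschitz_onI) auto
    show "1-lipschitz_on (?k ` {0..1}) (arc_pt \<gamma>)"
      by (rule lipschitz_on_subset[OF regular_arc_lipschitz[OF reg[OF g(1)]] sub])
  qed
  moreover have "(\<lambda>x. arc_pt \<gamma> (?k x)) ` {0..1} \<subseteq> network_points E"
  proof -
    have "arc_pt \<gamma> (?k x) \<in> network_points E" if "x \<in> {0..1}" for x
      unfolding network_points_def using g(1) subsetD[OF sub imageI[OF that]] by blast
    then show ?thesis by blast
  qed
  ultimately show ?thesis unfolding lipschitz_joined_def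
    by (intro exI[of _ "1 * \<bar>s' - s\<bar>"] exI[of _ "\<lambda>x. arc_pt \<gamma> (?k x)"]) auto
qed

lemma lipschitz_joined_network:
  assumes "p \<in> network_points E" "q \<in> network_points E" shows "lipschitz_joined p q"
proof -
  obtain \<gamma> s where g: "\<gamma> \<in> E" "s \<in> {0..arc_len \<gamma>}" "p = arc_pt \<gamma> s" using network_pointE[OF assms(1)] by metis
  obtain \<gamma>' s' where g': "\<gamma>' \<in> E" "s' \<in> {0..arc_len \<gamma>'}" "q = arc_pt \<gamma>' s'" using network_pointE[OF assms(2)] by metis
  have z: "0 \<in> {0..arc_len \<gamma>}" "arc_len \<gamma> \<in> {0..arc_len \<gamma>}" if "\<gamma> \<in> E" for \<gamma> using len_pos[OF that] by auto
  have "(arc_pt \<gamma> 0, arc_pt \<gamma>' 0) \<in> {(arc_pt \<gamma> 0, arc_pt \<gamma> (arc_len \<gamma>)) |\<gamma>. \<gamma> \<in> E}\<^sup>*"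
    by (rule arcs_connected) (use g g' start_vertex in auto)
  then have "lipschitz_joined (arc_pt \<gamma> 0) (arc_pt \<gamma>' 0)"
  proof (induction rule: rtrancl_induct)
    case base show ?case using lipschitz_joined_arc[OF g(1) z(1)[OF g(1)] z(1)[OF g(1)]] .
  next
    case (step y w)
    then obtain \<gamma>1 where "\<gamma>1 \<in> E" "y = arc_pt \<gamma>1 0" "w = arc_pt \<gamma>1 (arc_len \<gamma>1)" by blast
    then show ?case using step(3) lipschitz_joined_arc[OF _ z, of \<gamma>1] lipschitz_joined_trans by metis
  qed
  then show ?thesis
    using lipschitz_joined_arc[OF g(1,2) z(1)[OF g(1)]] lipschitz_joined_arc[OF g'(1) z(1)[OF g'(1)] g'(2)] g(3) g'(3)
      lipschitz_joined_trans by metis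
qed

text \<open>Some connecting curve is shorter than r. Its arc length is the control function, and 2 r
  \<le> m makes it a short curve.\<close>

lemma geodesic_dist_less_imp_close:
  assumes pq: "p \<in> network_points E" "q \<in> network_points E"
    and d: "geodesic_dist E p q < r" and r: "2 * r \<le> m"
  shows "close_points (2 * r) p q"
proof -
  let ?X = "{curve_length 0 1 \<eta> | \<eta>. curve_in (network_points E) 0 1 \<eta> \<and> \<eta> 0 = p \<and> \<eta> 1 = q}"
  obtain L \<eta>0 where "L-lipschitz_on {0..1::real} \<eta>0" "\<eta>0 ` {0..1} \<subseteq> network_points E" "\<eta>0 0 = p" "\<eta>0 1 = q"
    using lipschitz_joined_network[OF pq] unfolding lipschitz_joined_def by blast
  then have "curve_in (network_points E) 0 1 \<eta>0" "\<eta>0 0 = p" "\<eta>0 1 = q"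
    unfolding curve_in_def using lipschitz_absolutely_continuous[of L 0 1 \<eta>0] by simp_all
  then have "curve_length 0 1 \<eta>0 \<in> ?X" by (intro CollectI exI[of _ \<eta>0] conjI refl)
  then have ne: "?X \<noteq> {}" by (metis empty_iff)
  have "Inf ?X < r" using d by (simp add: geodesic_dist_def)
  from cInf_lessD[OF ne this] obtain y where y: "y \<in> ?X" "y < r" by (rule bexE)
  then obtain \<eta> where \<eta>: "curve_in (network_points E) 0 1 \<eta>" "\<eta> 0 = p" "\<eta> 1 = q" "curve_length 0 1 \<eta> < r"
    by auto
  have ac: "absolutely_continuous_curve 0 1 \<eta>" and im: "\<eta> ` {0..1} \<subseteq> network_points E"
    using \<eta>(1) unfolding curve_in_def by auto
  let ?w = "arclength 0 \<eta>"
  have w: "?w 1 = curve_length 0 1 \<eta>" "?w 0 = 0"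
    using arclength_eq_curve_length[OF ac] by (auto simp: arclength_def)
  have "close_points (2 * (?w 1 - ?w 0)) (\<eta> 0) (\<eta> 1)"
  proof (rule short_curve_close_endpoints[OF _ absolutely_continuous_curve_continuous[OF ac] im])
    show "dist (\<eta> u) (\<eta> v) \<le> ?w v - ?w u" if "0 \<le> u" "u \<le> v" "v \<le> 1" for u v
      by (rule dist_le_arclength[OF ac _ that]) simp
    show "continuous_on {0..1} ?w" by (rule arclength_continuous[OF ac]) simp
    show "2 * (?w 1 - ?w 0) < m" using w \<eta>(4) r by simp
  qed simp
  then show ?thesis using close_points_mono w \<eta> by auto
qed

end


section \<open>Coordinates along an arc\<close>

lemma continuous_interval_measurable:
  "continuous_on {a..b} f \<Longrightarrow> f \<in> borel_measurable (lebesgue_on {a..b::real})"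
  by (rule continuous_imp_measurable_on_sets_lebesgue) auto

text \<open>The parameter enters through a profile \<psi> that will vanish at both ends. Then the
  extension by zero is continuous across vertices, and the parameter chosen at the base point of a
  loop does not matter.\<close>

definition arc_coord :: "'a arc \<Rightarrow> (real \<Rightarrow> real) \<Rightarrow> 'a \<Rightarrow> real" where
  "arc_coord \<gamma> \<psi> p = (if p \<in> arc_trace \<gamma> then \<psi> (SOME s. s \<in> {0..arc_len \<gamma>} \<and> p = arc_pt \<gamma> s) else 0)"

definition arc_profile :: "'a arc \<Rightarrow> real \<Rightarrow> (real \<Rightarrow> real) \<Rightarrow> bool" where
  "arc_profile \<gamma> K \<psi> \<longleftrightarrow> K-lipschitz_on {0..arc_len \<gamma>} \<psi> \<and> \<psi> 0 = 0 \<and> \<psi> (arc_len \<gamma>) = 0"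

context metric_network
begin

lemma arc_coord_eq:
  assumes g: "\<gamma> \<in> E" "s \<in> {0..arc_len \<gamma>}" and psi: "arc_profile \<gamma> K \<psi>"
  shows "arc_coord \<gamma> \<psi> (arc_pt \<gamma> s) = \<psi> s"
proof -
  let ?P = "\<lambda>s'. s' \<in> {0..arc_len \<gamma>} \<and> arc_pt \<gamma> s = arc_pt \<gamma> s'"
  define z where "z = (SOME s'. ?P s')"
  have "?P s" using g(2) by simp
  then have z: "z \<in> {0..arc_len \<gamma>}" "arc_pt \<gamma> s = arc_pt \<gamma> z" unfolding z_def by (metis (mono_tags, lifting) someI_ex)+
  have "arc_coord \<gamma> \<psi> (arc_pt \<gamma> s) = \<psi> z" unfolding arc_coord_def z_def using g(2) by simp
  also have "\<psi> z = \<psi> s"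
  proof (cases "arc_pt \<gamma> s \<in> vertices E")
    case True
    then have "s = 0 \<or> s = arc_len \<gamma>" "z = 0 \<or> z = arc_len \<gamma>"
      using vertex_on_arc[OF g] vertex_on_arc[OF g(1) z(1)] z(2) by auto
    then show ?thesis using psi unfolding arc_profile_def by auto
  next
    case False
    then have "s \<noteq> 0" "s \<noteq> arc_len \<gamma>" using start_vertex[OF g(1)] end_vertex[OF g(1)] by auto
    then show ?thesis using same_arc_interior[OF g(1) _ z] g(2) by auto
  qed
  finally show ?thesis .
qed

lemma arc_coord_other:
  assumes g: "\<gamma> \<in> E" "\<gamma>' \<in> E" "s \<in> {0..arc_len \<gamma>'}" and psi: "arc_profile \<gamma> K \<psi>"
    and ne: "\<gamma>' \<noteq> \<gamma>" "\<gamma>' \<noteq> inverse_arc \<gamma>"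
  shows "arc_coord \<gamma> \<psi> (arc_pt \<gamma>' s) = 0"
proof (cases "arc_pt \<gamma>' s \<in> arc_trace \<gamma>")
  case True
  then obtain s0 where s0: "s0 \<in> {0..arc_len \<gamma>}" "arc_pt \<gamma>' s = arc_pt \<gamma> s0" by blast
  have "s0 = 0 \<or> s0 = arc_len \<gamma>"
  proof (rule ccontr)
    assume "\<not> ?thesis"
    then have "s0 \<in> {0<..<arc_len \<gamma>}" using s0(1) by auto
    from interior_point_unique[OF g(1,2) this g(3)] s0(2) ne show False by auto
  qed
  then show ?thesis using arc_coord_eq[OF g(1) s0(1) psi] s0(2) psi unfolding arc_profile_def by auto
qed (simp add: arc_coord_def)

lemma arc_coord_inverse:
  assumes g: "\<gamma> \<in> E" "s \<in> {0..arc_len \<gamma>}" and psi: "arc_profile \<gamma> K \<psi>"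
  shows "arc_coord \<gamma> \<psi> (arc_pt (inverse_arc \<gamma>) s) = \<psi> (arc_len \<gamma> - s)"
  using arc_coord_eq[OF g(1) _ psi, of "arc_len \<gamma> - s"] g(2) by simp

lemma arc_coord_vertex:
  assumes g: "\<gamma> \<in> E" "x \<in> vertices E" and psi: "arc_profile \<gamma> K \<psi>"
  shows "arc_coord \<gamma> \<psi> x = 0"
proof (cases "x \<in> arc_trace \<gamma>")
  case True
  then obtain s where s: "s \<in> {0..arc_len \<gamma>}" "x = arc_pt \<gamma> s" by blast
  then have "s = 0 \<or> s = arc_len \<gamma>" using vertex_on_arc[OF g(1) s(1)] g(2) by simp
  then show ?thesis using arc_coord_eq[OF g(1) s(1) psi] s(2) psi unfolding arc_profile_def by auto
qed (simp add: arc_coord_def)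

lemma arc_coord_same_arc:
  assumes g: "\<gamma> \<in> E" "\<gamma>' \<in> E" "s \<in> {0..arc_len \<gamma>'}" "s' \<in> {0..arc_len \<gamma>'}" and psi: "arc_profile \<gamma> K \<psi>"
  shows "\<bar>arc_coord \<gamma> \<psi> (arc_pt \<gamma>' s) - arc_coord \<gamma> \<psi> (arc_pt \<gamma>' s')\<bar> \<le> K * \<bar>s - s'\<bar>"
proof -
  have lip: "\<bar>\<psi> u - \<psi> v\<bar> \<le> K * \<bar>u - v\<bar>" if "u \<in> {0..arc_len \<gamma>}" "v \<in> {0..arc_len \<gamma>}" for u v
    using psi lipschitz_onD that unfolding arc_profile_def by (force simp: dist_real_def)
  have K: "K \<ge> 0" using psi lipschitz_on_nonneg unfolding arc_profile_def by blast
  consider "\<gamma>' = \<gamma>" | "\<gamma>' = inverse_arc \<gamma>" | "\<gamma>' \<noteq> \<gamma>" "\<gamma>' \<noteq> inverse_arc \<gamma>" by blast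
  then show ?thesis
  proof cases
    case 1 then show ?thesis using arc_coord_eq[OF g(1) _ psi] g lip by simp
  next
    case 2
    then have ss: "s \<in> {0..arc_len \<gamma>}" "s' \<in> {0..arc_len \<gamma>}" using g by simp_all
    have "\<bar>\<psi> (arc_len \<gamma> - s) - \<psi> (arc_len \<gamma> - s')\<bar> \<le> K * \<bar>(arc_len \<gamma> - s) - (arc_len \<gamma> - s')\<bar>"
      using ss by (intro lip) auto
    then show ?thesis
      using 2 arc_coord_inverse[OF g(1) ss(1) psi] arc_coord_inverse[OF g(1) ss(2) psi]
      by (simp add: abs_minus_commute)
  next
    case 3
    then show ?thesis using arc_coord_other[OF g(1,2) _ psi] g K by simp
  qed
qed

text \<open>At a common vertex the coordinate is zero, so two arms of parameter lengths s and s'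
  contribute at most K s + K s'.\<close>

lemma arc_coord_close:
  assumes g: "\<gamma> \<in> E" and psi: "arc_profile \<gamma> K \<psi>" and cl: "close_points r p q"
  shows "\<bar>arc_coord \<gamma> \<psi> p - arc_coord \<gamma> \<psi> q\<bar> \<le> K * r"
proof -
  have K: "K \<ge> 0" using psi lipschitz_on_nonneg unfolding arc_profile_def by blast
  from cl show ?thesis
  proof (cases rule: close_pointsE)
    case (one \<gamma>1 s s')
    have "K * \<bar>s - s'\<bar> \<le> K * r" using one(6) K by (rule mult_left_mono)
    then show ?thesis using arc_coord_same_arc[OF g one(1,2,3) psi] one(4,5) by simp
  next
    case (two \<gamma>1 \<gamma>2 s s')
    have z: "0 \<in> {0..arc_len \<gamma>1}" "0 \<in> {0..arc_len \<gamma>2}" using len_pos[OF two(1)] len_pos[OF two(2)] by auto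
    have v: "arc_coord \<gamma> \<psi> (arc_pt \<gamma>1 0) = 0" "arc_coord \<gamma> \<psi> (arc_pt \<gamma>2 0) = 0"
      using arc_coord_vertex[OF g _ psi] start_vertex two by auto
    have "\<bar>arc_coord \<gamma> \<psi> p\<bar> \<le> K * s" "\<bar>arc_coord \<gamma> \<psi> q\<bar> \<le> K * s'"
      using arc_coord_same_arc[OF g two(1,3) z(1) psi] arc_coord_same_arc[OF g two(2,4) z(2) psi] v two by auto
    moreover have "K * (s + s') \<le> K * r" using two(8) K by (rule mult_left_mono)
    ultimately show ?thesis by (simp add: algebra_simps)
  qed
qed

text \<open>Closeness through two arcs would pass an endpoint of \<gamma>, and both endpoints are
  farther than r from the given parameter.\<close>

lemma close_interior_point:
  assumes g: "\<gamma> \<in> E" "s0 \<in> {0<..<arc_len \<gamma>}" and r: "r < s0" "r < arc_len \<gamma> - s0"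
    and cl: "close_points r (arc_pt \<gamma> s0) q"
  shows "\<exists>s\<in>{0..arc_len \<gamma>}. q = arc_pt \<gamma> s \<and> \<bar>s - s0\<bar> \<le> r"
  using cl
proof (cases rule: close_pointsE)
  case (one \<gamma>1 s s')
  from interior_point_unique[OF g(1) one(1) g(2) one(2,4)]
  show ?thesis
  proof (elim disjE conjE)
    assume "\<gamma>1 = \<gamma>" "s = s0"
    then show ?thesis using one by (intro bexI[of _ s']) (auto simp: abs_minus_commute)
  next
    assume "\<gamma>1 = inverse_arc \<gamma>" "s = arc_len \<gamma> - s0"
    then show ?thesis using one by (intro bexI[of _ "arc_len \<gamma> - s'"]) auto
  qed
next
  case (two \<gamma>1 \<gamma>2 s s')
  from interior_point_unique[OF g(1) two(1) g(2) two(3,6)]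
  have "s = s0 \<or> s = arc_len \<gamma> - s0" by blast
  then show ?thesis using two(4,8) r by auto
qed

text \<open>The bound r < m excludes that \<open>x\<close> is the far end of the first arc, so the
  other point lies on an arc that leaves \<open>x\<close>.\<close>

lemma close_vertex:
  assumes x: "x \<in> vertices E" and r: "r < m" and cl: "close_points r x q"
  shows "\<exists>\<gamma>\<in>arcs_from E x. \<exists>s\<in>{0..arc_len \<gamma>}. q = arc_pt \<gamma> s \<and> s \<le> r"
  using cl
proof (cases rule: close_pointsE)
  case (one \<gamma>1 s s')
  have "arc_pt \<gamma>1 s \<in> vertices E" using one x by simp
  then obtain \<gamma>' s'' where *: "\<gamma>' \<in> E" "s'' \<in> {0..arc_len \<gamma>'}" "arc_pt \<gamma>' s'' = arc_pt \<gamma>1 s'"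
    "arc_pt \<gamma>' 0 = arc_pt \<gamma>1 s" "s'' = \<bar>s' - s\<bar>"
    using vertex_start_reparam[OF one(1,3,2)] by metis
  have "\<gamma>' \<in> arcs_from E x" using * one(4) unfolding arcs_from_def by simp
  moreover have "q = arc_pt \<gamma>' s''" "s'' \<le> r" using * one by (auto simp: abs_minus_commute)
  ultimately show ?thesis using *(2) by blast
next
  case (two \<gamma>1 \<gamma>2 s s')
  have "s = 0 \<or> s = arc_len \<gamma>1" using vertex_on_arc[OF two(1,3)] two(6) x by simp
  then have s: "s = 0" using two(4,8) r m_le[OF two(1)] by auto
  then have "\<gamma>2 \<in> arcs_from E x" using two unfolding arcs_from_def by simp
  moreover have "s' \<le> r" using two(8) s by simp
  ultimately show ?thesis using two(4,7) by blast
qed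

section \<open>Coordinates along a curve\<close>

lemma close_points_of_control:
  fixes \<xi> :: "real \<Rightarrow> 'a" and a b :: real
  assumes cont: "continuous_on {a..b} \<xi>" and im: "\<xi> ` {a..b} \<subseteq> network_points E"
    and om: "\<And>u v. a \<le> u \<Longrightarrow> u \<le> v \<Longrightarrow> v \<le> b \<Longrightarrow> dist (\<xi> u) (\<xi> v) \<le> \<omega> v - \<omega> u"
    and omc: "continuous_on {a..b} \<omega>" and uv: "a \<le> u" "u \<le> v" "v \<le> b" and short: "2 * (\<omega> v - \<omega> u) < m"
  shows "close_points (2 * (\<omega> v - \<omega> u)) (\<xi> u) (\<xi> v)"
proof (rule short_curve_close_endpoints[OF uv(2) _ _ _ _ short])
  show "continuous_on {u..v} \<xi>" "continuous_on {u..v} \<omega>"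
    by (rule continuous_on_subset[OF cont] continuous_on_subset[OF omc]; use uv in auto)+
  show "\<xi> ` {u..v} \<subseteq> network_points E" by (rule order_trans[OF image_mono im]) (use uv in auto)
  show "dist (\<xi> x) (\<xi> y) \<le> \<omega> y - \<omega> x" if "u \<le> x" "x \<le> y" "y \<le> v" for x y
    using om[of x y] that uv by linarith
qed

text \<open>Closeness is available for short pieces; uniform continuity of \<omega> cuts the curve
  into such pieces and the increments add up. The control function is left open because two
  different ones will be inserted.\<close>

lemma arc_coord_control:
  fixes \<xi> :: "real \<Rightarrow> 'a" and a b :: real
  assumes cont: "continuous_on {a..b} \<xi>" and im: "\<xi> ` {a..b} \<subseteq> network_points E"
    and om: "\<And>u v. a \<le> u \<Longrightarrow> u \<le> v \<Longrightarrow> v \<le> b \<Longrightarrow> dist (\<xi> u) (\<xi> v) \<le> \<omega> v - \<omega> u"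
    and omc: "continuous_on {a..b} \<omega>" and uv: "a \<le> u" "u \<le> v" "v \<le> b"
    and g: "\<gamma> \<in> E" and psi: "arc_profile \<gamma> K \<psi>"
  shows "dist (arc_coord \<gamma> \<psi> (\<xi> u)) (arc_coord \<gamma> \<psi> (\<xi> v)) \<le> (2 * K) * (\<omega> v - \<omega> u)"
proof -
  let ?W = "\<lambda>t. arc_coord \<gamma> \<psi> (\<xi> t)"
  have "uniformly_continuous_on {a..b} \<omega>" using omc by (intro compact_uniformly_continuous) auto
  moreover have "m/2 > 0" using m_pos by simp
  ultimately obtain \<delta> where \<delta>: "\<delta> > 0" "\<And>x x'. x \<in> {a..b} \<Longrightarrow> x' \<in> {a..b} \<Longrightarrow> dist x' x < \<delta> \<Longrightarrow> dist (\<omega> x') (\<omega> x) < m/2"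
    unfolding uniformly_continuous_on_def by metis
  have "\<bar>?W v - ?W u\<bar> \<le> (2 * K) * \<omega> v - (2 * K) * \<omega> u"
  proof (rule local_increments_imp_global[OF \<delta>(1) uv(2), where \<sigma> = ?W and \<omega> = "\<lambda>t. (2 * K) * \<omega> t"])
    fix s t assume st: "u \<le> s" "s \<le> t" "t \<le> v" "t - s < \<delta>"
    then have "dist (\<omega> t) (\<omega> s) < m/2" using uv by (intro \<delta>(2)) (auto simp: dist_real_def)
    then have "2 * (\<omega> t - \<omega> s) < m" by (auto simp: dist_real_def abs_if split: if_splits)
    then have "close_points (2 * (\<omega> t - \<omega> s)) (\<xi> s) (\<xi> t)"
      using st uv by (intro close_points_of_control[OF cont im om omc]) auto
    from arc_coord_close[OF g psi this] show "\<bar>?W t - ?W s\<bar> \<le> (2 * K) * \<omega> t - (2 * K) * \<omega> s"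
      by (simp add: algebra_simps abs_minus_commute)
  qed
  then show ?thesis by (simp add: dist_real_def abs_minus_commute right_diff_distrib)
qed

text \<open>The variation as control function gives absolute continuity, the arc length gives the
  bound on the velocity. In 2 K the 2 is that of the local expansion.\<close>

lemma arc_coord_curve:
  fixes \<xi> :: "real \<Rightarrow> 'a" and a b :: real
  assumes \<xi>: "curve_in (network_points E) a b \<xi>" and ab: "a \<le> b" and g: "\<gamma> \<in> E" and psi: "arc_profile \<gamma> K \<psi>"
  shows "absolutely_continuous_curve a b (\<lambda>t. arc_coord \<gamma> \<psi> (\<xi> t))"
    and "AE t in lebesgue_on {a..b}. \<bar>velocity (\<lambda>t. arc_coord \<gamma> \<psi> (\<xi> t)) t\<bar> \<le> (2 * K) * norm (velocity \<xi> t)"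
proof -
  let ?W = "\<lambda>t. arc_coord \<gamma> \<psi> (\<xi> t)"
  have ac: "absolutely_continuous_curve a b \<xi>" and im: "\<xi> ` {a..b} \<subseteq> network_points E"
    using \<xi> unfolding curve_in_def by auto
  have K: "K \<ge> 0" using psi lipschitz_on_nonneg unfolding arc_profile_def by blast
  note cont = absolutely_continuous_curve_continuous[OF ac]
  let ?V = "chain_var \<xi> a"
  have Vac: "absolutely_continuous_curve a b ?V" by (rule chain_var_absolutely_continuous[OF ac])
  have step: "dist (\<xi> u) (\<xi> v) \<le> ?V v - ?V u" if "a \<le> u" "u \<le> v" "v \<le> b" for u v
    using chain_var_step[OF ac that] by linarith
  show W: "absolutely_continuous_curve a b ?W"
  proof (rule absolutely_continuous_curve_controlled[OF Vac, of "2 * K"])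
    fix u v assume uv: "a \<le> u" "u \<le> v" "v \<le> b"
    have "dist (?W u) (?W v) \<le> (2 * K) * (?V v - ?V u)"
      by (rule arc_coord_control[OF cont im step absolutely_continuous_curve_continuous[OF Vac] uv g psi])
    also have "\<dots> \<le> (2 * K) * dist (?V u) (?V v)"
      using K by (intro mult_left_mono) (auto simp: dist_real_def)
    finally show "dist (?W u) (?W v) \<le> (2 * K) * dist (?V u) (?V v)" .
  qed (use K in simp)
  show "AE t in lebesgue_on {a..b}. \<bar>velocity ?W t\<bar> \<le> (2 * K) * norm (velocity \<xi> t)"
  proof (rule velocity_bound_of_arclength[OF ac W ab])
    fix u v assume uv: "a \<le> u" "u \<le> v" "v \<le> b"
    show "dist (?W u) (?W v) \<le> (2 * K) * (arclength a \<xi> v - arclength a \<xi> u)"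
      by (rule arc_coord_control[OF cont im dist_le_arclength[OF ac ab] arclength_continuous[OF ac ab] uv g psi])
  qed
qed

text \<open>Where the profile is the identity, \<xi> is near t the arc evaluated at the coordinate,
  so the chain rule applies and the velocity is tangent to the arc.\<close>

lemma velocity_on_arc:
  fixes \<xi> :: "real \<Rightarrow> 'a" and a b :: real
  assumes \<xi>: "curve_in (network_points E) a b \<xi>" and g: "\<gamma> \<in> E" and psi: "arc_profile \<gamma> K \<psi>"
    and t: "t \<in> {a<..<b}" and s0: "s0 \<in> {0<..<arc_len \<gamma>}" "\<xi> t = arc_pt \<gamma> s0"
    and e: "e > 0" "\<And>s. s \<in> {0..arc_len \<gamma>} \<Longrightarrow> \<bar>s - s0\<bar> < e \<Longrightarrow> \<psi> s = s"
    and D: "((\<lambda>t. arc_coord \<gamma> \<psi> (\<xi> t)) has_vector_derivative D) (at t)"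
  shows "velocity \<xi> t = D *\<^sub>R arc_vel \<gamma> s0"
proof -
  let ?W = "\<lambda>t. arc_coord \<gamma> \<psi> (\<xi> t)"
  have ac: "absolutely_continuous_curve a b \<xi>" and im: "\<xi> ` {a..b} \<subseteq> network_points E"
    using \<xi> unfolding curve_in_def by auto
  have ab: "a \<le> b" using t by auto
  let ?w = "arclength a \<xi>"
  \<comment> \<open>\<open>e\<close> keeps the parameter where the profile is the identity, m is the
    scale of short curves, and the last two terms keep it off both endpoints.\<close>
  define r0 where "r0 = min (min e m) (min s0 (arc_len \<gamma> - s0))"
  have r0: "r0 > 0" using e m_pos s0 by (auto simp: r0_def)
  have "continuous_on {a..b} ?w" by (rule arclength_continuous[OF ac ab])
  moreover have "t \<in> {a..b}" "r0/2 > 0" using t r0 by auto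
  ultimately obtain d where d: "d > 0" "\<And>x. x \<in> {a..b} \<Longrightarrow> dist x t < d \<Longrightarrow> dist (?w x) (?w t) < r0/2"
    unfolding continuous_on_iff by metis
  have near: "\<xi> x = arc_pt \<gamma> (?W x)" if x: "x \<in> ball t d \<inter> {a<..<b}" for x
  proof -
    have xab: "x \<in> {a..b}" "dist x t < d" using x by (auto simp: dist_commute)
    define r where "r = 2 * \<bar>?w x - ?w t\<bar>"
    have r: "r < r0" using d(2)[OF xab] by (simp add: r_def dist_real_def)
    have "close_points r (\<xi> t) (\<xi> x)"
    proof (cases "t \<le> x")
      case True
      have "0 \<le> ?w x - ?w t"
        using dist_le_arclength[OF ac ab, of t x] True xab t zero_le_dist[of "\<xi> t" "\<xi> x"] by (auto simp del: zero_le_dist)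
      moreover have "close_points (2 * (?w x - ?w t)) (\<xi> t) (\<xi> x)"
        using True xab t r r_def r0_def calculation
        by (intro close_points_of_control[OF absolutely_continuous_curve_continuous[OF ac] im dist_le_arclength[OF ac ab] arclength_continuous[OF ac ab]]) auto
      ultimately show ?thesis by (simp add: r_def)
    next
      case False
      have "0 \<le> ?w t - ?w x"
        using dist_le_arclength[OF ac ab, of x t] False xab t zero_le_dist[of "\<xi> x" "\<xi> t"] by (auto simp del: zero_le_dist)
      moreover have "close_points (2 * (?w t - ?w x)) (\<xi> x) (\<xi> t)"
        using False xab t r r_def r0_def calculation
        by (intro close_points_of_control[OF absolutely_continuous_curve_continuous[OF ac] im dist_le_arclength[OF ac ab] arclength_continuous[OF ac ab]]) auto
      ultimately show ?thesis by (simp add: r_def close_points_sym)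
    qed
    then obtain s where s: "s \<in> {0..arc_len \<gamma>}" "\<xi> x = arc_pt \<gamma> s" "\<bar>s - s0\<bar> \<le> r"
      using close_interior_point[OF g s0(1), of r "\<xi> x"] r s0(2) by (auto simp: r0_def)
    have "?W x = \<psi> s" using arc_coord_eq[OF g s(1) psi] s(2) by simp
    also have "\<psi> s = s" using e(2)[OF s(1)] s(3) r by (simp add: r0_def)
    finally show ?thesis using s(2) by simp
  qed
  have Wt: "?W t = s0"
    using arc_coord_eq[OF g _ psi, of s0] e(2)[of s0] e(1) s0 by simp
  have "(arc_pt \<gamma> has_vector_derivative arc_vel \<gamma> s0) (at s0 within {0..arc_len \<gamma>})"
    using reg[OF g] s0(1) unfolding regular_arc_def by auto
  then have "(arc_pt \<gamma> has_vector_derivative arc_vel \<gamma> s0) (at (?W t))"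
    using s0(1) Wt at_within_Icc_at[of 0 s0 "arc_len \<gamma>"] by auto
  from vector_diff_chain_at[OF D this]
  have "((\<lambda>x. arc_pt \<gamma> (?W x)) has_vector_derivative D *\<^sub>R arc_vel \<gamma> s0) (at t)" by (simp add: o_def)
  then have "(\<xi> has_vector_derivative D *\<^sub>R arc_vel \<gamma> s0) (at t)"
  proof (rule has_vector_derivative_transform_within_open)
    show "open (ball t d \<inter> {a<..<b})" "t \<in> ball t d \<inter> {a<..<b}" using d t by auto
  qed (use near in simp)
  then show ?thesis by (rule vector_derivative_at)
qed

end


section \<open>Lagrangians\<close>

lemma superlinear_bound_eventually:
  assumes "superlinear_bound \<theta>"
  obtains R where "R > 0" "\<And>r. r \<ge> R \<Longrightarrow> k * r \<le> \<theta> r"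
proof -
  have "eventually (\<lambda>r. k \<le> \<theta> r / r) at_top"
    using assms unfolding superlinear_bound_def filterlim_at_top by blast
  then obtain R where R: "\<And>r. r \<ge> R \<Longrightarrow> k \<le> \<theta> r / r" unfolding eventually_at_top_linorder by blast
  show ?thesis
  proof (rule that[of "max R 1"])
    fix r assume "r \<ge> max R 1"
    then have "k \<le> \<theta> r / r" "r > 0" using R[of r] by auto
    then show "k * r \<le> \<theta> r" by (simp add: field_simps)
  qed simp
qed

section \<open>Growth and representation of the Lagrangians\<close>

text \<open>Growth functions and the bound on the flux limiter are given for bounded times only; one
  horizon T fixes them.\<close>

locale network_action = metric_network E m for E :: "'a::euclidean_space arc set" and m +
  fixes H :: "'a hamiltonian" and c :: "'a \<Rightarrow> real \<Rightarrow> real" and T :: real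
  assumes ham: "network_hamiltonian E H" and flux: "flux_limiter E H c" and T: "T > 0"
begin

lemmas ham_unfolded = ham[unfolded network_hamiltonian_def]
lemmas flux_unfolded = flux[unfolded flux_limiter_def]
lemmas ham_sym = ham_unfolded[THEN conjunct1, rule_format]
lemmas ham_cont = ham_unfolded[THEN conjunct2, THEN conjunct1, THEN bspec]
lemmas ham_growth = ham_unfolded[THEN conjunct2, THEN conjunct2, THEN conjunct2, THEN conjunct1, THEN spec, THEN mp, OF T]
lemmas flux_cont = flux_unfolded[THEN conjunct1, THEN bspec]
lemmas flux_bound = flux_unfolded[THEN conjunct2, THEN conjunct2, THEN conjunct1, THEN spec, THEN mp, OF T]

lemma ham_bounds:
  obtains \<theta> \<Theta> where "superlinear_bound \<theta>" "superlinear_bound \<Theta>"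
    "\<And>\<gamma> s t \<mu>. \<gamma> \<in> E \<Longrightarrow> s \<in> {0..arc_len \<gamma>} \<Longrightarrow> t \<in> {0..T} \<Longrightarrow> \<theta> \<bar>\<mu>\<bar> \<le> H \<gamma> s t \<mu> \<and> H \<gamma> s t \<mu> \<le> \<Theta> \<bar>\<mu>\<bar>"
proof -
  from ham_growth obtain \<theta> \<Theta> where *: "superlinear_bound \<theta>" "superlinear_bound \<Theta>"
    "\<forall>\<gamma>\<in>E. \<forall>s\<in>{0..arc_len \<gamma>}. \<forall>t\<in>{0..T}. \<forall>\<mu>. \<theta> \<bar>\<mu>\<bar> \<le> H \<gamma> s t \<mu> \<and> H \<gamma> s t \<mu> \<le> \<Theta> \<bar>\<mu>\<bar>"
    by (elim exE conjE)
  show ?thesis by (rule that[OF *(1,2)]) (rule *(3)[rule_format])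
qed

lemma superlinear_bound_mono: "superlinear_bound \<theta> \<Longrightarrow> 0 \<le> x \<Longrightarrow> x \<le> y \<Longrightarrow> \<theta> x \<le> \<theta> y"
  unfolding superlinear_bound_def by (auto intro: mono_onD)

lemma ham_bounded:
  obtains B where "\<And>\<gamma> s t \<mu>. \<gamma> \<in> E \<Longrightarrow> s \<in> {0..arc_len \<gamma>} \<Longrightarrow> t \<in> {0..T} \<Longrightarrow> \<bar>\<mu>\<bar> \<le> R \<Longrightarrow> \<bar>H \<gamma> s t \<mu>\<bar> \<le> B"
proof -
  obtain \<theta> \<Theta> where b: "superlinear_bound \<theta>" "superlinear_bound \<Theta>"
    "\<And>\<gamma> s t \<mu>. \<gamma> \<in> E \<Longrightarrow> s \<in> {0..arc_len \<gamma>} \<Longrightarrow> t \<in> {0..T} \<Longrightarrow> \<theta> \<bar>\<mu>\<bar> \<le> H \<gamma> s t \<mu> \<and> H \<gamma> s t \<mu> \<le> \<Theta> \<bar>\<mu>\<bar>"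
    by (rule ham_bounds) blast
  show ?thesis
  proof (rule that)
    fix \<gamma> s t \<mu> assume *: "\<gamma> \<in> E" "s \<in> {0..arc_len \<gamma>}" "t \<in> {0..T}" "\<bar>\<mu>\<bar> \<le> R"
    have "\<theta> 0 \<le> \<theta> \<bar>\<mu>\<bar>" "\<Theta> \<bar>\<mu>\<bar> \<le> \<Theta> R"
      using superlinear_bound_mono b(1,2) *(4) by auto
    then show "\<bar>H \<gamma> s t \<mu>\<bar> \<le> \<bar>\<theta> 0\<bar> + \<bar>\<Theta> R\<bar>" using b(3)[OF *(1-3), of \<mu>] by linarith
  qed
qed

text \<open>Beyond some R superlinear growth beats |v| |\<mu>|, and below R everything is bounded.
  Only thereby does the real supremum in the Lagrangian have its intended meaning.\<close>

lemma arc_lagrangian_bdd: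
  assumes "\<gamma> \<in> E" "s \<in> {0..arc_len \<gamma>}" "t \<in> {0..T}"
  shows "bdd_above (range (\<lambda>\<mu>. v * \<mu> - H \<gamma> s t \<mu>))"
proof -
  obtain \<theta> \<Theta> where b: "superlinear_bound \<theta>" "superlinear_bound \<Theta>"
    "\<And>\<gamma> s t \<mu>. \<gamma> \<in> E \<Longrightarrow> s \<in> {0..arc_len \<gamma>} \<Longrightarrow> t \<in> {0..T} \<Longrightarrow> \<theta> \<bar>\<mu>\<bar> \<le> H \<gamma> s t \<mu> \<and> H \<gamma> s t \<mu> \<le> \<Theta> \<bar>\<mu>\<bar>"
    by (rule ham_bounds) blast
  obtain R where R: "R > 0" "\<And>r. r \<ge> R \<Longrightarrow> \<bar>v\<bar> * r \<le> \<theta> r"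
    using superlinear_bound_eventually[OF b(1)] by metis
  show ?thesis
  proof (rule bdd_aboveI2)
    fix \<mu>
    have h: "\<theta> \<bar>\<mu>\<bar> \<le> H \<gamma> s t \<mu>" using b(3)[OF assms] by blast
    have v: "v * \<mu> \<le> \<bar>v\<bar> * \<bar>\<mu>\<bar>" by (metis abs_ge_self abs_mult)
    show "v * \<mu> - H \<gamma> s t \<mu> \<le> \<bar>v\<bar> * R + \<bar>\<theta> 0\<bar>"
    proof (cases "\<bar>\<mu>\<bar> \<ge> R")
      case True
      have "0 \<le> \<bar>v\<bar> * R" using R(1) by simp
      then show ?thesis using R(2)[OF True] h v by linarith
    next
      case False
      have "\<bar>v\<bar> * \<bar>\<mu>\<bar> \<le> \<bar>v\<bar> * R" using False by (intro mult_left_mono) auto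
      moreover have "\<theta> 0 \<le> \<theta> \<bar>\<mu>\<bar>" using superlinear_bound_mono[OF b(1)] by simp
      ultimately show ?thesis using h v by linarith
    qed
  qed
qed

lemma arc_lagrangian_ge:
  assumes "\<gamma> \<in> E" "s \<in> {0..arc_len \<gamma>}" "t \<in> {0..T}"
  shows "v * \<mu> - H \<gamma> s t \<mu> \<le> arc_lagrangian H \<gamma> s v t"
  unfolding arc_lagrangian_def by (rule cSUP_upper[OF UNIV_I arc_lagrangian_bdd[OF assms]])

lemma ham_continuous_mu:
  assumes "\<gamma> \<in> E" "s \<in> {0..arc_len \<gamma>}" "t \<in> {0..T}"
  shows "continuous_on UNIV (H \<gamma> s t)"
proof -
  have "continuous_on UNIV (\<lambda>\<mu>. (\<lambda>(s, t, \<mu>). H \<gamma> s t \<mu>) (s, t, \<mu>))"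
    by (rule continuous_on_compose2[OF ham_cont[OF assms(1)]]) (use assms in \<open>auto intro!: continuous_intros\<close>)
  then show ?thesis by simp
qed

text \<open>Continuity in \<mu> reduces the supremum to a countable one. Measurability of the action
  and the countable family of minorants both rest on this.\<close>

lemma arc_lagrangian_rats:
  assumes "\<gamma> \<in> E" "s \<in> {0..arc_len \<gamma>}" "t \<in> {0..T}"
  shows "arc_lagrangian H \<gamma> s v t = (SUP \<mu>\<in>\<rat>. v * \<mu> - H \<gamma> s t \<mu>)"
proof (rule antisym)
  let ?f = "\<lambda>\<mu>. v * \<mu> - H \<gamma> s t \<mu>"
  have bdd: "bdd_above (?f ` \<rat>)" by (rule bdd_above_mono[OF arc_lagrangian_bdd[OF assms]]) auto
  have "?f ` closure \<rat> \<subseteq> {..(SUP \<mu>\<in>\<rat>. ?f \<mu>)}"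
  proof (rule image_closure_subset)
    show "continuous_on (closure \<rat>) ?f"
      by (intro continuous_intros continuous_on_subset[OF ham_continuous_mu[OF assms]]) auto
    show "?f ` \<rat> \<subseteq> {..(SUP \<mu>\<in>\<rat>. ?f \<mu>)}" using cSUP_upper[OF _ bdd] by auto
  qed auto
  then have "?f \<mu> \<le> (SUP \<mu>\<in>\<rat>. ?f \<mu>)" for \<mu> using Rats_closure_real by auto
  then show "arc_lagrangian H \<gamma> s v t \<le> (SUP \<mu>\<in>\<rat>. ?f \<mu>)" unfolding arc_lagrangian_def by (intro cSUP_least) auto
  show "(SUP \<mu>\<in>\<rat>. ?f \<mu>) \<le> arc_lagrangian H \<gamma> s v t"
    by (rule cSUP_least) (use arc_lagrangian_ge[OF assms] Rats_0 in auto)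
qed

lemma arc_vel_inverse:
  assumes g: "\<gamma> \<in> E" and s: "s \<in> {0..arc_len \<gamma>}"
  shows "arc_vel (inverse_arc \<gamma>) s = - arc_vel \<gamma> (arc_len \<gamma> - s)"
proof -
  let ?I = "{0..arc_len \<gamma>}"
  let ?r = "\<lambda>x. arc_len \<gamma> - x"
  have img: "?r ` ?I = ?I" by (simp add: image_diff_atLeastAtMost)
  have "(arc_pt \<gamma> has_vector_derivative arc_vel \<gamma> (?r s)) (at (?r s) within ?r ` ?I)"
    using reg[OF g] s unfolding regular_arc_def img by auto
  moreover have "(?r has_vector_derivative -1) (at s within ?I)" by (auto intro!: derivative_eq_intros)
  ultimately have "((arc_pt \<gamma> \<circ> ?r) has_vector_derivative (-1) *\<^sub>R arc_vel \<gamma> (?r s)) (at s within ?I)"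
    by (intro vector_diff_chain_within)
  then have D: "((arc_pt \<gamma> \<circ> ?r) has_vector_derivative - arc_vel \<gamma> (?r s)) (at s within ?I)" by simp
  have "(arc_pt (inverse_arc \<gamma>) has_vector_derivative - arc_vel \<gamma> (?r s)) (at s within ?I)"
    by (rule has_vector_derivative_transform[OF s _ D]) (auto simp: inverse_arc_def)
  moreover have "(arc_pt (inverse_arc \<gamma>) has_vector_derivative arc_vel (inverse_arc \<gamma>) s) (at s within ?I)"
    using reg[OF inv_in[OF g]] s unfolding regular_arc_def by simp
  moreover have "at s within ?I \<noteq> bot"
    using s len_pos[OF g] by (simp add: trivial_limit_within islimpt_Icc)
  ultimately show ?thesis by (intro vector_derivative_unique_within)
qed

lemma arc_lagrangian_inverse:
  assumes "\<gamma> \<in> E" "s \<in> {0..arc_len \<gamma>}" "t \<in> {0..T}"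
  shows "arc_lagrangian H (inverse_arc \<gamma>) s v t = arc_lagrangian H \<gamma> (arc_len \<gamma> - s) (- v) t"
proof -
  have "arc_lagrangian H (inverse_arc \<gamma>) s v t = (SUP \<mu>. (- v) * (- \<mu>) - H \<gamma> (arc_len \<gamma> - s) t (- \<mu>))"
    unfolding arc_lagrangian_def using ham_sym assms by simp
  also have "\<dots> = Sup ((\<lambda>\<mu>. (- v) * \<mu> - H \<gamma> (arc_len \<gamma> - s) t \<mu>) ` (uminus ` UNIV))"
    by (simp only: image_image)
  also have "uminus ` (UNIV :: real set) = UNIV" by (simp add: surj_uminus)
  finally show ?thesis unfolding arc_lagrangian_def .
qed

lemma overall_lagrangian_vertex:
  "x \<in> vertices E \<Longrightarrow> overall_lagrangian E H c x q t = (norm q)\<^sup>2 / 2 + c x t"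
  unfolding overall_lagrangian_def by simp

lemma interior_not_vertex:
  assumes "\<gamma> \<in> E" "s \<in> {0<..<arc_len \<gamma>}" shows "arc_pt \<gamma> s \<notin> vertices E"
  using vertex_on_arc[OF assms(1), of s] assms(2) by auto

text \<open>The pair picked by \<open>SOME\<close> is the given one or its reversal. Reversal
  changes the sign of the arc velocity, and the symmetry of the Hamiltonians undoes it.\<close>

lemma overall_lagrangian_interior:
  assumes g: "\<gamma> \<in> E" and s: "s \<in> {0<..<arc_len \<gamma>}" and t: "t \<in> {0..T}"
  shows "overall_lagrangian E H c (arc_pt \<gamma> s) q t = arc_lagrangian H \<gamma> s (q \<bullet> arc_vel \<gamma> s) t"
proof -
  let ?P = "\<lambda>(\<gamma>', s'). \<gamma>' \<in> E \<and> s' \<in> {0<..<arc_len \<gamma>'} \<and> arc_pt \<gamma> s = arc_pt \<gamma>' s'"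
  obtain \<gamma>' s' where e: "(SOME p. ?P p) = (\<gamma>', s')" by (rule that[OF prod.collapse[symmetric]])
  have "?P (\<gamma>, s)" using g s by simp
  then have "?P (SOME p. ?P p)" by (rule someI)
  then have "?P (\<gamma>', s')" unfolding e .
  then have P: "\<gamma>' \<in> E" "s' \<in> {0<..<arc_len \<gamma>'}" "arc_pt \<gamma> s = arc_pt \<gamma>' s'" by simp_all
  have "overall_lagrangian E H c (arc_pt \<gamma> s) q t = arc_lagrangian H \<gamma>' s' (q \<bullet> arc_vel \<gamma>' s') t"
    unfolding overall_lagrangian_def using interior_not_vertex[OF g s] e by simp
  also have "\<dots> = arc_lagrangian H \<gamma> s (q \<bullet> arc_vel \<gamma> s) t"
  proof -
    have s': "s' \<in> {0..arc_len \<gamma>'}" using P(2) by auto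
    from interior_point_unique[OF g P(1) s s' P(3)] show ?thesis
    proof (elim disjE conjE)
      assume *: "\<gamma>' = inverse_arc \<gamma>" "s' = arc_len \<gamma> - s"
      then have "s' \<in> {0..arc_len \<gamma>}" using s by auto
      then show ?thesis using * arc_lagrangian_inverse[OF g _ t, of s'] arc_vel_inverse[OF g, of s'] by simp
    qed simp
  qed
  finally show ?thesis .
qed

text \<open>Up to reversal an interior point lies in the first two thirds of an arc, so a profile
  has to be faithful only away from the far end.\<close>

lemma network_point_cases:
  assumes "p \<in> network_points E"
  obtains "p \<in> vertices E" | \<gamma> s where "\<gamma> \<in> E" "s \<in> {0<..2 * arc_len \<gamma> / 3}" "s \<in> {0<..<arc_len \<gamma>}" "p = arc_pt \<gamma> s"
proof -
  obtain \<gamma> s where g: "\<gamma> \<in> E" "s \<in> {0..arc_len \<gamma>}" "p = arc_pt \<gamma> s" using network_pointE[OF assms] by metis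
  show ?thesis
  proof (cases "p \<in> vertices E")
    case False
    then have s: "s \<noteq> 0" "s \<noteq> arc_len \<gamma>" using g start_vertex[OF g(1)] end_vertex[OF g(1)] by auto
    show ?thesis
    proof (cases "s \<le> 2 * arc_len \<gamma> / 3")
      case True
      then show ?thesis using that(2)[OF g(1) _ _ g(3)] s g(2) by auto
    next
      case False
      show ?thesis
        by (rule that(2)[of "inverse_arc \<gamma>" "arc_len \<gamma> - s"])
           (use False s g inv_in[OF g(1)] len_pos[OF g(1)] in \<open>auto simp: field_simps\<close>)
    qed
  qed (rule that(1))
qed

lemma c_le_lagrangian:
  assumes x: "x \<in> vertices E" and g: "\<gamma> \<in> arcs_from E x" and t: "0 \<le> t"
  shows "c x t \<le> arc_lagrangian H \<gamma> 0 0 t"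
proof -
  have "c x t \<le> (MIN \<gamma>\<in>arcs_from E x. arc_lagrangian H \<gamma> 0 0 t)"
    using flux_unfolded[THEN conjunct2, THEN conjunct1, THEN bspec, OF x, THEN spec, THEN mp, OF t] .
  also have "\<dots> \<le> arc_lagrangian H \<gamma> 0 0 t"
    by (rule Min_le) (use finite_arcs_from[OF x] g in auto)
  finally show ?thesis .
qed

text \<open>On an arc, test the supremum with \<mu> = K sgn v, where the Hamiltonians are uniformly
  bounded; at a vertex use K r \<le> r^2/2 + K^2/2. On an arc only the tangential part of q is
  controlled, which for velocities of curves is almost everywhere all of it.\<close>

lemma overall_lagrangian_superlinear:
  assumes K: "K \<ge> 0"
  obtains A where "A \<ge> 0"
    "\<And>x q t. x \<in> vertices E \<Longrightarrow> t \<in> {0..T} \<Longrightarrow> K * norm q \<le> overall_lagrangian E H c x q t + A"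
    "\<And>\<gamma> s q t. \<gamma> \<in> E \<Longrightarrow> s \<in> {0<..<arc_len \<gamma>} \<Longrightarrow> t \<in> {0..T} \<Longrightarrow>
      K * \<bar>q \<bullet> arc_vel \<gamma> s\<bar> \<le> overall_lagrangian E H c (arc_pt \<gamma> s) q t + A"
proof -
  obtain B where B: "\<And>\<gamma> s t \<mu>. \<gamma> \<in> E \<Longrightarrow> s \<in> {0..arc_len \<gamma>} \<Longrightarrow> t \<in> {0..T} \<Longrightarrow> \<bar>\<mu>\<bar> \<le> K \<Longrightarrow> \<bar>H \<gamma> s t \<mu>\<bar> \<le> B"
    by (rule ham_bounded) blast
  obtain C where C: "\<forall>x\<in>vertices E. \<forall>t\<in>{0..T}. \<bar>c x t\<bar> \<le> C" using flux_bound by blast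
  show ?thesis
  proof (rule that)
    show "0 \<le> \<bar>B\<bar> + \<bar>C\<bar> + K\<^sup>2 / 2" by simp
    fix x :: 'a and q :: 'a and t assume "x \<in> vertices E" "t \<in> {0..T}"
    moreover have "0 \<le> (norm q - K)\<^sup>2" by simp
    then have "K * norm q \<le> (norm q)\<^sup>2 / 2 + K\<^sup>2 / 2" by (simp add: power2_eq_square algebra_simps)
    moreover have "- C \<le> c x t" using C calculation(1,2) by (meson abs_le_iff minus_le_iff)
    ultimately show "K * norm q \<le> overall_lagrangian E H c x q t + (\<bar>B\<bar> + \<bar>C\<bar> + K\<^sup>2 / 2)"
      using overall_lagrangian_vertex[of x q t] by linarith
  next
    fix \<gamma> s and q :: 'a and t assume *: "\<gamma> \<in> E" "s \<in> {0<..<arc_len \<gamma>}" "t \<in> {0..T}"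
    let ?v = "q \<bullet> arc_vel \<gamma> s"
    have s: "s \<in> {0..arc_len \<gamma>}" using *(2) by auto
    have "?v * (K * sgn ?v) - H \<gamma> s t (K * sgn ?v) \<le> arc_lagrangian H \<gamma> s ?v t"
      by (rule arc_lagrangian_ge[OF *(1) s *(3)])
    moreover have "?v * (K * sgn ?v) = K * \<bar>?v\<bar>" by (simp add: abs_sgn)
    moreover have "\<bar>K * sgn ?v\<bar> \<le> K" using K by (simp add: abs_mult sgn_if)
    then have "\<bar>H \<gamma> s t (K * sgn ?v)\<bar> \<le> B" by (rule B[OF *(1) s *(3)])
    ultimately have "K * \<bar>?v\<bar> \<le> arc_lagrangian H \<gamma> s ?v t + B" by linarith
    moreover have "0 \<le> K\<^sup>2 / 2" by simp
    ultimately show "K * \<bar>?v\<bar> \<le> overall_lagrangian E H c (arc_pt \<gamma> s) q t + (\<bar>B\<bar> + \<bar>C\<bar> + K\<^sup>2 / 2)"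
      using overall_lagrangian_interior[OF *(1-3), of q] by linarith
  qed
qed

lemma overall_lagrangian_lower:
  obtains A where "A \<ge> 0"
    "\<And>p q t. p \<in> network_points E \<Longrightarrow> t \<in> {0..T} \<Longrightarrow> 0 \<le> overall_lagrangian E H c p q t + A"
proof -
  obtain A where A: "A \<ge> 0"
    "\<And>x q t. x \<in> vertices E \<Longrightarrow> t \<in> {0..T} \<Longrightarrow> 0 * norm q \<le> overall_lagrangian E H c x q t + A"
    "\<And>\<gamma> s q t. \<gamma> \<in> E \<Longrightarrow> s \<in> {0<..<arc_len \<gamma>} \<Longrightarrow> t \<in> {0..T} \<Longrightarrow>
      0 * \<bar>q \<bullet> arc_vel \<gamma> s\<bar> \<le> overall_lagrangian E H c (arc_pt \<gamma> s) q t + A"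
    by (rule overall_lagrangian_superlinear[of 0]) auto
  show ?thesis
  proof (rule that[OF A(1)])
    fix p q :: 'a and t assume p: "p \<in> network_points E" and t: "t \<in> {0..T}"
    from p show "0 \<le> overall_lagrangian E H c p q t + A"
    proof (cases rule: network_point_cases)
      case 1 then show ?thesis using A(2)[OF 1 t, of q] by simp
    next
      case (2 \<gamma> s) then show ?thesis using A(3)[OF 2(1) 2(3) t, of q] by simp
    qed
  qed
qed

section \<open>Measurability of the action\<close>

text \<open>The identity up to 3/4 of the arc, then slope -3 down to zero at the far end. Points in
  the first two thirds thus keep a margin of 1/12 of the length within the range where it is the
  identity.\<close>

definition long_profile :: "'a arc \<Rightarrow> real \<Rightarrow> real" where
  "long_profile \<gamma> s = min s (3 * (arc_len \<gamma> - s))"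

lemma long_profile: "\<gamma> \<in> E \<Longrightarrow> arc_profile \<gamma> 3 (long_profile \<gamma>)"
  unfolding arc_profile_def long_profile_def using len_pos[of \<gamma>]
  by (auto intro!: lipschitz_onI simp: dist_real_def min_def abs_if)

lemma long_profile_eq: "s \<le> 3 * arc_len \<gamma> / 4 \<Longrightarrow> long_profile \<gamma> s = s"
  unfolding long_profile_def by (simp add: min_def)

lemma long_coord_range:
  assumes g: "\<gamma> \<in> E" shows "arc_coord \<gamma> (long_profile \<gamma>) p \<in> {0..arc_len \<gamma>}"
proof (cases "p \<in> arc_trace \<gamma>")
  case True
  then obtain s where s: "s \<in> {0..arc_len \<gamma>}" "p = arc_pt \<gamma> s" by blast
  then have "arc_coord \<gamma> (long_profile \<gamma>) p = long_profile \<gamma> s" using arc_coord_eq[OF g s(1) long_profile[OF g]] by simp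
  then show ?thesis using s(1) by (auto simp: long_profile_def min_def)
next
  case False then show ?thesis using len_pos[OF g] by (simp add: arc_coord_def)
qed

lemma ham_along_measurable:
  assumes g: "\<gamma> \<in> E" and ab: "0 \<le> a" "b \<le> T" and \<sigma>: "continuous_on {a..b} \<sigma>" "\<And>t. t \<in> {a..b} \<Longrightarrow> \<sigma> t \<in> {0..arc_len \<gamma>}"
  shows "continuous_on {a..b} (\<lambda>t. H \<gamma> (\<sigma> t) t \<mu>)"
proof -
  have "continuous_on {a..b} (\<lambda>t. (\<lambda>(s, t, \<mu>). H \<gamma> s t \<mu>) (\<sigma> t, t, \<mu>))"
    by (rule continuous_on_compose2[OF ham_cont[OF g]]) (use ab \<sigma> in \<open>auto intro!: continuous_intros\<close>)
  then show ?thesis by simp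
qed

lemma velocity_measurable:
  assumes \<xi>: "curve_in (network_points E) a b \<xi>" and ab: "a \<le> b"
  shows "velocity \<xi> \<in> borel_measurable (lebesgue_on {a..b})"
proof -
  have "absolutely_continuous_curve a b \<xi>" using \<xi> unfolding curve_in_def by blast
  from absolutely_continuous_FTC(2)[OF this ab] have "integrable (lebesgue_on {a..b}) (velocity \<xi>)"
    by (simp add: integrable_restrict_space set_integrable_def)
  then show ?thesis by (rule borel_measurable_integrable)
qed

text \<open>The times spent at a vertex or in the first two thirds of an arc form a countable cover.
  On each piece the integrand has an explicit formula, on arcs a countable supremum of measurable
  functions.\<close>

lemma lagrangian_measurable:
  assumes \<xi>: "curve_in (network_points E) a b \<xi>" and ab: "0 \<le> a" "a \<le> b" "b \<le> T"
  shows "(\<lambda>t. overall_lagrangian E H c (\<xi> t) (velocity \<xi> t) t) \<in> borel_measurable (lebesgue_on {a..b})"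
    (is "?F \<in> borel_measurable ?M")
proof -
  have ac: "absolutely_continuous_curve a b \<xi>" and im: "\<xi> ` {a..b} \<subseteq> network_points E"
    using \<xi> unfolding curve_in_def by auto
  note cont = absolutely_continuous_curve_continuous[OF ac]
  note vm = velocity_measurable[OF \<xi> ab(2)]
  let ?P = "\<lambda>x. {a..b} \<inter> \<xi> -` {x}"
  \<comment> \<open>The start of the arc is taken out, because the vertex formula holds
    there.\<close>
  let ?Q = "\<lambda>\<gamma>. {a..b} \<inter> \<xi> -` (arc_pt \<gamma> ` {0..2 * arc_len \<gamma> / 3} - {arc_pt \<gamma> 0})"
  have spM: "space ?M = {a..b}" by simp
  have closedset: "{a..b} \<inter> \<xi> -` C \<in> sets ?M" if "closed C" for C
  proof -
    have "closed ({a..b} \<inter> \<xi> -` C)" by (rule continuous_closed_preimage[OF cont _ that]) auto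
    then show ?thesis by (simp add: sets_restrict_space_iff borel_closed)
  qed
  have sub: "arc_pt \<gamma> ` {0..2 * arc_len \<gamma> / 3} \<subseteq> arc_trace \<gamma>" "closed (arc_pt \<gamma> ` {0..2 * arc_len \<gamma> / 3})" if g: "\<gamma> \<in> E" for \<gamma>
  proof -
    have "{0..2 * arc_len \<gamma> / 3} \<subseteq> {0..arc_len \<gamma>}" using len_pos[OF g] by auto
    then show "arc_pt \<gamma> ` {0..2 * arc_len \<gamma> / 3} \<subseteq> arc_trace \<gamma>" "closed (arc_pt \<gamma> ` {0..2 * arc_len \<gamma> / 3})"
      using arc_continuous[OF g]
      by (auto intro!: compact_imp_closed compact_continuous_image intro: continuous_on_subset)
  qed
  have Qm: "?Q \<gamma> \<in> sets ?M" if g: "\<gamma> \<in> E" for \<gamma>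
  proof -
    have "?Q \<gamma> = ({a..b} \<inter> \<xi> -` (arc_pt \<gamma> ` {0..2 * arc_len \<gamma> / 3})) - ({a..b} \<inter> \<xi> -` {arc_pt \<gamma> 0})" by auto
    then show ?thesis using closedset sub(2)[OF g] by (metis closed_singleton sets.Diff)
  qed
  have cV: "countable (vertices E)"
  proof -
    have "vertices E = (\<lambda>\<gamma>. arc_pt \<gamma> 0) ` E" using vertices_eq by blast
    then show ?thesis using countable_arcs by simp
  qed
  show ?thesis
  proof (rule measurable_piecewise_restrict)
    show "countable (?P ` vertices E \<union> ?Q ` E)" using cV countable_arcs by simp
    show "space ?M \<subseteq> \<Union>(?P ` vertices E \<union> ?Q ` E)"
    proof
      fix t assume "t \<in> space ?M"
      then have t: "t \<in> {a..b}" by simp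
      have "\<xi> t \<in> network_points E" by (rule subsetD[OF im imageI[OF t]])
      then show "t \<in> \<Union>(?P ` vertices E \<union> ?Q ` E)"
      proof (cases rule: network_point_cases)
        case 1 then show ?thesis using t by auto
      next
        case (2 \<gamma> s)
        have "arc_pt \<gamma> s \<noteq> arc_pt \<gamma> 0" using interior_not_vertex[OF 2(1,3)] start_vertex[OF 2(1)] by auto
        moreover have "\<xi> t \<in> arc_pt \<gamma> ` {0..2 * arc_len \<gamma> / 3}" using 2(2,4) by auto
        ultimately have "t \<in> ?Q \<gamma>" using t 2(4) by simp
        then show ?thesis using 2(1) by blast
      qed
    qed
    fix \<Omega> assume \<Omega>: "\<Omega> \<in> ?P ` vertices E \<union> ?Q ` E"
    then consider x where "x \<in> vertices E" "\<Omega> = ?P x" | \<gamma> where "\<gamma> \<in> E" "\<Omega> = ?Q \<gamma>" by blast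
    then have "\<Omega> \<in> sets ?M \<and> ?F \<in> borel_measurable (restrict_space ?M \<Omega>)"
    proof cases
      case 1
      have "{a..b} \<subseteq> {0..}" using ab by auto
      then have "c x \<in> borel_measurable ?M"
        by (intro continuous_interval_measurable continuous_on_subset[OF flux_cont[OF 1(1)]])
      then have "(\<lambda>t. (norm (velocity \<xi> t))\<^sup>2 / 2 + c x t) \<in> borel_measurable ?M" using vm by measurable
      then have mG: "(\<lambda>t. (norm (velocity \<xi> t))\<^sup>2 / 2 + c x t) \<in> borel_measurable (restrict_space ?M \<Omega>)"
        by (rule measurable_restrict_space1)
      have eq: "?F t = (norm (velocity \<xi> t))\<^sup>2 / 2 + c x t" if "t \<in> space (restrict_space ?M \<Omega>)" for t
        using that 1 overall_lagrangian_vertex by (simp add: space_restrict_space)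
      have "?F \<in> borel_measurable (restrict_space ?M \<Omega>)" using mG by (subst measurable_cong[OF eq])
      then show ?thesis using 1(2) closedset[of "{x}"] by simp
    next
      case 2
      note g = 2(1)
      let ?s = "\<lambda>t. arc_coord \<gamma> (long_profile \<gamma>) (\<xi> t)"
      let ?G = "\<lambda>t. SUP \<mu>\<in>\<rat>. (velocity \<xi> t \<bullet> arc_vel \<gamma> (?s t)) * \<mu> - H \<gamma> (?s t) t \<mu>"
      have sc: "continuous_on {a..b} ?s"
        using arc_coord_curve(1)[OF \<xi> ab(2) g long_profile[OF g]] absolutely_continuous_curve_continuous by blast
      have "continuous_on {a..b} (\<lambda>t. arc_vel \<gamma> (?s t))"
      proof (rule continuous_on_compose2[OF _ sc])
        show "continuous_on {0..arc_len \<gamma>} (arc_vel \<gamma>)" using reg[OF g] by (simp add: regular_arc_def)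
      qed (use long_coord_range[OF g] in blast)
      then have m1: "(\<lambda>t. arc_vel \<gamma> (?s t)) \<in> borel_measurable ?M" by (rule continuous_interval_measurable)
      have m2: "(\<lambda>t. H \<gamma> (?s t) t \<mu>) \<in> borel_measurable ?M" for \<mu>
        by (rule continuous_interval_measurable[OF ham_along_measurable[OF g ab(1,3) sc long_coord_range[OF g]]])
      have "?G \<in> borel_measurable ?M"
      proof (rule borel_measurable_cSUP)
        show "(\<lambda>t. (velocity \<xi> t \<bullet> arc_vel \<gamma> (?s t)) * \<mu> - H \<gamma> (?s t) t \<mu>) \<in> borel_measurable ?M" for \<mu>
          using m1 m2[of \<mu>] vm by measurable
        fix t assume "t \<in> space ?M"
        then have "t \<in> {0..T}" using ab by auto
        then show "bdd_above ((\<lambda>\<mu>. (velocity \<xi> t \<bullet> arc_vel \<gamma> (?s t)) * \<mu> - H \<gamma> (?s t) t \<mu>) ` \<rat>)"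
          by (intro bdd_above_mono[OF arc_lagrangian_bdd[OF g long_coord_range[OF g]]]) auto
      qed (rule countable_rat)
      then have mG: "?G \<in> borel_measurable (restrict_space ?M \<Omega>)" by (rule measurable_restrict_space1)
      have eq: "?F t = ?G t" if t: "t \<in> space (restrict_space ?M \<Omega>)" for t
      proof -
        have t2: "t \<in> {0..T}" using t ab 2(2) by (auto simp: space_restrict_space)
        have "\<xi> t \<in> arc_pt \<gamma> ` {0..2 * arc_len \<gamma> / 3} - {arc_pt \<gamma> 0}" using t 2(2) by (auto simp: space_restrict_space)
        then obtain s where s: "s \<in> {0..2 * arc_len \<gamma> / 3}" "\<xi> t = arc_pt \<gamma> s" "s \<noteq> 0" by blast
        have s1: "s \<in> {0<..<arc_len \<gamma>}" "s \<in> {0..arc_len \<gamma>}" using s len_pos[OF g] by auto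
        have "?s t = long_profile \<gamma> s" using arc_coord_eq[OF g s1(2) long_profile[OF g]] s(2) by simp
        also have "\<dots> = s" using s(1) len_pos[OF g] by (intro long_profile_eq) auto
        finally have st: "?s t = s" .
        have "?F t = arc_lagrangian H \<gamma> s (velocity \<xi> t \<bullet> arc_vel \<gamma> s) t"
          using overall_lagrangian_interior[OF g s1(1) t2] s(2) by simp
        then show ?thesis using arc_lagrangian_rats[OF g s1(2) t2] st by simp
      qed
      have "?F \<in> borel_measurable (restrict_space ?M \<Omega>)" using mG by (subst measurable_cong[OF eq])
      then show ?thesis using 2(2) Qm[OF g] by simp
    qed
    then show "\<Omega> \<inter> space ?M \<in> sets ?M" "?F \<in> borel_measurable (restrict_space ?M \<Omega>)" by auto
  qed
qed

end


section \<open>Lower semicontinuity from affine minorants\<close>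

lemma lebesgue_on_Icc_finite: "finite_measure (lebesgue_on {a..b::real})"
  by (rule finite_measureI) (simp add: emeasure_restrict_space emeasure_lborel_Icc_eq)

lemma integrable_indicator_mult:
  fixes h :: "'a \<Rightarrow> real"
  assumes "integrable M h" "Q \<in> sets M" shows "integrable M (\<lambda>x. indicator Q x * h x)"
  using integrable_mult_indicator[OF assms(2,1)] by simp

section \<open>Uniform integrability\<close>

definition unif_integrable :: "'a measure \<Rightarrow> (nat \<Rightarrow> 'a \<Rightarrow> real) \<Rightarrow> bool" where
  "unif_integrable M D \<longleftrightarrow> (\<forall>n. integrable M (D n)) \<and>
     (\<forall>e>0. \<exists>d>0. \<forall>n. \<forall>B\<in>sets M. measure M B < d \<longrightarrow> (LINT x|M. indicator B x * \<bar>D n x\<bar>) \<le> e)"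

text \<open>Criterion of de la Vallee-Poussin, with superlinearity expressed by K |f| \<le> G + A
  for every K. As \<open>G\<close> is an arbitrary sequence with bounded integrals, it can be the
  shifted Lagrangian.\<close>

lemma unif_integrable_superlinear:
  fixes f :: "nat \<Rightarrow> 'a \<Rightarrow> real"
  assumes fin: "finite_measure M" and f: "\<And>n. integrable M (f n)" and G: "\<And>n. G n \<in> borel_measurable M"
    and C: "\<And>n. (\<integral>\<^sup>+x. G n x \<partial>M) \<le> ennreal C" and C0: "C \<ge> 0"
    and K: "\<And>K. K > 0 \<Longrightarrow> \<exists>A\<ge>0. \<forall>n. AE x in M. ennreal (K * \<bar>f n x\<bar>) \<le> G n x + ennreal A"
  shows "unif_integrable M f"
  unfolding unif_integrable_def
proof (intro conjI allI impI f)
  interpret finite_measure M by (rule fin)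
  fix e :: real assume "e > 0"
  \<comment> \<open>With this K the bound C + 1 for K times the integral becomes e/2; the choice of
    d below limits the contribution of A to 1.\<close>
  define K where "K = 2 * (C + 1) / e"
  have K0: "K > 0" using C0 \<open>e > 0\<close> by (simp add: K_def)
  obtain A where A: "A \<ge> 0" "\<And>n. AE x in M. ennreal (K * \<bar>f n x\<bar>) \<le> G n x + ennreal A" using K[OF K0] by blast
  define d where "d = 1 / (A + 1)"
  show "\<exists>d>0. \<forall>n. \<forall>B\<in>sets M. measure M B < d \<longrightarrow> (LINT x|M. indicator B x * \<bar>f n x\<bar>) \<le> e"
  proof (intro exI[of _ d] conjI allI ballI impI)
    show "d > 0" using A(1) by (simp add: d_def)
    fix n B assume B: "B \<in> sets M" "measure M B < d"
    let ?I = "LINT x|M. indicator B x * \<bar>f n x\<bar>"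
    have int: "integrable M (\<lambda>x. K * (indicator B x * \<bar>f n x\<bar>))"
      using f[of n] B(1) by (intro integrable_mult_right integrable_indicator_mult integrable_abs)
    have "ennreal (K * ?I) = ennreal (LINT x|M. K * (indicator B x * \<bar>f n x\<bar>))" by simp
    also have "\<dots> = (\<integral>\<^sup>+x. ennreal (K * (indicator B x * \<bar>f n x\<bar>)) \<partial>M)"
      using K0 by (intro nn_integral_eq_integral[symmetric] int) auto
    also have "\<dots> \<le> (\<integral>\<^sup>+x. G n x + ennreal A * indicator B x \<partial>M)"
    proof (rule nn_integral_mono_AE)
      show "AE x in M. ennreal (K * (indicator B x * \<bar>f n x\<bar>)) \<le> G n x + ennreal A * indicator B x"
        using A(2)[of n] by eventually_elim (auto simp: indicator_def)
    qed
    also have "\<dots> = (\<integral>\<^sup>+x. G n x \<partial>M) + ennreal A * emeasure M B"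
      using G[of n] B(1) by (subst nn_integral_add) (auto simp: nn_integral_cmult)
    also have "\<dots> \<le> ennreal C + ennreal (A * measure M B)"
      using C[of n] A(1) by (simp add: emeasure_eq_measure ennreal_mult add_mono)
    also have "\<dots> \<le> ennreal (C + 1)"
    proof -
      have "A * measure M B \<le> A * d" using B(2) A(1) by (intro mult_left_mono) auto
      also have "\<dots> \<le> 1" using A(1) by (simp add: d_def)
      finally show ?thesis using C0 A(1) by (simp add: ennreal_plus[symmetric] ennreal_leI del: ennreal_plus)
    qed
    finally have "ennreal (K * ?I) \<le> ennreal (C + 1)" .
    then have "K * ?I \<le> C + 1" by (subst (asm) ennreal_le_iff) (use C0 in simp_all)
    then have "?I \<le> (C + 1) / K" using K0 by (simp add: field_simps)
    also have "\<dots> = e / 2"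
    proof -
      have "C + 1 \<noteq> 0" using C0 by simp
      then show ?thesis using \<open>e > 0\<close> unfolding K_def by (simp only: divide_divide_eq_right) (simp add: field_simps)
    qed
    finally show "?I \<le> e" using \<open>e > 0\<close> by simp
  qed
qed

lemma unif_integrable_dominated:
  fixes f g :: "nat \<Rightarrow> 'a \<Rightarrow> real"
  assumes f: "unif_integrable M f" and g: "\<And>n. integrable M (g n)" and K: "K \<ge> 0" "\<And>n. AE x in M. \<bar>g n x\<bar> \<le> K * \<bar>f n x\<bar>"
  shows "unif_integrable M g"
  unfolding unif_integrable_def
proof (intro conjI allI impI g)
  fix e :: real assume "e > 0"
  then have "e / (K + 1) > 0" using K by simp
  then obtain d where d: "d > 0" "\<forall>n. \<forall>B\<in>sets M. measure M B < d \<longrightarrow> (LINT x|M. indicator B x * \<bar>f n x\<bar>) \<le> e / (K + 1)"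
    using f unfolding unif_integrable_def by blast
  show "\<exists>d>0. \<forall>n. \<forall>B\<in>sets M. measure M B < d \<longrightarrow> (LINT x|M. indicator B x * \<bar>g n x\<bar>) \<le> e"
  proof (intro exI[of _ d] conjI allI ballI impI d(1))
    fix n B assume B: "B \<in> sets M" "measure M B < d"
    have fi: "integrable M (f n)" using f unfolding unif_integrable_def by blast
    have "(LINT x|M. indicator B x * \<bar>g n x\<bar>) \<le> (LINT x|M. K * (indicator B x * \<bar>f n x\<bar>))"
    proof (rule integral_mono_AE)
      show "integrable M (\<lambda>x. indicator B x * \<bar>g n x\<bar>)" "integrable M (\<lambda>x. K * (indicator B x * \<bar>f n x\<bar>))"
        using fi g[of n] B(1) by (auto intro!: integrable_mult_right integrable_indicator_mult integrable_abs)
      show "AE x in M. indicator B x * \<bar>g n x\<bar> \<le> K * (indicator B x * \<bar>f n x\<bar>)"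
        using K(2)[of n] by eventually_elim (auto simp: indicator_def)
    qed
    also have "\<dots> = K * (LINT x|M. indicator B x * \<bar>f n x\<bar>)" by simp
    also have "\<dots> \<le> K * (e / (K + 1))" using d(2) B K(1) by (intro mult_left_mono) auto
    also have "\<dots> \<le> e" using K(1) \<open>e > 0\<close> by (simp add: field_simps)
    finally show "(LINT x|M. indicator B x * \<bar>g n x\<bar>) \<le> e" .
  qed
qed

lemma unif_integrable_diff:
  fixes f g :: "nat \<Rightarrow> 'a \<Rightarrow> real"
  assumes f: "unif_integrable M f" and g: "unif_integrable M g"
  shows "unif_integrable M (\<lambda>n x. f n x - g n x)"
  unfolding unif_integrable_def
proof (intro conjI allI impI)
  have fi: "integrable M (f n)" and gi: "integrable M (g n)" for n using f g unfolding unif_integrable_def by blast+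
  show "integrable M (\<lambda>x. f n x - g n x)" for n using fi gi by simp
  fix e :: real assume "e > 0"
  then have e2: "e / 2 > 0" by simp
  obtain d1 where d1: "d1 > 0" "\<forall>n. \<forall>B\<in>sets M. measure M B < d1 \<longrightarrow> (LINT x|M. indicator B x * \<bar>f n x\<bar>) \<le> e / 2"
    using f e2 unfolding unif_integrable_def by blast
  obtain d2 where d2: "d2 > 0" "\<forall>n. \<forall>B\<in>sets M. measure M B < d2 \<longrightarrow> (LINT x|M. indicator B x * \<bar>g n x\<bar>) \<le> e / 2"
    using g e2 unfolding unif_integrable_def by blast
  show "\<exists>d>0. \<forall>n. \<forall>B\<in>sets M. measure M B < d \<longrightarrow> (LINT x|M. indicator B x * \<bar>f n x - g n x\<bar>) \<le> e"
  proof (intro exI[of _ "min d1 d2"] conjI allI ballI impI)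
    fix n B assume B: "B \<in> sets M" "measure M B < min d1 d2"
    have "(LINT x|M. indicator B x * \<bar>f n x - g n x\<bar>) \<le> (LINT x|M. indicator B x * \<bar>f n x\<bar> + indicator B x * \<bar>g n x\<bar>)"
      using fi[of n] gi[of n] B(1)
      by (intro integral_mono integrable_indicator_mult integrable_abs Bochner_Integration.integrable_add Bochner_Integration.integrable_diff)
         (auto simp: indicator_def)
    also have "\<dots> = (LINT x|M. indicator B x * \<bar>f n x\<bar>) + (LINT x|M. indicator B x * \<bar>g n x\<bar>)"
      using fi[of n] gi[of n] B(1) by (intro Bochner_Integration.integral_add integrable_indicator_mult integrable_abs)
    also have "\<dots> \<le> e / 2 + e / 2" using d1(2) d2(2) B by (intro add_mono) auto
    finally show "(LINT x|M. indicator B x * \<bar>f n x - g n x\<bar>) \<le> e" by simp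
  qed (use d1 d2 in auto)
qed

lemma integral_disjoint_Un:
  fixes h :: "'a \<Rightarrow> real"
  assumes "integrable M h" "A \<in> sets M" "B \<in> sets M" "A \<inter> B = {}"
  shows "(LINT x|M. indicator (A \<union> B) x * h x) = (LINT x|M. indicator A x * h x) + (LINT x|M. indicator B x * h x)"
proof -
  have "indicator (A \<union> B) x * h x = indicator A x * h x + indicator B x * h x" for x
    using assms(4) by (auto simp: indicator_def)
  then show ?thesis
    using assms by (simp add: Bochner_Integration.integral_add integrable_indicator_mult)
qed

text \<open>The sets on which the integrals converge form a Dynkin system: uniform integrability takes
  care of countable disjoint unions.\<close>

lemma unif_integrable_weak_null:
  fixes D :: "nat \<Rightarrow> real \<Rightarrow> real" and a b :: real
  defines "M \<equiv> lebesgue_on {a..b}"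
  assumes ab: "a \<le> b" and ui: "unif_integrable M D"
    and lim: "\<And>t. t \<in> {a..b} \<Longrightarrow> (\<lambda>n. LINT x|M. indicator {a..t} x * D n x) \<longlonglongrightarrow> 0"
    and Q: "Q \<in> sets M"
  shows "(\<lambda>n. LINT x|M. indicator Q x * D n x) \<longlonglongrightarrow> 0"
proof -
  interpret finite_measure M unfolding M_def by (rule lebesgue_on_Icc_finite)
  have spM: "space M = {a..b}" by (simp add: M_def)
  have Di: "integrable M (D n)" for n using ui unfolding unif_integrable_def by blast
  have bor: "A \<inter> {a..b} \<in> sets M" if "A \<in> sets borel" for A
  proof -
    have "A \<in> sets lebesgue" using that by (intro sets_completionI_sets) simp
    then show ?thesis unfolding M_def by (subst sets_restrict_space_iff) auto
  qed
  let ?P = "\<lambda>A. (\<lambda>n. LINT x|M. indicator (A \<inter> {a..b}) x * D n x) \<longlonglongrightarrow> 0"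
  have borel_case: "?P A" if "A \<in> sets borel" for A :: "real set"
  proof -
    have 1: "Int_stable (range (atMost :: real \<Rightarrow> _))" by (auto simp: Int_stable_def)
    have 2: "range (atMost :: real \<Rightarrow> _) \<subseteq> Pow UNIV" by simp
    have 3: "A \<in> sigma_sets UNIV (range atMost)" using that by (simp add: borel_eq_atMost)
    from 1 2 3 show "?P A"
    proof (induct rule: sigma_sets_induct_disjoint)
      case (basic A)
      then obtain x where A: "A = {..x}" by blast
      show ?case
      proof (cases "a \<le> x")
        case True
        then have "A \<inter> {a..b} = {a..min x b}" "min x b \<in> {a..b}" using ab A by auto
        then show ?thesis using lim by simp
      next
        case False
        then have "A \<inter> {a..b} = {}" using A by auto
        then show ?thesis by simp
      qed
    next
      case empty show ?case by simp
    next
      case (compl A)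
      then have Ab: "A \<in> sets borel" by (simp add: borel_eq_atMost)
      have "(LINT x|M. indicator ((UNIV - A) \<inter> {a..b}) x * D n x) =
        (LINT x|M. indicator {a..b} x * D n x) - (LINT x|M. indicator (A \<inter> {a..b}) x * D n x)" for n
      proof -
        have 1: "(UNIV - A) \<inter> {a..b} \<union> A \<inter> {a..b} = {a..b}" by auto
        have 2: "(UNIV - A) \<inter> {a..b} \<in> sets M" using Ab by (intro bor) auto
        have 3: "(UNIV - A) \<inter> {a..b} \<inter> (A \<inter> {a..b}) = {}" by auto
        show ?thesis using integral_disjoint_Un[OF Di[of n] 2 bor[OF Ab] 3] unfolding 1 by linarith
      qed
      moreover have "(\<lambda>n. (LINT x|M. indicator {a..b} x * D n x) - (LINT x|M. indicator (A \<inter> {a..b}) x * D n x)) \<longlonglongrightarrow> 0 - 0"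
        using lim[of b] ab compl(2) by (intro tendsto_diff) auto
      ultimately show ?case by simp
    next
      case (union A)
      have Ab: "A i \<in> sets borel" for i using union(2) by (auto simp: borel_eq_atMost)
      have dis: "disjoint_family A" by (rule union(1))
      show ?case
      proof (rule LIMSEQ_I)
        fix e :: real assume "e > 0"
        then have "e/2 > 0" by simp
        then obtain d where d: "d > 0" "\<forall>n. \<forall>B\<in>sets M. measure M B < d \<longrightarrow> (LINT x|M. indicator B x * \<bar>D n x\<bar>) \<le> e/2"
          using ui unfolding unif_integrable_def by blast
        \<comment> \<open>The tails \<open>R N\<close> decrease to the empty set, so one of them
          costs at most e/2 for all n at once; the finite union \<open>S N\<close> converges by
          additivity.\<close>
        define R where "R N = (\<Union>i\<in>{N..}. A i) \<inter> {a..b}" for N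
        define S where "S N = (\<Union>i\<in>{..<N}. A i) \<inter> {a..b}" for N
        have RM: "R N \<in> sets M" and SM: "S N \<in> sets M" for N
          unfolding R_def S_def using Ab by (auto intro!: bor)
        have "(\<Inter>N. R N) = {}"
        proof (rule ccontr)
          assume "(\<Inter>N. R N) \<noteq> {}"
          then obtain x where x: "\<And>N. x \<in> R N" by blast
          then obtain i where "x \<in> A i" unfolding R_def by blast
          moreover obtain j where "j \<ge> Suc i" "x \<in> A j" using x[of "Suc i"] unfolding R_def by auto
          ultimately show False using dis unfolding disjoint_family_on_def by (metis Suc_n_not_le_n UNIV_I disjoint_iff)
        qed
        moreover have "(\<lambda>N. measure M (R N)) \<longlonglongrightarrow> measure M (\<Inter>N. R N)"
        proof (rule finite_Lim_measure_decseq)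
          show "range R \<subseteq> sets M" using RM by blast
          show "decseq R" unfolding decseq_def R_def by (intro allI impI Int_mono UN_mono) auto
        qed
        ultimately have "(\<lambda>N. measure M (R N)) \<longlonglongrightarrow> 0" by simp
        then obtain N where "norm (measure M (R N) - 0) < d" using d(1) LIMSEQ_D by blast
        then have N: "measure M (R N) < d" by simp
        have "(\<lambda>n. LINT x|M. indicator (S k) x * D n x) \<longlonglongrightarrow> 0" for k
        proof (induction k)
          case 0 show ?case by (simp add: S_def)
        next
          case (Suc k)
          have "S (Suc k) = S k \<union> A k \<inter> {a..b}" unfolding S_def by (auto simp: less_Suc_eq)
          moreover have "S k \<inter> (A k \<inter> {a..b}) = {}"
          proof -
            have "A i \<inter> A k = {}" if "i < k" for i
              using dis that unfolding disjoint_family_on_def by simp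
            then show ?thesis unfolding S_def by fastforce
          qed
          ultimately have "(LINT x|M. indicator (S (Suc k)) x * D n x) =
              (LINT x|M. indicator (S k) x * D n x) + (LINT x|M. indicator (A k \<inter> {a..b}) x * D n x)" for n
            using integral_disjoint_Un[OF Di[of n] SM bor[OF Ab]] by simp
          moreover have "(\<lambda>n. (LINT x|M. indicator (S k) x * D n x) + (LINT x|M. indicator (A k \<inter> {a..b}) x * D n x)) \<longlonglongrightarrow> 0 + 0"
            using Suc union(3) by (intro tendsto_add) auto
          ultimately show ?case by simp
        qed
        from LIMSEQ_D[OF this[of N] \<open>e/2 > 0\<close>]
        obtain n0 where n0: "\<forall>n\<ge>n0. norm ((LINT x|M. indicator (S N) x * D n x) - 0) < e/2" by (elim exE)
        show "\<exists>n0. \<forall>n\<ge>n0. norm ((LINT x|M. indicator ((\<Union>i. A i) \<inter> {a..b}) x * D n x) - 0) < e"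
        proof (intro exI[of _ n0] allI impI)
          fix n assume n: "n \<ge> n0"
          have U: "(UNIV :: nat set) = {..<N} \<union> {N..}" by auto
          have "(\<Union>i. A i) \<inter> {a..b} = S N \<union> R N"
          proof -
            have "(\<Union>i. A i) = (\<Union>i\<in>{..<N}. A i) \<union> (\<Union>i\<in>{N..}. A i)"
              using arg_cong[OF U, of "\<lambda>I. \<Union>i\<in>I. A i"] by (simp only: UN_Un)
            then show ?thesis unfolding S_def R_def by (simp only: Int_Un_distrib2)
          qed
          moreover have "S N \<inter> R N = {}"
          proof -
            have "A i \<inter> A j = {}" if "i < N" "N \<le> j" for i j
              using dis that unfolding disjoint_family_on_def by simp
            then show ?thesis unfolding S_def R_def by fastforce
          qed
          ultimately have eq: "(LINT x|M. indicator ((\<Union>i. A i) \<inter> {a..b}) x * D n x) =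
              (LINT x|M. indicator (S N) x * D n x) + (LINT x|M. indicator (R N) x * D n x)"
            using integral_disjoint_Un[OF Di[of n] SM RM] by simp
          have "\<bar>LINT x|M. indicator (R N) x * D n x\<bar> \<le> (LINT x|M. \<bar>indicator (R N) x * D n x\<bar>)"
            by (rule integral_abs_bound)
          also have "\<dots> = (LINT x|M. indicator (R N) x * \<bar>D n x\<bar>)" by (simp add: abs_mult)
          also have "\<dots> \<le> e/2" using d(2) RM N by blast
          finally show "norm ((LINT x|M. indicator ((\<Union>i. A i) \<inter> {a..b}) x * D n x) - 0) < e"
            using n0[rule_format, OF n] eq by simp
        qed
      qed
    qed
  qed
  \<comment> \<open>A Lebesgue set is a Borel set up to part of a null set, which the integrals do
    not see.\<close>
  have "Q \<in> sets lebesgue" "Q \<subseteq> {a..b}" using Q unfolding M_def by (auto simp: sets_restrict_space)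
  then obtain S N N' where S: "Q = S \<union> N" "N \<subseteq> N'" "N' \<in> null_sets lborel" "S \<in> sets lborel"
    by (metis sets_completionE)
  have "AE x in M. x \<notin> N'"
    unfolding M_def using S(3) by (intro ae_lebesgue_onI[of N']) (auto simp: negligible_iff_null_sets null_sets_completionI)
  then have "AE x in M. indicator Q x * D n x = indicator (S \<inter> {a..b}) x * D n x" for n
    by eventually_elim (use S \<open>Q \<subseteq> {a..b}\<close> in \<open>auto simp: indicator_def\<close>)
  then have "(LINT x|M. indicator Q x * D n x) = (LINT x|M. indicator (S \<inter> {a..b}) x * D n x)" for n
    using Q bor[of S] S(4) Di[of n] by (intro integral_cong_AE) (auto intro!: borel_measurable_times)
  then show ?thesis using borel_case[of S] S(4) by simp
qed

section \<open>Liminf inequalities for integrals\<close>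

lemma set_nn_integral_split:
  fixes f :: "'a \<Rightarrow> ennreal"
  assumes "f \<in> borel_measurable M" "A \<in> sets M" "B \<in> sets M" "A \<inter> B = {}"
  shows "(\<integral>\<^sup>+x\<in>A \<union> B. f x \<partial>M) = (\<integral>\<^sup>+x\<in>A. f x \<partial>M) + (\<integral>\<^sup>+x\<in>B. f x \<partial>M)"
proof -
  have "(\<integral>\<^sup>+x\<in>A \<union> B. f x \<partial>M) = (\<integral>\<^sup>+x. f x * indicator A x + f x * indicator B x \<partial>M)"
    using assms(4) by (intro nn_integral_cong) (auto simp: indicator_def)
  also have "\<dots> = (\<integral>\<^sup>+x\<in>A. f x \<partial>M) + (\<integral>\<^sup>+x\<in>B. f x \<partial>M)"
    using assms by (intro nn_integral_add) auto
  finally show ?thesis .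
qed

text \<open>This is Fatou's lemma on a space with two points.\<close>

lemma ennreal_liminf_superadditive:
  fixes u v :: "nat \<Rightarrow> ennreal"
  shows "liminf u + liminf v \<le> liminf (\<lambda>n. u n + v n)"
proof -
  have "(\<integral>\<^sup>+i. liminf (\<lambda>n. if i then u n else v n) \<partial>count_space UNIV)
      \<le> liminf (\<lambda>n. \<integral>\<^sup>+i. (if i then u n else v n) \<partial>count_space UNIV)"
    by (rule nn_integral_liminf) simp
  then show ?thesis by (simp add: nn_integral_count_space_finite UNIV_bool add.commute)
qed

lemma ennreal_integral_le_nn_integral:
  fixes f :: "'a \<Rightarrow> real"
  assumes f: "integrable M f" shows "ennreal (LINT x|M. f x) \<le> (\<integral>\<^sup>+x. ennreal (f x) \<partial>M)"
proof -
  have "(LINT x|M. f x) \<le> (LINT x|M. max 0 (f x))"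
    using f by (intro integral_mono integrable_max) auto
  then have "ennreal (LINT x|M. f x) \<le> ennreal (LINT x|M. max 0 (f x))" by (rule ennreal_leI)
  also have "\<dots> = (\<integral>\<^sup>+x. ennreal (max 0 (f x)) \<partial>M)"
    using f by (intro nn_integral_eq_integral[symmetric] integrable_max) auto
  also have "\<dots> = (\<integral>\<^sup>+x. ennreal (f x) \<partial>M)"
    by (intro nn_integral_cong) (simp add: max_def ennreal_neg)
  finally show ?thesis .
qed

text \<open>For a maximum of finitely many minorants, split the set according to which one is
  largest, take limits on each part, and use superadditivity of liminf. This is why
  \<open>conv\<close> is asked on all measurable subsets of \<open>P\<close>. Monotone convergence
  then reaches the full supremum.\<close>

lemma lsc_of_affine_minorants:
  fixes F :: "'a \<Rightarrow> ennreal" and Fs :: "nat \<Rightarrow> 'a \<Rightarrow> ennreal" and l :: "nat \<Rightarrow> 'a \<Rightarrow> real" and ls :: "nat \<Rightarrow> nat \<Rightarrow> 'a \<Rightarrow> real"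
  assumes P: "P \<in> sets M" and F: "F \<in> borel_measurable M" and Fs: "\<And>n. Fs n \<in> borel_measurable M"
    and l: "\<And>k. integrable M (l k)" and ls: "\<And>k n. integrable M (ls k n)"
    and conv: "\<And>k Q. Q \<in> sets M \<Longrightarrow> Q \<subseteq> P \<Longrightarrow>
      (\<lambda>n. LINT x|M. indicator Q x * ls k n x) \<longlonglongrightarrow> (LINT x|M. indicator Q x * l k x)"
    and dom: "\<And>k. \<forall>\<^sub>F n in sequentially. AE x in M. x \<in> P \<longrightarrow> ennreal (ls k n x) \<le> Fs n x"
    and sup: "AE x in M. x \<in> P \<longrightarrow> F x \<le> (SUP k. ennreal (l k x))"
  shows "(\<integral>\<^sup>+x\<in>P. F x \<partial>M) \<le> liminf (\<lambda>n. \<integral>\<^sup>+x\<in>P. Fs n x \<partial>M)"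
proof -
  have lm[measurable]: "l k \<in> borel_measurable M" for k using l by (rule borel_measurable_integrable)
  have lsm[measurable]: "ls k n \<in> borel_measurable M" for k n using ls by (rule borel_measurable_integrable)
  note [measurable] = P F Fs
  define g where "g K x = (SUP k\<in>{..<K}. ennreal (l k x))" for K :: nat and x
  have gm[measurable]: "g K \<in> borel_measurable M" for K unfolding g_def by measurable
  have gSuc: "g (Suc K) x = max (ennreal (l K x)) (g K x)" for K x
    unfolding g_def lessThan_Suc by (simp add: sup_max)
  \<comment> \<open>The set varies in the induction, since the hypothesis is applied to the part of
    \<open>Q\<close> where the new minorant does not win.\<close>
  have step: "(\<integral>\<^sup>+x\<in>Q. g K x \<partial>M) \<le> liminf (\<lambda>n. \<integral>\<^sup>+x\<in>Q. Fs n x \<partial>M)" if "Q \<in> sets M" "Q \<subseteq> P" for Q K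
    using that
  proof (induction K arbitrary: Q)
    case 0
    have "g 0 x = 0" for x unfolding g_def by (simp add: bot_ennreal)
    then show ?case by simp
  next
    case (Suc K)
    note [measurable] = Suc.prems(1)
    \<comment> \<open>The strict inequality forces \<open>l K\<close> to be positive on
      \<open>Q1\<close>, so \<open>ennreal\<close> truncates nothing there and the integral is that
      of a real function.\<close>
    define Q1 where "Q1 = {x \<in> space M. x \<in> Q \<and> g K x < ennreal (l K x)}"
    define Q2 where "Q2 = {x \<in> space M. x \<in> Q \<and> \<not> g K x < ennreal (l K x)}"
    have Q1[measurable]: "Q1 \<in> sets M" and Q2[measurable]: "Q2 \<in> sets M" unfolding Q1_def Q2_def by measurable
    have QQ: "Q = Q1 \<union> Q2" "Q1 \<inter> Q2 = {}" using sets.sets_into_space[OF Suc.prems(1)] unfolding Q1_def Q2_def by auto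
    have sub: "Q1 \<subseteq> P" "Q2 \<subseteq> P" using Suc.prems(2) QQ by auto
    have "(\<integral>\<^sup>+x\<in>Q1. g (Suc K) x \<partial>M) = (\<integral>\<^sup>+x. ennreal (indicator Q1 x * l K x) \<partial>M)"
      by (rule nn_integral_cong) (auto simp: indicator_def gSuc Q1_def max_def)
    also have "\<dots> = ennreal (LINT x|M. indicator Q1 x * l K x)"
    proof (rule nn_integral_eq_integral[OF integrable_indicator_mult[OF l Q1]])
      have "0 \<le> l K x" if "x \<in> Q1" for x
      proof (rule ccontr)
        assume "\<not> 0 \<le> l K x"
        then have "ennreal (l K x) = 0" by (simp add: ennreal_neg)
        then show False using that unfolding Q1_def by simp
      qed
      then show "AE x in M. 0 \<le> indicator Q1 x * l K x" by (auto simp: indicator_def)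
    qed
    also have "\<dots> = liminf (\<lambda>n. ennreal (LINT x|M. indicator Q1 x * ls K n x))"
      using tendsto_ennrealI[OF conv[OF Q1 sub(1)]] by (intro lim_imp_Liminf[symmetric]) auto
    also have "\<dots> \<le> liminf (\<lambda>n. \<integral>\<^sup>+x\<in>Q1. Fs n x \<partial>M)"
    proof (rule Liminf_mono)
      show "\<forall>\<^sub>F n in sequentially. ennreal (LINT x|M. indicator Q1 x * ls K n x) \<le> (\<integral>\<^sup>+x\<in>Q1. Fs n x \<partial>M)"
        using dom[of K]
      proof eventually_elim
        case (elim n)
        have "ennreal (LINT x|M. indicator Q1 x * ls K n x) \<le> (\<integral>\<^sup>+x. ennreal (indicator Q1 x * ls K n x) \<partial>M)"
          by (rule ennreal_integral_le_nn_integral[OF integrable_indicator_mult[OF ls Q1]])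
        also have "\<dots> \<le> (\<integral>\<^sup>+x\<in>Q1. Fs n x \<partial>M)"
        proof (rule nn_integral_mono_AE)
          show "AE x in M. ennreal (indicator Q1 x * ls K n x) \<le> Fs n x * indicator Q1 x"
            using elim by eventually_elim (use sub(1) in \<open>auto simp: indicator_def\<close>)
        qed
        finally show ?case .
      qed
    qed
    finally have A1: "(\<integral>\<^sup>+x\<in>Q1. g (Suc K) x \<partial>M) \<le> liminf (\<lambda>n. \<integral>\<^sup>+x\<in>Q1. Fs n x \<partial>M)" .
    have "(\<integral>\<^sup>+x\<in>Q2. g (Suc K) x \<partial>M) = (\<integral>\<^sup>+x\<in>Q2. g K x \<partial>M)"
      by (rule nn_integral_cong) (auto simp: indicator_def gSuc Q2_def max_def)
    also have "\<dots> \<le> liminf (\<lambda>n. \<integral>\<^sup>+x\<in>Q2. Fs n x \<partial>M)" by (rule Suc.IH[OF Q2 sub(2)])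
    finally have A2: "(\<integral>\<^sup>+x\<in>Q2. g (Suc K) x \<partial>M) \<le> liminf (\<lambda>n. \<integral>\<^sup>+x\<in>Q2. Fs n x \<partial>M)" .
    have "(\<integral>\<^sup>+x\<in>Q. g (Suc K) x \<partial>M) = (\<integral>\<^sup>+x\<in>Q1. g (Suc K) x \<partial>M) + (\<integral>\<^sup>+x\<in>Q2. g (Suc K) x \<partial>M)"
      unfolding QQ(1) by (rule set_nn_integral_split[OF gm Q1 Q2 QQ(2)])
    also have "\<dots> \<le> liminf (\<lambda>n. \<integral>\<^sup>+x\<in>Q1. Fs n x \<partial>M) + liminf (\<lambda>n. \<integral>\<^sup>+x\<in>Q2. Fs n x \<partial>M)" by (rule add_mono[OF A1 A2])
    also have "\<dots> \<le> liminf (\<lambda>n. (\<integral>\<^sup>+x\<in>Q1. Fs n x \<partial>M) + (\<integral>\<^sup>+x\<in>Q2. Fs n x \<partial>M))" by (rule ennreal_liminf_superadditive)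
    also have "\<dots> = liminf (\<lambda>n. \<integral>\<^sup>+x\<in>Q. Fs n x \<partial>M)"
      unfolding QQ(1) using set_nn_integral_split[OF Fs Q1 Q2 QQ(2)] by simp
    finally show ?case .
  qed
  have mono: "incseq (\<lambda>K x. g K x * indicator P x)"
    unfolding g_def by (intro monoI le_funI mult_right_mono SUP_subset_mono) auto
  have "(\<integral>\<^sup>+x\<in>P. F x \<partial>M) \<le> (\<integral>\<^sup>+x. (SUP K. g K x * indicator P x) \<partial>M)"
  proof (rule nn_integral_mono_AE)
    show "AE x in M. F x * indicator P x \<le> (SUP K. g K x * indicator P x)"
      using sup
    proof eventually_elim
      case (elim x)
      show ?case
      proof (cases "x \<in> P")
        case True
        have "F x \<le> (SUP k. ennreal (l k x))" using elim True by simp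
        also have "\<dots> \<le> (SUP K. g K x)"
        proof (rule SUP_least)
          fix k
          have "ennreal (l k x) \<le> g (Suc k) x" unfolding gSuc by simp
          then show "ennreal (l k x) \<le> (SUP K. g K x)" by (meson SUP_upper2 UNIV_I)
        qed
        finally show ?thesis using True by simp
      qed simp
    qed
  qed
  also have "\<dots> = (SUP K. \<integral>\<^sup>+x\<in>P. g K x \<partial>M)"
    by (rule nn_integral_monotone_convergence_SUP[OF mono]) measurable
  also have "\<dots> \<le> liminf (\<lambda>n. \<integral>\<^sup>+x\<in>P. Fs n x \<partial>M)"
    by (rule SUP_least) (rule step[OF P order_refl])
  finally show ?thesis .
qed

text \<open>Sum over disjointed pieces and apply Fatou's lemma to the counting measure. Since the
  inequality is asked on every measurable subset of a piece, the given pieces may overlap.\<close>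

lemma lsc_of_countable_pieces:
  fixes F :: "'a \<Rightarrow> ennreal" and Fs :: "nat \<Rightarrow> 'a \<Rightarrow> ennreal"
  assumes F: "F \<in> borel_measurable M" and Fs: "\<And>n. Fs n \<in> borel_measurable M"
    and P: "\<And>i::nat. P i \<in> sets M" and cover: "space M \<subseteq> (\<Union>i. P i)"
    and lsc: "\<And>i Q. Q \<in> sets M \<Longrightarrow> Q \<subseteq> P i \<Longrightarrow> (\<integral>\<^sup>+x\<in>Q. F x \<partial>M) \<le> liminf (\<lambda>n. \<integral>\<^sup>+x\<in>Q. Fs n x \<partial>M)"
  shows "(\<integral>\<^sup>+x. F x \<partial>M) \<le> liminf (\<lambda>n. \<integral>\<^sup>+x. Fs n x \<partial>M)"
proof -
  let ?Q = "disjointed P"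
  have Q: "?Q i \<in> sets M" for i using sets.range_disjointed_sets[of P M] P by auto
  have UQ: "(\<Union>i. ?Q i) = space M"
  proof
    show "(\<Union>i. ?Q i) \<subseteq> space M" by (rule UN_least) (rule sets.sets_into_space[OF Q])
    show "space M \<subseteq> (\<Union>i. ?Q i)" using cover by (simp only: UN_disjointed_eq)
  qed
  have split: "(\<integral>\<^sup>+x. f x \<partial>M) = (\<integral>\<^sup>+i. (\<integral>\<^sup>+x\<in>?Q i. f x \<partial>M) \<partial>count_space UNIV)"
    if f: "f \<in> borel_measurable M" for f :: "'a \<Rightarrow> ennreal"
  proof -
    have "(\<integral>\<^sup>+x. f x \<partial>M) = (\<integral>\<^sup>+x\<in>(\<Union>i. ?Q i). f x \<partial>M)"
      unfolding UQ by (rule nn_integral_cong) simp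
    also have "\<dots> = (\<Sum>i. \<integral>\<^sup>+x\<in>?Q i. f x \<partial>M)"
      by (rule nn_integral_disjoint_family[OF f Q disjoint_family_disjointed])
    also have "\<dots> = (\<integral>\<^sup>+i. (\<integral>\<^sup>+x\<in>?Q i. f x \<partial>M) \<partial>count_space UNIV)"
      by (rule nn_integral_count_space_nat[symmetric])
    finally show ?thesis .
  qed
  have "(\<integral>\<^sup>+x. F x \<partial>M) \<le> (\<integral>\<^sup>+i. liminf (\<lambda>n. \<integral>\<^sup>+x\<in>?Q i. Fs n x \<partial>M) \<partial>count_space UNIV)"
    unfolding split[OF F] by (rule nn_integral_mono) (rule lsc[OF Q disjointed_subset])
  also have "\<dots> \<le> liminf (\<lambda>n. \<integral>\<^sup>+i. (\<integral>\<^sup>+x\<in>?Q i. Fs n x \<partial>M) \<partial>count_space UNIV)"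
    by (rule nn_integral_liminf) simp
  also have "\<dots> = liminf (\<lambda>n. \<integral>\<^sup>+x. Fs n x \<partial>M)" by (simp only: split[OF Fs])
  finally show ?thesis .
qed

text \<open>The negative part has integral at most A (b - a), so only the positive part can be
  infinite and the constant may be taken out. Afterwards only nonnegative integrands occur.\<close>

lemma lebesgue_integral_ereal_shift:
  assumes f: "f \<in> borel_measurable (lebesgue_on {a..b})" and ab: "a \<le> b" and A: "A \<ge> 0" "\<And>t. t \<in> {a..b} \<Longrightarrow> 0 \<le> f t + A"
  shows "lebesgue_integral_ereal a b f = enn2ereal (\<integral>\<^sup>+t. ennreal (f t + A) \<partial>lebesgue_on {a..b}) - ereal (A * (b - a))"
proof -
  let ?M = "lebesgue_on {a..b}"
  note [measurable] = f
  let ?p = "\<integral>\<^sup>+t. ennreal (f t) \<partial>?M" and ?n = "\<integral>\<^sup>+t. ennreal (- f t) \<partial>?M" and ?s = "\<integral>\<^sup>+t. ennreal (f t + A) \<partial>?M"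
  have M: "emeasure ?M {a..b} = ennreal (b - a)" using ab by (simp add: emeasure_restrict_space)
  have cst: "(\<integral>\<^sup>+t. ennreal A \<partial>?M) = ennreal (A * (b - a))"
    using M A(1) ab by (simp add: ennreal_mult)
  have nfin: "?n \<le> ennreal (A * (b - a))"
    unfolding cst[symmetric]
  proof (rule nn_integral_mono)
    fix t assume "t \<in> space ?M"
    then have "0 \<le> f t + A" using A(2) by simp
    then show "ennreal (- f t) \<le> ennreal A" by (intro ennreal_leI) linarith
  qed
  have "?s + ?n = (\<integral>\<^sup>+t. ennreal (f t + A) + ennreal (- f t) \<partial>?M)"
    by (rule nn_integral_add[symmetric]) measurable
  also have "\<dots> = (\<integral>\<^sup>+t. ennreal (f t) + ennreal A \<partial>?M)"
  proof (rule nn_integral_cong)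
    fix t assume "t \<in> space ?M"
    then have t: "0 \<le> f t + A" using A(2) by simp
    show "ennreal (f t + A) + ennreal (- f t) = ennreal (f t) + ennreal A"
    proof (cases "0 \<le> f t")
      case True then show ?thesis using A(1) by (simp add: ennreal_neg)
    next
      case False
      then have "ennreal (f t + A) + ennreal (- f t) = ennreal A" using t by (simp flip: ennreal_plus)
      then show ?thesis using False by (simp add: ennreal_neg)
    qed
  qed
  also have "\<dots> = ?p + ennreal (A * (b - a))"
    unfolding cst[symmetric] by (rule nn_integral_add) measurable
  finally have eq: "?s + ?n = ?p + ennreal (A * (b - a))" .
  obtain n where n: "?n = ennreal n" "n \<ge> 0" using nfin by (metis ennreal_cases ennreal_neq_top neq_top_trans)
  have k: "0 \<le> A * (b - a)" using A(1) ab by simp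
  have "enn2ereal ?s + ereal n = enn2ereal ?p + ereal (A * (b - a))"
    using arg_cong[OF eq, of enn2ereal] n k by (simp add: plus_ennreal.rep_eq enn2ereal_ennreal)
  then show ?thesis
    unfolding lebesgue_integral_ereal_def n(1) using n(2) k
    by (cases "enn2ereal ?s"; cases "enn2ereal ?p") (auto simp: enn2ereal_ennreal)
qed


section \<open>Lower semicontinuity of the action\<close>

lemma lebesgue_on_indicator_integral:
  fixes v :: "real \<Rightarrow> real"
  assumes v: "v absolutely_integrable_on {a..b}" and t: "t \<in> {a..b}"
  shows "(LINT x|lebesgue_on {a..b}. indicator {a..t} x * v x) = integral {a..t} v"
proof -
  have "(LINT x|lebesgue_on {a..b}. indicator {a..t} x * v x) = (LINT x|lebesgue. indicator {a..b} x *\<^sub>R (indicator {a..t} x * v x))"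
    by (rule integral_restrict_space) simp
  also have "\<dots> = (LINT x:{a..t}|lebesgue. v x)"
    unfolding set_lebesgue_integral_def using t by (intro Bochner_Integration.integral_cong) (auto simp: indicator_def)
  also have "\<dots> = integral {a..t} v"
    using t by (intro set_lebesgue_integral_eq_integral set_integrable_subset[OF v]) auto
  finally show ?thesis .
qed

lemma bounded_convergence_on:
  fixes f :: "'a \<Rightarrow> real" and fs :: "nat \<Rightarrow> 'a \<Rightarrow> real"
  assumes fin: "finite_measure M" and f: "f \<in> borel_measurable M" and fs: "\<And>n. fs n \<in> borel_measurable M"
    and lim: "\<And>x. x \<in> space M \<Longrightarrow> (\<lambda>n. fs n x) \<longlonglongrightarrow> f x"
    and B: "\<And>n x. x \<in> space M \<Longrightarrow> \<bar>fs n x\<bar> \<le> B" and Q: "Q \<in> sets M"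
  shows "integrable M f" "integrable M (fs n)"
    "(\<lambda>n. LINT x|M. indicator Q x * fs n x) \<longlonglongrightarrow> (LINT x|M. indicator Q x * f x)"
proof -
  interpret finite_measure M by (rule fin)
  note [measurable] = f fs Q
  have fB: "\<bar>f x\<bar> \<le> B" if "x \<in> space M" for x
    by (rule LIMSEQ_le_const2[OF tendsto_rabs[OF lim[OF that]]]) (use B[OF that] in blast)
  show "integrable M f" by (rule integrable_const_bound[of _ B]) (use fB in auto)
  show "integrable M (fs n)" by (rule integrable_const_bound[of _ B]) (use B in auto)
  show "(\<lambda>n. LINT x|M. indicator Q x * fs n x) \<longlonglongrightarrow> (LINT x|M. indicator Q x * f x)"
  proof (rule integral_dominated_convergence[where w = "\<lambda>_. \<bar>B\<bar>"])
    show "AE x in M. (\<lambda>n. indicator Q x * fs n x) \<longlonglongrightarrow> indicator Q x * f x"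
      using lim by (auto intro!: AE_I2 tendsto_mult)
    show "AE x in M. norm (indicator Q x * fs n x) \<le> \<bar>B\<bar>" for n
    proof (rule AE_I2)
      fix x assume "x \<in> space M"
      then show "norm (indicator Q x * fs n x) \<le> \<bar>B\<bar>" using B[of x n] by (auto simp: indicator_def)
    qed
  qed auto
qed

text \<open>A tent: the identity up to r/2, back to zero at r, zero beyond. With r = m/2 the
  coordinates of different arcs leaving a vertex do not interfere near it, not even those of a loop
  and its inverse.\<close>

definition short_profile :: "real \<Rightarrow> real \<Rightarrow> real" where
  "short_profile r s = max 0 (min s (r - s))"

section \<open>Convergence along a sequence with bounded actions\<close>

text \<open>The situation after passing to a subsequence whose shifted actions stay below C; the
  shift A makes the integrands nonnegative.\<close>

locale converging_curves = network_action E m H c T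
  for E :: "'a::euclidean_space arc set" and m H c T +
  fixes \<xi> :: "nat \<Rightarrow> real \<Rightarrow> 'a" and \<zeta> :: "real \<Rightarrow> 'a" and a b A C :: real
  assumes a0: "0 \<le> a" and ab: "a \<le> b" and bT: "b \<le> T"
    and \<xi>: "\<And>n. curve_in (network_points E) a b (\<xi> n)" and \<zeta>: "curve_in (network_points E) a b \<zeta>"
    and unif: "uniform_limit {a..b} (\<lambda>n \<tau>. geodesic_dist E (\<xi> n \<tau>) (\<zeta> \<tau>)) (\<lambda>_. 0) sequentially"
    and L2: "in_L2 a b (velocity \<zeta>)"
    and A0: "A \<ge> 0"
    and A: "\<And>p q t. p \<in> network_points E \<Longrightarrow> t \<in> {0..T} \<Longrightarrow> 0 \<le> overall_lagrangian E H c p q t + A"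
    and C0: "C \<ge> 0"
    and C: "\<And>n. (\<integral>\<^sup>+t. ennreal (overall_lagrangian E H c (\<xi> n t) (velocity (\<xi> n) t) t + A) \<partial>lebesgue_on {a..b}) \<le> ennreal C"
begin

abbreviation "M \<equiv> lebesgue_on {a..b}"
abbreviation "lag \<eta> t \<equiv> overall_lagrangian E H c (\<eta> t) (velocity \<eta> t) t"

lemma T_time: "t \<in> {a..b} \<Longrightarrow> t \<in> {0..T}" using a0 bT by auto

lemma curve_point: "curve_in (network_points E) a b \<eta> \<Longrightarrow> t \<in> {a..b} \<Longrightarrow> \<eta> t \<in> network_points E"
  unfolding curve_in_def by blast

lemma eventually_close:
  assumes "r > 0" "r \<le> m"
  shows "\<forall>\<^sub>F n in sequentially. \<forall>t\<in>{a..b}. close_points r (\<zeta> t) (\<xi> n t)"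
proof -
  have "r/2 > 0" using assms by simp
  from uniform_limitD[OF unif this] show ?thesis
  proof eventually_elim
    case (elim n)
    show ?case
    proof
      fix t assume t: "t \<in> {a..b}"
      then have "dist (geodesic_dist E (\<xi> n t) (\<zeta> t)) 0 < r/2" using elim by blast
      then have "geodesic_dist E (\<xi> n t) (\<zeta> t) < r/2" unfolding dist_real_def by linarith
      from geodesic_dist_less_imp_close[OF curve_point[OF \<xi> t] curve_point[OF \<zeta> t] this]
      have "close_points r (\<xi> n t) (\<zeta> t)" using assms(2) by simp
      then show "close_points r (\<zeta> t) (\<xi> n t)" by (rule close_points_sym)
    qed
  qed
qed

lemma coord_converges:
  assumes g: "\<gamma> \<in> E" and psi: "arc_profile \<gamma> K \<psi>" and t: "t \<in> {a..b}"
  shows "(\<lambda>n. arc_coord \<gamma> \<psi> (\<xi> n t)) \<longlonglongrightarrow> arc_coord \<gamma> \<psi> (\<zeta> t)"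
proof (rule LIMSEQ_I)
  fix e :: real assume e: "e > 0"
  have K: "K \<ge> 0" using psi lipschitz_on_nonneg unfolding arc_profile_def by blast
  define r where "r = min m (e / (K + 1) / 2)"
  have r: "r > 0" "r \<le> m" using e K m_pos by (auto simp: r_def)
  have "K * r \<le> K * (e / (K + 1) / 2)" using K by (intro mult_left_mono) (auto simp: r_def)
  also have "\<dots> < e" using K e by (simp add: field_simps add_nonneg_pos)
  finally have Kr: "K * r < e" .
  from eventually_close[OF r] obtain N where N: "\<forall>n\<ge>N. \<forall>t\<in>{a..b}. close_points r (\<zeta> t) (\<xi> n t)"
    unfolding eventually_sequentially by (elim exE)
  show "\<exists>N. \<forall>n\<ge>N. norm (arc_coord \<gamma> \<psi> (\<xi> n t) - arc_coord \<gamma> \<psi> (\<zeta> t)) < e"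
  proof (intro exI[of _ N] allI impI)
    fix n assume "N \<le> n"
    then have "close_points r (\<zeta> t) (\<xi> n t)" using N t by blast
    from arc_coord_close[OF g psi this] Kr
    show "norm (arc_coord \<gamma> \<psi> (\<xi> n t) - arc_coord \<gamma> \<psi> (\<zeta> t)) < e" by (simp add: abs_minus_commute)
  qed
qed

text \<open>There are countably many arcs, so one null set serves them all. Outside it the chain
  rule applies on every arc whose profile is the identity near the current parameter.\<close>

lemma velocity_tangent_ae:
  assumes \<eta>: "curve_in (network_points E) a b \<eta>" and psi: "\<forall>\<gamma>\<in>E. arc_profile \<gamma> K (\<psi> \<gamma>)"
  shows "AE t in M. \<forall>\<gamma>\<in>E. \<forall>s\<in>{0<..<arc_len \<gamma>}. \<forall>e>0. \<eta> t = arc_pt \<gamma> s \<longrightarrow>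
     (\<forall>s'\<in>{0..arc_len \<gamma>}. \<bar>s' - s\<bar> < e \<longrightarrow> \<psi> \<gamma> s' = s') \<longrightarrow>
     velocity \<eta> t \<bullet> arc_vel \<gamma> s = velocity (\<lambda>t. arc_coord \<gamma> (\<psi> \<gamma>) (\<eta> t)) t \<and>
     norm (velocity \<eta> t) = \<bar>velocity \<eta> t \<bullet> arc_vel \<gamma> s\<bar>"
proof -
  have "AE t in M. \<forall>\<gamma>\<in>E. t \<in> {a<..<b} \<and>
    ((\<lambda>t. arc_coord \<gamma> (\<psi> \<gamma>) (\<eta> t)) has_vector_derivative velocity (\<lambda>t. arc_coord \<gamma> (\<psi> \<gamma>) (\<eta> t)) t) (at t)"
    using absolutely_continuous_ae_differentiable[OF arc_coord_curve(1)[OF \<eta> ab _ bspec[OF psi]] ab] countable_arcs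
    by (simp only: AE_ball_countable) blast
  then show ?thesis
  proof eventually_elim
    case (elim t)
    show ?case
    proof (intro ballI allI impI)
      fix \<gamma> s and e :: real
      assume g: "\<gamma> \<in> E" and s: "s \<in> {0<..<arc_len \<gamma>}" and e: "e > 0" and ts: "\<eta> t = arc_pt \<gamma> s"
        and id: "\<forall>s'\<in>{0..arc_len \<gamma>}. \<bar>s' - s\<bar> < e \<longrightarrow> \<psi> \<gamma> s' = s'"
      let ?D = "velocity (\<lambda>t. arc_coord \<gamma> (\<psi> \<gamma>) (\<eta> t)) t"
      have "velocity \<eta> t = ?D *\<^sub>R arc_vel \<gamma> s"
        using elim g by (intro velocity_on_arc[OF \<eta> g bspec[OF psi g] _ s ts e]) (use id in auto)
      moreover have n: "norm (arc_vel \<gamma> s) = 1"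
        using reg[OF g] s unfolding regular_arc_def by auto
      moreover have "arc_vel \<gamma> s \<bullet> arc_vel \<gamma> s = 1" using n by (simp add: norm_eq_1)
      ultimately show "velocity \<eta> t \<bullet> arc_vel \<gamma> s = ?D \<and> norm (velocity \<eta> t) = \<bar>velocity \<eta> t \<bullet> arc_vel \<gamma> s\<bar>"
        by simp
    qed
  qed
qed

lemma long_profile_local_id:
  assumes "s' \<in> {0..arc_len \<gamma>}" "\<bar>s' - s\<bar> < 3 * arc_len \<gamma> / 4 - s"
  shows "long_profile \<gamma> s' = s'"
  by (rule long_profile_eq) (use assms in auto)

lemma velocity_long_ae:
  assumes \<eta>: "curve_in (network_points E) a b \<eta>"
  shows "AE t in M. \<forall>\<gamma>\<in>E. \<forall>s\<in>{0<..<3 * arc_len \<gamma> / 4}. \<eta> t = arc_pt \<gamma> s \<longrightarrow>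
     velocity \<eta> t \<bullet> arc_vel \<gamma> s = velocity (\<lambda>t. arc_coord \<gamma> (long_profile \<gamma>) (\<eta> t)) t \<and>
     norm (velocity \<eta> t) = \<bar>velocity \<eta> t \<bullet> arc_vel \<gamma> s\<bar>"
proof -
  have "\<forall>\<gamma>\<in>E. arc_profile \<gamma> 3 (long_profile \<gamma>)" using long_profile by blast
  from velocity_tangent_ae[OF \<eta> this] show ?thesis
  proof eventually_elim
    case (elim t)
    show ?case
    proof (intro ballI impI)
      fix \<gamma> s assume g: "\<gamma> \<in> E" and s: "s \<in> {0<..<3 * arc_len \<gamma> / 4}" and ts: "\<eta> t = arc_pt \<gamma> s"
      have s': "s \<in> {0<..<arc_len \<gamma>}" "3 * arc_len \<gamma> / 4 - s > 0" using s len_pos[OF g] by auto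
      show "velocity \<eta> t \<bullet> arc_vel \<gamma> s = velocity (\<lambda>t. arc_coord \<gamma> (long_profile \<gamma>) (\<eta> t)) t \<and>
       norm (velocity \<eta> t) = \<bar>velocity \<eta> t \<bullet> arc_vel \<gamma> s\<bar>"
        by (rule elim[rule_format, OF g s'(1) s'(2) ts]) (rule long_profile_local_id)
    qed
  qed
qed

lemma velocity_integrable: "curve_in (network_points E) a b \<eta> \<Longrightarrow> integrable M (velocity \<eta>)"
  unfolding curve_in_def using absolutely_continuous_FTC(2)[OF _ ab, of \<eta>]
  by (simp add: integrable_restrict_space set_integrable_def)

lemma lag_measurable: "curve_in (network_points E) a b \<eta> \<Longrightarrow> lag \<eta> \<in> borel_measurable M"
  by (rule lagrangian_measurable[OF _ a0 ab bT])

text \<open>Superlinearity controls the tangential component, which almost everywhere is the full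
  speed; so the bound on the actions feeds the criterion.\<close>

lemma speed_unif_integrable: "unif_integrable M (\<lambda>n t. norm (velocity (\<xi> n) t))"
proof (rule unif_integrable_superlinear[OF lebesgue_on_Icc_finite _ _ C C0])
  show "integrable M (\<lambda>t. norm (velocity (\<xi> n) t))" for n
    by (rule integrable_norm[OF velocity_integrable[OF \<xi>]])
  show "(\<lambda>t. ennreal (lag (\<xi> n) t + A)) \<in> borel_measurable M" for n
    using lag_measurable[OF \<xi>] by measurable
  fix K :: real assume "K > 0"
  then have K: "K \<ge> 0" by simp
  obtain B where B: "B \<ge> 0"
    "\<And>x q t. x \<in> vertices E \<Longrightarrow> t \<in> {0..T} \<Longrightarrow> K * norm q \<le> overall_lagrangian E H c x q t + B"
    "\<And>\<gamma> s q t. \<gamma> \<in> E \<Longrightarrow> s \<in> {0<..<arc_len \<gamma>} \<Longrightarrow> t \<in> {0..T} \<Longrightarrow>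
      K * \<bar>q \<bullet> arc_vel \<gamma> s\<bar> \<le> overall_lagrangian E H c (arc_pt \<gamma> s) q t + B"
    by (rule overall_lagrangian_superlinear[OF K]) blast
  have "AE t in M. ennreal (K * \<bar>norm (velocity (\<xi> n) t)\<bar>) \<le> ennreal (lag (\<xi> n) t + A) + ennreal B" for n
  proof -
    have "AE t in M. t \<in> {a..b}" by (rule AE_I2) simp
    with velocity_long_ae[OF \<xi>[of n]] show ?thesis
    proof eventually_elim
      case (elim t)
      have "K * norm (velocity (\<xi> n) t) \<le> lag (\<xi> n) t + B"
        using curve_point[OF \<xi>[of n] elim(2)]
      proof (cases rule: network_point_cases)
        case 1 show ?thesis by (rule B(2)[OF 1 T_time[OF elim(2)]])
      next
        case (2 \<gamma> s)
        have "s \<in> {0<..<3 * arc_len \<gamma> / 4}" using 2(2) len_pos[OF 2(1)] by auto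
        then have "norm (velocity (\<xi> n) t) = \<bar>velocity (\<xi> n) t \<bullet> arc_vel \<gamma> s\<bar>"
          by (intro elim(1)[rule_format, THEN conjunct2] 2(1,4))
        then show ?thesis using B(3)[OF 2(1,3) T_time[OF elim(2)], of "velocity (\<xi> n) t"] 2(4) by simp
      qed
      then have "K * \<bar>norm (velocity (\<xi> n) t)\<bar> \<le> (lag (\<xi> n) t + A) + B" using A0 by simp
      moreover have "0 \<le> lag (\<xi> n) t + A" by (rule A[OF curve_point[OF \<xi> elim(2)] T_time[OF elim(2)]])
      ultimately show ?case using B(1) by (simp flip: ennreal_plus add: ennreal_leI)
    qed
  qed
  then show "\<exists>B\<ge>0. \<forall>n. AE t in M. ennreal (K * \<bar>norm (velocity (\<xi> n) t)\<bar>) \<le> ennreal (lag (\<xi> n) t + A) + ennreal B"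
    using B(1) by blast
qed

text \<open>The same criterion for a constant sequence, with the square of the speed as
  \<open>G\<close>: K r \<le> r^2 + K^2.\<close>

lemma limit_speed_unif_integrable: "unif_integrable M (\<lambda>n::nat. \<lambda>t. norm (velocity \<zeta> t))"
proof -
  have int: "integrable M (\<lambda>t. (norm (velocity \<zeta> t))\<^sup>2)" using L2 unfolding in_L2_def by blast
  define C' where "C' = (LINT t|M. (norm (velocity \<zeta> t))\<^sup>2)"
  show ?thesis
  proof (rule unif_integrable_superlinear[OF lebesgue_on_Icc_finite, where G = "\<lambda>_ t. ennreal ((norm (velocity \<zeta> t))\<^sup>2)" and C = C'])
    show "integrable M (\<lambda>t. norm (velocity \<zeta> t))" for n :: nat by (rule integrable_norm[OF velocity_integrable[OF \<zeta>]])
    show "(\<lambda>t. ennreal ((norm (velocity \<zeta> t))\<^sup>2)) \<in> borel_measurable M" for n :: nat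
      using borel_measurable_integrable[OF int] by measurable
    show "(\<integral>\<^sup>+t. ennreal ((norm (velocity \<zeta> t))\<^sup>2) \<partial>M) \<le> ennreal C'" for n :: nat
      unfolding C'_def using int by (subst nn_integral_eq_integral) auto
    show "C' \<ge> 0" unfolding C'_def by simp
    fix K :: real
    have "ennreal (K * \<bar>norm v\<bar>) \<le> ennreal ((norm v)\<^sup>2) + ennreal (K\<^sup>2)" for v :: 'a
    proof -
      have "2 * (K * norm v) \<le> (norm v)\<^sup>2 + K\<^sup>2"
        using sum_squares_bound[of "norm v" K] by (simp add: mult_ac)
      moreover have "0 \<le> (norm v)\<^sup>2 + K\<^sup>2" by simp
      ultimately have "K * norm v \<le> (norm v)\<^sup>2 + K\<^sup>2" by linarith
      then show ?thesis by (simp flip: ennreal_plus add: ennreal_leI)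
    qed
    then show "\<exists>B\<ge>0. \<forall>n::nat. AE t in M. ennreal (K * \<bar>norm (velocity \<zeta> t)\<bar>) \<le> ennreal ((norm (velocity \<zeta> t))\<^sup>2) + ennreal B"
      by (intro exI[of _ "K\<^sup>2"]) auto
  qed
qed

lemma coord_velocity_integrable:
  assumes "curve_in (network_points E) a b \<eta>" "\<gamma> \<in> E" "arc_profile \<gamma> K \<psi>"
  shows "velocity (\<lambda>t. arc_coord \<gamma> \<psi> (\<eta> t)) absolutely_integrable_on {a..b}"
    "integrable M (velocity (\<lambda>t. arc_coord \<gamma> \<psi> (\<eta> t)))"
  using absolutely_continuous_FTC(2)[OF arc_coord_curve(1)[OF assms(1) ab assms(2,3)] ab]
  by (auto simp: integrable_restrict_space set_integrable_def)

text \<open>Over an initial interval the integral of a coordinate velocity is an increment of the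
  coordinate, so the limit is known there. Subtracting the limit velocity reduces the claim to a
  null limit, which uniform integrability extends to all measurable sets.\<close>

lemma coord_velocity_converges:
  assumes g: "\<gamma> \<in> E" and psi: "arc_profile \<gamma> K \<psi>" and Q: "Q \<in> sets M"
  shows "(\<lambda>n. LINT t|M. indicator Q t * velocity (\<lambda>t. arc_coord \<gamma> \<psi> (\<xi> n t)) t)
    \<longlonglongrightarrow> (LINT t|M. indicator Q t * velocity (\<lambda>t. arc_coord \<gamma> \<psi> (\<zeta> t)) t)"
proof -
  let ?W = "\<lambda>\<eta> t. arc_coord \<gamma> \<psi> (\<eta> t)"
  have K: "K \<ge> 0" using psi lipschitz_on_nonneg unfolding arc_profile_def by blast
  have ui1: "unif_integrable M (\<lambda>n. velocity (?W (\<xi> n)))"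
    by (rule unif_integrable_dominated[OF speed_unif_integrable, of _ "2 * K"])
       (use coord_velocity_integrable[OF \<xi> g psi] arc_coord_curve(2)[OF \<xi> ab g psi] K in auto)
  have ui2: "unif_integrable M (\<lambda>n::nat. velocity (?W \<zeta>))"
    by (rule unif_integrable_dominated[OF limit_speed_unif_integrable, of _ "2 * K"])
       (use coord_velocity_integrable[OF \<zeta> g psi] arc_coord_curve(2)[OF \<zeta> ab g psi] K in auto)
  let ?D = "\<lambda>n t. velocity (?W (\<xi> n)) t - velocity (?W \<zeta>) t"
  have i1: "integrable M (\<lambda>t. indicator R t * velocity (?W (\<xi> n)) t)"
    and i2: "integrable M (\<lambda>t. indicator R t * velocity (?W \<zeta>) t)" if "R \<in> sets M" for R n
    using coord_velocity_integrable(2)[OF \<xi> g psi] coord_velocity_integrable(2)[OF \<zeta> g psi] that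
    by (auto intro: integrable_indicator_mult)
  have split: "(LINT t|M. indicator R t * ?D n t) = (LINT t|M. indicator R t * velocity (?W (\<xi> n)) t) -
      (LINT t|M. indicator R t * velocity (?W \<zeta>) t)" if "R \<in> sets M" for R n
    unfolding right_diff_distrib by (rule Bochner_Integration.integral_diff[OF i1[OF that] i2[OF that]])
  have "(\<lambda>n. LINT t|M. indicator Q t * ?D n t) \<longlonglongrightarrow> 0"
  proof (rule unif_integrable_weak_null[OF ab unif_integrable_diff[OF ui1 ui2] _ Q])
    fix t assume t: "t \<in> {a..b}"
    have aa: "a \<in> {a..b}" using ab by simp
    have m: "{a..t} \<in> sets M" using t by (auto simp: sets_restrict_space_iff)
    have eq: "(LINT x|M. indicator {a..t} x * velocity (?W \<eta>) x) = ?W \<eta> t - ?W \<eta> a"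
      if "curve_in (network_points E) a b \<eta>" for \<eta>
    proof -
      have "(LINT x|M. indicator {a..t} x * velocity (?W \<eta>) x) = integral {a..t} (velocity (?W \<eta>))"
        by (rule lebesgue_on_indicator_integral[OF coord_velocity_integrable(1)[OF that g psi] t])
      also have "\<dots> = ?W \<eta> t - ?W \<eta> a"
        using absolutely_continuous_FTC(3)[OF arc_coord_curve(1)[OF that ab g psi] ab, of a t] t by simp
      finally show ?thesis .
    qed
    have "(\<lambda>n. (?W (\<xi> n) t - ?W (\<xi> n) a) - (?W \<zeta> t - ?W \<zeta> a)) \<longlonglongrightarrow> (?W \<zeta> t - ?W \<zeta> a) - (?W \<zeta> t - ?W \<zeta> a)"
      by (intro tendsto_diff coord_converges[OF g psi t] coord_converges[OF g psi aa] tendsto_const)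
    then show "(\<lambda>n. LINT x|M. indicator {a..t} x * ?D n x) \<longlonglongrightarrow> 0"
      unfolding split[OF m] eq[OF \<xi>] eq[OF \<zeta>] by simp
  qed
  then have "(\<lambda>n. (LINT t|M. indicator Q t * ?D n t) + (LINT t|M. indicator Q t * velocity (?W \<zeta>) t))
      \<longlonglongrightarrow> 0 + (LINT t|M. indicator Q t * velocity (?W \<zeta>) t)"
    by (intro tendsto_add tendsto_const)
  then show ?thesis unfolding split[OF Q] by simp
qed

lemma coord_continuous:
  assumes "curve_in (network_points E) a b \<eta>" "\<gamma> \<in> E" "arc_profile \<gamma> K \<psi>"
  shows "continuous_on {a..b} (\<lambda>t. arc_coord \<gamma> \<psi> (\<eta> t))"
  by (rule absolutely_continuous_curve_continuous[OF arc_coord_curve(1)[OF assms(1) ab assms(2,3)]])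

lemma ham_coord_converges:
  assumes g: "\<gamma> \<in> E" and psi: "arc_profile \<gamma> K \<psi>" and range: "\<And>p. arc_coord \<gamma> \<psi> p \<in> {0..arc_len \<gamma>}" and t: "t \<in> {a..b}"
  shows "(\<lambda>n. H \<gamma> (arc_coord \<gamma> \<psi> (\<xi> n t)) t \<mu>) \<longlonglongrightarrow> H \<gamma> (arc_coord \<gamma> \<psi> (\<zeta> t)) t \<mu>"
proof -
  have "(\<lambda>n. (\<lambda>(s, t, \<mu>). H \<gamma> s t \<mu>) (arc_coord \<gamma> \<psi> (\<xi> n t), t, \<mu>)) \<longlonglongrightarrow> (\<lambda>(s, t, \<mu>). H \<gamma> s t \<mu>) (arc_coord \<gamma> \<psi> (\<zeta> t), t, \<mu>)"
  proof (rule continuous_on_tendsto_compose[OF ham_cont[OF g]])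
    show "(\<lambda>n. (arc_coord \<gamma> \<psi> (\<xi> n t), t, \<mu>)) \<longlonglongrightarrow> (arc_coord \<gamma> \<psi> (\<zeta> t), t, \<mu>)"
      by (intro tendsto_Pair coord_converges[OF g psi t] tendsto_const)
  qed (use range t a0 in auto)
  then show ?thesis by simp
qed

text \<open>Allows the comparison to be made through real upper bounds, although
  \<open>ennreal\<close> cuts off negative values; if the supremum is infinite nothing has to be
  shown.\<close>

lemma ennreal_le_SUP_shift:
  assumes "\<And>z. (\<And>k. l k \<le> z) \<Longrightarrow> x \<le> z"
  shows "ennreal x \<le> (SUP k. ennreal (l (k :: nat)))"
proof (cases "(SUP k. ennreal (l k))")
  case (real z)
  have "l k \<le> z" for k
  proof -
    have "ennreal (l k) \<le> ennreal z" unfolding real(2)[symmetric] by (rule SUP_upper) simp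
    then show ?thesis using real(1) by (simp add: ennreal_le_iff)
  qed
  then show ?thesis unfolding real(2) by (intro ennreal_leI assms)
next
  case top
  show ?thesis unfolding top by (rule top_greatest)
qed

section \<open>Times at which the limit is inside an arc\<close>

text \<open>The point of \<rho> and of the bound 2/3 is uniformity: \<zeta> keeps a fixed distance
  from the start and from the range where the profile bends. Hence eventually, for all times in
  \<open>Q\<close> at once, \<xi> n lies on \<gamma> and its coordinate is the true parameter, so
  that each slope gives a minorant for \<xi> n too.\<close>

lemma lsc_interior_piece:
  assumes g: "\<gamma> \<in> E" and \<rho>: "0 < \<rho>" and Q: "Q \<in> sets M"
    and QP: "\<And>t. t \<in> Q \<Longrightarrow> \<exists>s\<in>{\<rho>..2 * arc_len \<gamma> / 3}. \<zeta> t = arc_pt \<gamma> s"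
  shows "(\<integral>\<^sup>+t\<in>Q. ennreal (lag \<zeta> t + A) \<partial>M) \<le> liminf (\<lambda>n. \<integral>\<^sup>+t\<in>Q. ennreal (lag (\<xi> n) t + A) \<partial>M)"
proof -
  let ?W = "\<lambda>\<eta> t. arc_coord \<gamma> (long_profile \<gamma>) (\<eta> t)"
  define \<mu> where "\<mu> k = from_nat_into (\<rat> :: real set) k" for k
  have \<mu>: "range \<mu> = \<rat>" unfolding \<mu>_def using range_from_nat_into[of "\<rat> :: real set"] countable_rat Rats_0 by blast
  note psi = long_profile[OF g]
  have Qab: "t \<in> {a..b}" if "t \<in> Q" for t using sets.sets_into_space[OF Q] that by auto
  have len: "0 < arc_len \<gamma>" by (rule len_pos[OF g])
  have Hm: "(\<lambda>t. A - H \<gamma> (?W \<eta> t) t \<mu>) \<in> borel_measurable M" if "curve_in (network_points E) a b \<eta>" for \<eta> \<mu>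
    by (intro continuous_interval_measurable continuous_intros ham_along_measurable[OF g a0 bT coord_continuous[OF that g psi] long_coord_range[OF g]])
  have Hconv: "integrable M (\<lambda>t. A - H \<gamma> (?W \<zeta> t) t \<mu>)" "integrable M (\<lambda>t. A - H \<gamma> (?W (\<xi> n) t) t \<mu>)"
    "R \<in> sets M \<Longrightarrow> (\<lambda>n. LINT t|M. indicator R t * (A - H \<gamma> (?W (\<xi> n) t) t \<mu>)) \<longlonglongrightarrow> (LINT t|M. indicator R t * (A - H \<gamma> (?W \<zeta> t) t \<mu>))"
    for \<mu> n R
  proof -
    obtain B where B: "\<And>\<gamma> s t \<nu>. \<gamma> \<in> E \<Longrightarrow> s \<in> {0..arc_len \<gamma>} \<Longrightarrow> t \<in> {0..T} \<Longrightarrow> \<bar>\<nu>\<bar> \<le> \<bar>\<mu>\<bar> \<Longrightarrow> \<bar>H \<gamma> s t \<nu>\<bar> \<le> B"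
      by (rule ham_bounded) blast
    have bd: "\<bar>A - H \<gamma> (?W (\<xi> n) t) t \<mu>\<bar> \<le> \<bar>A\<bar> + B" if "t \<in> space M" for n t
      using B[OF g long_coord_range[OF g] T_time, of t \<mu> "\<xi> n t"] that by simp
    have lim: "(\<lambda>n. A - H \<gamma> (?W (\<xi> n) t) t \<mu>) \<longlonglongrightarrow> A - H \<gamma> (?W \<zeta> t) t \<mu>" if "t \<in> space M" for t
      using that by (intro tendsto_diff tendsto_const ham_coord_converges[OF g psi long_coord_range[OF g]]) simp
    note bc = bounded_convergence_on[OF lebesgue_on_Icc_finite Hm[OF \<zeta>] Hm[OF \<xi>] lim bd]
    show "integrable M (\<lambda>t. A - H \<gamma> (?W \<zeta> t) t \<mu>)" "integrable M (\<lambda>t. A - H \<gamma> (?W (\<xi> n) t) t \<mu>)"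
      using bc(1,2)[OF _ _ sets.top] by auto
    show "R \<in> sets M \<Longrightarrow> (\<lambda>n. LINT t|M. indicator R t * (A - H \<gamma> (?W (\<xi> n) t) t \<mu>)) \<longlonglongrightarrow> (LINT t|M. indicator R t * (A - H \<gamma> (?W \<zeta> t) t \<mu>))"
      using bc(3) by auto
  qed
  let ?l = "\<lambda>\<eta> k t. \<mu> k * velocity (?W \<eta>) t + (A - H \<gamma> (?W \<eta> t) t (\<mu> k))"
  have vi: "integrable M (\<lambda>t. \<mu> k * velocity (?W \<eta>) t)" if "curve_in (network_points E) a b \<eta>" for \<eta> k
    using coord_velocity_integrable(2)[OF that g psi] by simp
  have li: "integrable M (?l \<zeta> k)" "integrable M (?l (\<xi> n) k)" for k n
    using vi[OF \<zeta>] vi[OF \<xi>] Hconv(1,2) by (auto intro: Bochner_Integration.integrable_add)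
  have lint: "(LINT t|M. indicator R t * ?l \<eta> k t) =
      \<mu> k * (LINT t|M. indicator R t * velocity (?W \<eta>) t) + (LINT t|M. indicator R t * (A - H \<gamma> (?W \<eta> t) t (\<mu> k)))"
    if R: "R \<in> sets M" and \<eta>: "curve_in (network_points E) a b \<eta>" and Hi: "integrable M (\<lambda>t. A - H \<gamma> (?W \<eta> t) t (\<mu> k))" for R \<eta> k
  proof -
    have "(LINT t|M. indicator R t * ?l \<eta> k t) =
      (LINT t|M. \<mu> k * (indicator R t * velocity (?W \<eta>) t) + indicator R t * (A - H \<gamma> (?W \<eta> t) t (\<mu> k)))"
      by (intro Bochner_Integration.integral_cong) (auto simp: algebra_simps)
    also have "\<dots> = (LINT t|M. \<mu> k * (indicator R t * velocity (?W \<eta>) t)) + (LINT t|M. indicator R t * (A - H \<gamma> (?W \<eta> t) t (\<mu> k)))"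
      using integrable_indicator_mult[OF coord_velocity_integrable(2)[OF \<eta> g psi] R]
      by (intro Bochner_Integration.integral_add integrable_mult_right integrable_indicator_mult[OF Hi R])
    finally show ?thesis by simp
  qed
  show ?thesis
  proof (rule lsc_of_affine_minorants[where l = "?l \<zeta>" and ls = "\<lambda>k n. ?l (\<xi> n) k", OF Q _ _ li])
    show "(\<lambda>t. ennreal (lag \<zeta> t + A)) \<in> borel_measurable M" "(\<lambda>t. ennreal (lag (\<xi> n) t + A)) \<in> borel_measurable M" for n
      using lag_measurable[OF \<zeta>] lag_measurable[OF \<xi>] by measurable
    fix k
    show "(\<lambda>n. LINT t|M. indicator R t * ?l (\<xi> n) k t) \<longlonglongrightarrow> (LINT t|M. indicator R t * ?l \<zeta> k t)" if R: "R \<in> sets M" for R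
      unfolding lint[OF R \<xi> Hconv(2)] lint[OF R \<zeta> Hconv(1)]
      by (intro tendsto_add tendsto_mult_left coord_velocity_converges[OF g psi R] Hconv(3)[OF R])
    \<comment> \<open>Smaller than \<rho>, so that \<xi> n stays off the start; smaller than 1/12 of
      the length, since 2/3 + 1/12 = 3/4 is where the profile bends; at most m, as closeness
      requires.\<close>
    define r where "r = min (min (\<rho> / 2) (arc_len \<gamma> / 24)) m"
    have r: "r > 0" "r \<le> m" "r < \<rho>" "r < arc_len \<gamma> / 12" using \<rho> len m_pos by (auto simp: r_def)
    show "\<forall>\<^sub>F n in sequentially. AE t in M. t \<in> Q \<longrightarrow> ennreal (?l (\<xi> n) k t) \<le> ennreal (lag (\<xi> n) t + A)"
      using eventually_close[OF r(1,2)]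
    proof eventually_elim
      case (elim n)
      show ?case
        using velocity_long_ae[OF \<xi>[of n]]
      proof eventually_elim
        case v: (elim t)
        show ?case
        proof
          assume t: "t \<in> Q"
          obtain s where s: "s \<in> {\<rho>..2 * arc_len \<gamma> / 3}" "\<zeta> t = arc_pt \<gamma> s" using QP[OF t] by blast
          have s1: "s \<in> {0<..<arc_len \<gamma>}" using s(1) \<rho> len by auto
          have "close_points r (arc_pt \<gamma> s) (\<xi> n t)" using elim Qab[OF t] s(2) by metis
          then obtain s' where s': "s' \<in> {0..arc_len \<gamma>}" "\<xi> n t = arc_pt \<gamma> s'" "\<bar>s' - s\<bar> \<le> r"
            using close_interior_point[OF g s1, of r "\<xi> n t"] r s(1) len by auto
          have s2: "s' \<in> {0<..<3 * arc_len \<gamma> / 4}" "s' \<in> {0<..<arc_len \<gamma>}" using s'(3) s(1) r len by auto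
          have W: "?W (\<xi> n) t = s'"
            using arc_coord_eq[OF g s'(1) psi] s'(2) long_profile_eq[of s' \<gamma>] s2(1) by simp
          have "lag (\<xi> n) t = arc_lagrangian H \<gamma> s' (velocity (\<xi> n) t \<bullet> arc_vel \<gamma> s') t"
            using overall_lagrangian_interior[OF g s2(2) T_time[OF Qab[OF t]]] s'(2) by simp
          also have "velocity (\<xi> n) t \<bullet> arc_vel \<gamma> s' = velocity (?W (\<xi> n)) t"
            by (rule v[rule_format, OF g s2(1) s'(2), THEN conjunct1])
          finally have "velocity (?W (\<xi> n)) t * \<mu> k - H \<gamma> s' t (\<mu> k) \<le> lag (\<xi> n) t"
            using arc_lagrangian_ge[OF g s'(1) T_time[OF Qab[OF t]]] by simp
          then show "ennreal (?l (\<xi> n) k t) \<le> ennreal (lag (\<xi> n) t + A)"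
            unfolding W by (intro ennreal_leI) (simp add: mult.commute)
        qed
      qed
    qed
  next
    show "AE t in M. t \<in> Q \<longrightarrow> ennreal (lag \<zeta> t + A) \<le> (SUP k. ennreal (?l \<zeta> k t))"
      using velocity_long_ae[OF \<zeta>]
    proof eventually_elim
      case (elim t)
      show ?case
      proof
        assume t: "t \<in> Q"
        obtain s where s: "s \<in> {\<rho>..2 * arc_len \<gamma> / 3}" "\<zeta> t = arc_pt \<gamma> s" using QP[OF t] by blast
        have s1: "s \<in> {0<..<arc_len \<gamma>}" "s \<in> {0..arc_len \<gamma>}" "s \<in> {0<..<3 * arc_len \<gamma> / 4}" using s(1) \<rho> len by auto
        have W: "?W \<zeta> t = s" using arc_coord_eq[OF g s1(2) psi] s(2) long_profile_eq[of s \<gamma>] s1(3) by simp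
        have v: "velocity \<zeta> t \<bullet> arc_vel \<gamma> s = velocity (?W \<zeta>) t"
          by (rule elim[rule_format, OF g s1(3) s(2), THEN conjunct1])
        have lagt: "lag \<zeta> t = (SUP \<mu>\<in>\<rat>. velocity (?W \<zeta>) t * \<mu> - H \<gamma> s t \<mu>)"
          using overall_lagrangian_interior[OF g s1(1) T_time[OF Qab[OF t]], of "velocity \<zeta> t"]
            arc_lagrangian_rats[OF g s1(2) T_time[OF Qab[OF t]], of "velocity (?W \<zeta>) t"] s(2) v by simp
        show "ennreal (lag \<zeta> t + A) \<le> (SUP k. ennreal (?l \<zeta> k t))"
        proof (rule ennreal_le_SUP_shift)
          fix z assume z: "\<And>k. ?l \<zeta> k t \<le> z"
          have "velocity (?W \<zeta>) t * \<nu> - H \<gamma> s t \<nu> \<le> z - A" if "\<nu> \<in> \<rat>" for \<nu>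
          proof -
            obtain k where k: "\<nu> = \<mu> k" using \<mu> \<open>\<nu> \<in> \<rat>\<close> by (metis imageE)
            have "\<mu> k * velocity (?W \<zeta>) t + (A - H \<gamma> s t (\<mu> k)) \<le> z" using z[of k] unfolding W .
            then show ?thesis unfolding k mult.commute[of "velocity (?W \<zeta>) t"] by linarith
          qed
          then have "lag \<zeta> t \<le> z - A" unfolding lagt by (intro cSUP_least) (use Rats_0 in auto)
          then show "lag \<zeta> t + A \<le> z" by simp
        qed
      qed
    qed
  qed
qed

section \<open>Times at which the limit is at a vertex\<close>

lemma short_profile: "\<gamma> \<in> E \<Longrightarrow> arc_profile \<gamma> 1 (short_profile (m/2))"
  unfolding arc_profile_def short_profile_def using len_pos[of \<gamma>] m_le[of \<gamma>] m_pos
  by (auto intro!: lipschitz_onI simp: dist_real_def min_def max_def)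

lemma short_coord_range:
  assumes g: "\<gamma> \<in> E" shows "arc_coord \<gamma> (short_profile (m/2)) p \<in> {0..arc_len \<gamma>}"
proof (cases "p \<in> arc_trace \<gamma>")
  case True
  then obtain s where s: "s \<in> {0..arc_len \<gamma>}" "p = arc_pt \<gamma> s" by blast
  then have "arc_coord \<gamma> (short_profile (m/2)) p = short_profile (m/2) s"
    using arc_coord_eq[OF g s(1) short_profile[OF g]] by simp
  then show ?thesis using s(1) by (auto simp: short_profile_def min_def max_def)
next
  case False then show ?thesis using len_pos[OF g] by (simp add: arc_coord_def)
qed

lemma velocity_short_ae:
  assumes \<eta>: "curve_in (network_points E) a b \<eta>"
  shows "AE t in M. \<forall>\<gamma>\<in>E. \<forall>s\<in>{0<..<m/4}. \<eta> t = arc_pt \<gamma> s \<longrightarrow>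
     velocity \<eta> t \<bullet> arc_vel \<gamma> s = velocity (\<lambda>t. arc_coord \<gamma> (short_profile (m/2)) (\<eta> t)) t"
proof -
  have "\<forall>\<gamma>\<in>E. arc_profile \<gamma> 1 (short_profile (m/2))" using short_profile by blast
  from velocity_tangent_ae[OF \<eta> this] show ?thesis
  proof eventually_elim
    case (elim t)
    show ?case
    proof (intro ballI impI)
      fix \<gamma> s assume g: "\<gamma> \<in> E" and s: "s \<in> {0<..<m/4}" and ts: "\<eta> t = arc_pt \<gamma> s"
      have s': "s \<in> {0<..<arc_len \<gamma>}" "m/4 - s > 0" using s m_le[OF g] m_pos by auto
      have "velocity \<eta> t \<bullet> arc_vel \<gamma> s = velocity (\<lambda>t. arc_coord \<gamma> (short_profile (m/2)) (\<eta> t)) t \<and>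
        norm (velocity \<eta> t) = \<bar>velocity \<eta> t \<bullet> arc_vel \<gamma> s\<bar>"
        by (rule elim[rule_format, OF g s'(1) s'(2) ts]) (auto simp: short_profile_def)
      then show "velocity \<eta> t \<bullet> arc_vel \<gamma> s = velocity (\<lambda>t. arc_coord \<gamma> (short_profile (m/2)) (\<eta> t)) t" by blast
    qed
  qed
qed

text \<open>Takes care of the arcs that do not carry the curve at a given time: their coordinates
  are zero there, so their linear terms vanish as well.\<close>

lemma short_coord_zero_ae:
  assumes \<eta>: "curve_in (network_points E) a b \<eta>"
  shows "AE t in M. \<forall>\<gamma>\<in>E. arc_coord \<gamma> (short_profile (m/2)) (\<eta> t) = 0 \<longrightarrow>
     velocity (\<lambda>t. arc_coord \<gamma> (short_profile (m/2)) (\<eta> t)) t = 0"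
  using velocity_zero_on_level_set[OF arc_coord_curve(1)[OF \<eta> ab _ short_profile] ab] countable_arcs
  by (simp only: AE_ball_countable) blast

text \<open>On the inverse arc the parameter is at least m - m/4, beyond the support of the tent;
  any other arc has at most endpoints in common with \<gamma>'.\<close>

lemma short_coord_other_arc:
  assumes g: "\<gamma> \<in> E" "\<gamma>' \<in> E" "\<gamma>' \<noteq> \<gamma>" and s: "s \<in> {0..m/4}"
  shows "arc_coord \<gamma>' (short_profile (m/2)) (arc_pt \<gamma> s) = 0"
proof -
  have s': "s \<in> {0..arc_len \<gamma>}" using s m_le[OF g(1)] m_pos by auto
  show ?thesis
  proof (cases "\<gamma> = inverse_arc \<gamma>'")
    case True
    then have s2: "s \<in> {0..arc_len \<gamma>'}" using s' by simp
    have "arc_coord \<gamma>' (short_profile (m/2)) (arc_pt \<gamma> s) = short_profile (m/2) (arc_len \<gamma>' - s)"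
      using arc_coord_inverse[OF g(2) s2 short_profile[OF g(2)]] True by simp
    also have "\<dots> = 0" using s m_le[OF g(2)] by (auto simp: short_profile_def)
    finally show ?thesis .
  next
    case False
    show ?thesis by (rule arc_coord_other[OF g(2,1) s' short_profile[OF g(2)]]) (use g(3) False in auto)
  qed
qed

text \<open>The slopes are chosen independently on all arcs leaving \<open>x\<close>, as it is
  unknown which of them carries \<xi> n. The sum in \<open>?\<phi>\<close> corrects the constant:
  the term of the carrying arc is at least c + H, which brings c + A down to A - H or less. At the
  limit all coordinates vanish, and good slopes make the correction arbitrarily small.\<close>

lemma lsc_vertex_piece:
  assumes x: "x \<in> vertices E" and Q: "Q \<in> sets M" and QP: "\<And>t. t \<in> Q \<Longrightarrow> \<zeta> t = x"
  shows "(\<integral>\<^sup>+t\<in>Q. ennreal (lag \<zeta> t + A) \<partial>M) \<le> liminf (\<lambda>n. \<integral>\<^sup>+t\<in>Q. ennreal (lag (\<xi> n) t + A) \<partial>M)"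
proof -
  let ?G = "arcs_from E x"
  have finG: "finite ?G" by (rule finite_arcs_from[OF x])
  have GE: "\<gamma> \<in> E" if "\<gamma> \<in> ?G" for \<gamma> using that unfolding arcs_from_def by blast
  let ?W = "\<lambda>\<eta> \<gamma> t. arc_coord \<gamma> (short_profile (m/2)) (\<eta> t)"
  \<comment> \<open>One rational slope per arc. Finitely many arcs leave \<open>x\<close>, so there
    are countably many such choices, and each is one minorant.\<close>
  define X where "X = (\<Pi>\<^sub>E \<gamma>\<in>?G. (\<rat> :: real set))"
  have "countable X" unfolding X_def by (intro countable_PiE finG countable_rat)
  moreover have Xne: "X \<noteq> {}" unfolding X_def by (auto simp: PiE_eq_empty_iff Rats_0)
  ultimately have rangeX: "range (from_nat_into X) = X" by (intro range_from_nat_into)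
  define \<kappa> where "\<kappa> k = from_nat_into X k" for k
  have \<kappa>: "range \<kappa> = X" unfolding \<kappa>_def using rangeX by simp
  have Qab: "t \<in> {a..b}" if "t \<in> Q" for t using sets.sets_into_space[OF Q] that by auto
  have cc: "continuous_on {a..b} (c x)" by (rule continuous_on_subset[OF flux_cont[OF x]]) (use a0 in auto)
  obtain Cx where Cx: "\<forall>x\<in>vertices E. \<forall>t\<in>{0..T}. \<bar>c x t\<bar> \<le> Cx" using flux_bound by blast
  \<comment> \<open>Taking positive parts ensures that the terms of the other arcs can only lower
    the minorant.\<close>
  let ?\<phi> = "\<lambda>\<eta> k t. c x t + A - (\<Sum>\<gamma>\<in>?G. max 0 (c x t + H \<gamma> (?W \<eta> \<gamma> t) t (\<kappa> k \<gamma>)))"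
  have \<phi>m: "?\<phi> \<eta> k \<in> borel_measurable M" if \<eta>: "curve_in (network_points E) a b \<eta>" for \<eta> k
    by (intro continuous_interval_measurable continuous_intros cc
        ham_along_measurable[OF GE a0 bT coord_continuous[OF \<eta> GE short_profile[OF GE]] short_coord_range[OF GE]])
  have \<phi>conv: "integrable M (?\<phi> \<zeta> k)" "integrable M (?\<phi> (\<xi> n) k)"
    "R \<in> sets M \<Longrightarrow> (\<lambda>n. LINT t|M. indicator R t * ?\<phi> (\<xi> n) k t) \<longlonglongrightarrow> (LINT t|M. indicator R t * ?\<phi> \<zeta> k t)"
    for k n R
  proof -
    define N where "N = (\<Sum>\<gamma>\<in>?G. \<bar>\<kappa> k \<gamma>\<bar>)"
    obtain B where B: "\<And>\<gamma> s t \<nu>. \<gamma> \<in> E \<Longrightarrow> s \<in> {0..arc_len \<gamma>} \<Longrightarrow> t \<in> {0..T} \<Longrightarrow> \<bar>\<nu>\<bar> \<le> N \<Longrightarrow> \<bar>H \<gamma> s t \<nu>\<bar> \<le> B"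
      by (rule ham_bounded) blast
    have bd: "\<bar>?\<phi> (\<xi> n) k t\<bar> \<le> Cx + A + (\<Sum>\<gamma>\<in>?G. Cx + B)" if t: "t \<in> space M" for n t
    proof -
      have t': "t \<in> {0..T}" using T_time t by simp
      have c: "\<bar>c x t\<bar> \<le> Cx" using Cx x t' by blast
      have h: "0 \<le> max 0 (c x t + H \<gamma> (?W (\<xi> n) \<gamma> t) t (\<kappa> k \<gamma>)) \<and> max 0 (c x t + H \<gamma> (?W (\<xi> n) \<gamma> t) t (\<kappa> k \<gamma>)) \<le> Cx + B" if "\<gamma> \<in> ?G" for \<gamma>
      proof -
        have "\<bar>\<kappa> k \<gamma>\<bar> \<le> N" unfolding N_def using finG that by (intro member_le_sum) auto
        from B[OF GE[OF that] short_coord_range[OF GE[OF that]] t' this, of "\<xi> n t"] c show ?thesis by auto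
      qed
      have "0 \<le> (\<Sum>\<gamma>\<in>?G. max 0 (c x t + H \<gamma> (?W (\<xi> n) \<gamma> t) t (\<kappa> k \<gamma>)))" by (rule sum_nonneg) simp
      moreover have "(\<Sum>\<gamma>\<in>?G. max 0 (c x t + H \<gamma> (?W (\<xi> n) \<gamma> t) t (\<kappa> k \<gamma>))) \<le> (\<Sum>\<gamma>\<in>?G. Cx + B)"
        by (rule sum_mono) (use h in blast)
      ultimately show ?thesis using c A0 by linarith
    qed
    have lim: "(\<lambda>n. ?\<phi> (\<xi> n) k t) \<longlonglongrightarrow> ?\<phi> \<zeta> k t" if "t \<in> space M" for t
      using that by (intro tendsto_diff tendsto_sum tendsto_max tendsto_add tendsto_const
          ham_coord_converges[OF GE short_profile[OF GE] short_coord_range[OF GE]]) auto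
    note bc = bounded_convergence_on[OF lebesgue_on_Icc_finite \<phi>m[OF \<zeta>] \<phi>m[OF \<xi>] lim bd]
    show "integrable M (?\<phi> \<zeta> k)" "integrable M (?\<phi> (\<xi> n) k)" using bc(1,2)[OF _ _ sets.top] by auto
    show "R \<in> sets M \<Longrightarrow> (\<lambda>n. LINT t|M. indicator R t * ?\<phi> (\<xi> n) k t) \<longlonglongrightarrow> (LINT t|M. indicator R t * ?\<phi> \<zeta> k t)"
      using bc(3) by auto
  qed
  let ?v = "\<lambda>\<eta> k t. \<Sum>\<gamma>\<in>?G. \<kappa> k \<gamma> * velocity (?W \<eta> \<gamma>) t"
  let ?l = "\<lambda>\<eta> k t. ?v \<eta> k t + ?\<phi> \<eta> k t"
  have vi: "integrable M (?v \<eta> k)" if "curve_in (network_points E) a b \<eta>" for \<eta> k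
    by (intro Bochner_Integration.integrable_sum integrable_mult_right coord_velocity_integrable(2)[OF that GE short_profile[OF GE]])
  have li: "integrable M (?l \<zeta> k)" "integrable M (?l (\<xi> n) k)" for k n
    by (intro Bochner_Integration.integrable_add vi \<zeta> \<xi> \<phi>conv(1,2))+
  have lint: "(LINT t|M. indicator R t * ?l \<eta> k t) =
      (\<Sum>\<gamma>\<in>?G. \<kappa> k \<gamma> * (LINT t|M. indicator R t * velocity (?W \<eta> \<gamma>) t)) + (LINT t|M. indicator R t * ?\<phi> \<eta> k t)"
    if R: "R \<in> sets M" and \<eta>: "curve_in (network_points E) a b \<eta>" and Hi: "integrable M (?\<phi> \<eta> k)" for R \<eta> k
  proof -
    have i: "integrable M (\<lambda>t. \<kappa> k \<gamma> * (indicator R t * velocity (?W \<eta> \<gamma>) t))" if "\<gamma> \<in> ?G" for \<gamma>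
      using integrable_indicator_mult[OF coord_velocity_integrable(2)[OF \<eta> GE[OF that] short_profile[OF GE[OF that]]] R]
      by (rule integrable_mult_right)
    have "(LINT t|M. indicator R t * ?l \<eta> k t) =
      (LINT t|M. (\<Sum>\<gamma>\<in>?G. \<kappa> k \<gamma> * (indicator R t * velocity (?W \<eta> \<gamma>) t)) + indicator R t * ?\<phi> \<eta> k t)"
      by (intro Bochner_Integration.integral_cong refl) (simp only: distrib_left sum_distrib_left mult.left_commute)
    also have "\<dots> = (LINT t|M. (\<Sum>\<gamma>\<in>?G. \<kappa> k \<gamma> * (indicator R t * velocity (?W \<eta> \<gamma>) t))) + (LINT t|M. indicator R t * ?\<phi> \<eta> k t)"
      by (intro Bochner_Integration.integral_add Bochner_Integration.integrable_sum i integrable_indicator_mult[OF Hi R])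
    also have "(LINT t|M. (\<Sum>\<gamma>\<in>?G. \<kappa> k \<gamma> * (indicator R t * velocity (?W \<eta> \<gamma>) t))) =
      (\<Sum>\<gamma>\<in>?G. LINT t|M. \<kappa> k \<gamma> * (indicator R t * velocity (?W \<eta> \<gamma>) t))"
      by (intro Bochner_Integration.integral_sum i)
    finally show ?thesis by simp
  qed
  show ?thesis
  proof (rule lsc_of_affine_minorants[where l = "?l \<zeta>" and ls = "\<lambda>k n. ?l (\<xi> n) k", OF Q _ _ li])
    show "(\<lambda>t. ennreal (lag \<zeta> t + A)) \<in> borel_measurable M" "(\<lambda>t. ennreal (lag (\<xi> n) t + A)) \<in> borel_measurable M" for n
      using lag_measurable[OF \<zeta>] lag_measurable[OF \<xi>] by measurable
    fix k
    show "(\<lambda>n. LINT t|M. indicator R t * ?l (\<xi> n) k t) \<longlonglongrightarrow> (LINT t|M. indicator R t * ?l \<zeta> k t)" if R: "R \<in> sets M" for R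
      unfolding lint[OF R \<xi> \<phi>conv(2)] lint[OF R \<zeta> \<phi>conv(1)]
      by (intro tendsto_add tendsto_sum tendsto_mult_left coord_velocity_converges[OF GE short_profile[OF GE] R] \<phi>conv(3)[OF R])
    \<comment> \<open>Below m/4, up to which the tent is the identity.\<close>
    define r where "r = m / 8"
    have r: "r > 0" "r \<le> m" "r < m" "r < m/4" using m_pos by (auto simp: r_def)
    show "\<forall>\<^sub>F n in sequentially. AE t in M. t \<in> Q \<longrightarrow> ennreal (?l (\<xi> n) k t) \<le> ennreal (lag (\<xi> n) t + A)"
      using eventually_close[OF r(1,2)]
    proof eventually_elim
      case (elim n)
      show ?case
        using velocity_short_ae[OF \<xi>[of n]] short_coord_zero_ae[OF \<xi>[of n]]
      proof eventually_elim
        case v: (elim t)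
        show ?case
        proof
          assume t: "t \<in> Q"
          note tT = T_time[OF Qab[OF t]]
          have "close_points r x (\<xi> n t)" using elim Qab[OF t] QP[OF t] by metis
          from close_vertex[OF x r(3) this]
          obtain \<gamma> s where g: "\<gamma> \<in> ?G" and s: "s \<in> {0..arc_len \<gamma>}" "\<xi> n t = arc_pt \<gamma> s" "s \<le> r" by blast
          have others: "velocity (?W (\<xi> n) \<gamma>') t = 0" if "\<gamma>' \<in> ?G - {\<gamma>}" for \<gamma>'
          proof -
            have "?W (\<xi> n) \<gamma>' t = 0"
              unfolding s(2) by (rule short_coord_other_arc) (use that GE g s r in auto)
            then show ?thesis using v(2) GE that by blast
          qed
          have vs: "?v (\<xi> n) k t = \<kappa> k \<gamma> * velocity (?W (\<xi> n) \<gamma>) t"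
            using sum.remove[OF finG g, of "\<lambda>\<gamma>. \<kappa> k \<gamma> * velocity (?W (\<xi> n) \<gamma>) t"] others by simp
          let ?S = "\<Sum>\<gamma>\<in>?G. max 0 (c x t + H \<gamma> (?W (\<xi> n) \<gamma> t) t (\<kappa> k \<gamma>))"
          have "?v (\<xi> n) k t + c x t - ?S \<le> lag (\<xi> n) t"
          proof (cases "s = 0")
            \<comment> \<open>At the vertex itself the Lagrangian is at least \<open>c x t\<close>
              for any velocity, the coordinate velocity is zero, and the correction has the right
              sign.\<close>
            case True
            then have tx: "\<xi> n t = x" using s(2) g unfolding arcs_from_def by simp
            have "?W (\<xi> n) \<gamma> t = 0"
              unfolding tx by (rule arc_coord_vertex[OF GE[OF g] x short_profile[OF GE[OF g]]])
            then have "velocity (?W (\<xi> n) \<gamma>) t = 0" using v(2) GE[OF g] by blast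
            moreover have "0 \<le> ?S" by (rule sum_nonneg) simp
            moreover have "c x t \<le> lag (\<xi> n) t"
              unfolding tx overall_lagrangian_vertex[OF x] by simp
            ultimately show ?thesis using vs by simp
          next
            case False
            then have s1: "s \<in> {0<..<m/4}" "s \<in> {0<..<arc_len \<gamma>}"
              using s r m_le[OF GE[OF g]] by auto
            have W: "?W (\<xi> n) \<gamma> t = s"
              unfolding s(2) using arc_coord_eq[OF GE[OF g] s(1) short_profile[OF GE[OF g]]] s1(1)
              by (simp add: short_profile_def)
            have "lag (\<xi> n) t = arc_lagrangian H \<gamma> s (velocity (\<xi> n) t \<bullet> arc_vel \<gamma> s) t"
              using overall_lagrangian_interior[OF GE[OF g] s1(2) tT] s(2) by simp
            also have "velocity (\<xi> n) t \<bullet> arc_vel \<gamma> s = velocity (?W (\<xi> n) \<gamma>) t"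
              by (rule v(1)[rule_format, OF GE[OF g] s1(1) s(2)])
            finally have 1: "velocity (?W (\<xi> n) \<gamma>) t * \<kappa> k \<gamma> - H \<gamma> s t (\<kappa> k \<gamma>) \<le> lag (\<xi> n) t"
              using arc_lagrangian_ge[OF GE[OF g] s(1) tT] by simp
            have "max 0 (c x t + H \<gamma> (?W (\<xi> n) \<gamma> t) t (\<kappa> k \<gamma>)) \<le> ?S"
              by (rule member_le_sum[OF g _ finG]) simp
            then have "c x t + H \<gamma> s t (\<kappa> k \<gamma>) \<le> ?S" unfolding W by simp
            then show ?thesis using 1 vs mult.commute[of "\<kappa> k \<gamma>"] by simp
          qed
          then show "ennreal (?l (\<xi> n) k t) \<le> ennreal (lag (\<xi> n) t + A)"
            by (intro ennreal_leI) linarith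
        qed
      qed
    qed
  next
    have ac: "absolutely_continuous_curve a b \<zeta>" using \<zeta> unfolding curve_in_def by blast
    show "AE t in M. t \<in> Q \<longrightarrow> ennreal (lag \<zeta> t + A) \<le> (SUP k. ennreal (?l \<zeta> k t))"
      using short_coord_zero_ae[OF \<zeta>] velocity_zero_on_level_set[OF ac ab, of x]
    proof eventually_elim
      case (elim t)
      show ?case
      proof
        assume t: "t \<in> Q"
        have tx: "\<zeta> t = x" by (rule QP[OF t])
        have tT: "t \<in> {0..T}" by (rule T_time[OF Qab[OF t]])
        have "velocity \<zeta> t = 0" using elim(2) tx by blast
        then have lagt: "lag \<zeta> t = c x t" using tx overall_lagrangian_vertex[OF x] by simp
        have W: "?W \<zeta> \<gamma> t = 0" if "\<gamma> \<in> ?G" for \<gamma>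
          unfolding tx by (rule arc_coord_vertex[OF GE[OF that] x short_profile[OF GE[OF that]]])
        have v0: "?v \<zeta> k t = 0" for k
          using W elim(1) GE by (intro sum.neutral) simp
        show "ennreal (lag \<zeta> t + A) \<le> (SUP k. ennreal (?l \<zeta> k t))"
        proof (rule ennreal_le_SUP_shift)
          fix z assume z: "\<And>k. ?l \<zeta> k t \<le> z"
          have "c x t + A \<le> z"
          proof (rule field_le_epsilon)
            fix e :: real assume e: "e > 0"
            \<comment> \<open>An allowance of d for each arc keeps the whole correction within
              e.\<close>
            define d where "d = e / (real (card ?G) + 1)"
            have d: "d > 0" using e by (simp add: d_def)
            have "\<exists>\<mu>\<in>\<rat>. c x t + H \<gamma> 0 t \<mu> \<le> d" if g: "\<gamma> \<in> ?G" for \<gamma>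
            proof -
              have 0: "0 \<in> {0..arc_len \<gamma>}" using len_pos[OF GE[OF g]] by simp
              \<comment> \<open>The flux limiter bound enters here; the gap d makes the inequality
                strict, so that some rational slope achieves it.\<close>
              have "c x t - d < arc_lagrangian H \<gamma> 0 0 t" using c_le_lagrangian[OF x g, of t] tT d by simp
              also have "\<dots> = (SUP \<mu>\<in>\<rat>. 0 * \<mu> - H \<gamma> 0 t \<mu>)" by (rule arc_lagrangian_rats[OF GE[OF g] 0 tT])
              finally have lt: "c x t - d < (SUP \<mu>\<in>\<rat>. 0 * \<mu> - H \<gamma> 0 t \<mu>)" .
              have "\<exists>y\<in>(\<lambda>\<mu>. 0 * \<mu> - H \<gamma> 0 t \<mu>) ` \<rat>. c x t - d < y"
                by (rule less_cSupD[OF _ lt, unfolded Bex_def[symmetric]]) (use Rats_0 in auto)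
              then obtain \<mu> where "\<mu> \<in> \<rat>" "c x t - d < 0 * \<mu> - H \<gamma> 0 t \<mu>" by blast
              then show ?thesis by (intro bexI[of _ \<mu>]) auto
            qed
            then have "\<forall>\<gamma>\<in>?G. \<exists>\<mu>. \<mu> \<in> \<rat> \<and> c x t + H \<gamma> 0 t \<mu> \<le> d" by blast
            from bchoice[OF this] obtain f where f: "\<forall>\<gamma>\<in>?G. f \<gamma> \<in> \<rat> \<and> c x t + H \<gamma> 0 t (f \<gamma>) \<le> d" by blast
            have "restrict f ?G \<in> X" unfolding X_def using f by auto
            then obtain k where k: "\<kappa> k = restrict f ?G" using \<kappa> by (metis imageE)
            have "(\<Sum>\<gamma>\<in>?G. max 0 (c x t + H \<gamma> (?W \<zeta> \<gamma> t) t (\<kappa> k \<gamma>))) \<le> (\<Sum>\<gamma>\<in>?G. d)"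
            proof (rule sum_mono)
              fix \<gamma> assume g: "\<gamma> \<in> ?G"
              then show "max 0 (c x t + H \<gamma> (?W \<zeta> \<gamma> t) t (\<kappa> k \<gamma>)) \<le> d"
                unfolding W[OF g] k using f d by simp
            qed
            also have "\<dots> = real (card ?G) * d" by simp
            also have "\<dots> \<le> e" using e by (simp add: d_def field_simps)
            finally show "c x t + A \<le> z + e" using z[of k] v0[of k] by linarith
          qed
          then show "lag \<zeta> t + A \<le> z" unfolding lagt .
        qed
      qed
    qed
  qed
qed

section \<open>Countable cover of the time interval\<close>

text \<open>At every time \<zeta> is at a vertex or, up to reversal, on an arc between the fractions
  1/(j + 2) and 2/3 of its length for some j. These are countably many closed sets of times, and on
  each of them one of the two local results applies.\<close>

lemma lsc_bounded_actions:
  "(\<integral>\<^sup>+t. ennreal (lag \<zeta> t + A) \<partial>M) \<le> liminf (\<lambda>n. \<integral>\<^sup>+t. ennreal (lag (\<xi> n) t + A) \<partial>M)"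
proof -
  have ac: "absolutely_continuous_curve a b \<zeta>" using \<zeta> unfolding curve_in_def by blast
  note cont = absolutely_continuous_curve_continuous[OF ac]
  let ?Pv = "\<lambda>x. {a..b} \<inter> \<zeta> -` {x}"
  \<comment> \<open>The 2 in j + 2 avoids division by zero and keeps the lower fraction below
    2/3.\<close>
  let ?Pe = "\<lambda>(\<gamma>, j::nat). {a..b} \<inter> \<zeta> -` (arc_pt \<gamma> ` {arc_len \<gamma> / real (j + 2)..2 * arc_len \<gamma> / 3})"
  \<comment> \<open>The empty set is inserted to make the family nonempty, as its enumeration
    requires.\<close>
  define \<P> where "\<P> = insert {} (?Pv ` vertices E \<union> ?Pe ` (E \<times> UNIV))"
  have "vertices E = (\<lambda>\<gamma>. arc_pt \<gamma> 0) ` E" using vertices_eq by blast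
  then have "countable (vertices E)" using countable_arcs by simp
  then have cP: "countable \<P>" unfolding \<P>_def using countable_arcs by simp
  have rP: "range (from_nat_into \<P>) = \<P>" by (rule range_from_nat_into[OF _ cP]) (simp add: \<P>_def)
  have PiP: "from_nat_into \<P> i \<in> \<P>" for i using rP by blast
  have closedset: "{a..b} \<inter> \<zeta> -` D \<in> sets M" if "closed D" for D
  proof -
    have "closed ({a..b} \<inter> \<zeta> -` D)" by (rule continuous_closed_preimage[OF cont _ that]) auto
    then show ?thesis by (simp add: sets_restrict_space_iff borel_closed)
  qed
  have Pcases: "P = {} \<or> (\<exists>x\<in>vertices E. P = ?Pv x) \<or> (\<exists>\<gamma>\<in>E. \<exists>j. P = ?Pe (\<gamma>, j))" if "P \<in> \<P>" for P
    using that unfolding \<P>_def by blast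
  have meas: "P \<in> sets M" if P: "P \<in> \<P>" for P
  proof -
    from P consider "P = {}" | x where "P = ?Pv x" | \<gamma> j where "\<gamma> \<in> E" "P = ?Pe (\<gamma>, j)"
      unfolding \<P>_def by blast
    then show ?thesis
    proof cases
      case 1 then show ?thesis by simp
    next
      case 2 then show ?thesis using closedset by blast
    next
      case (3 \<gamma> j)
      have sub: "{arc_len \<gamma> / real (j + 2)..2 * arc_len \<gamma> / 3} \<subseteq> {0..arc_len \<gamma>}" using len_pos[OF 3(1)] by auto
      have "compact (arc_pt \<gamma> ` {arc_len \<gamma> / real (j + 2)..2 * arc_len \<gamma> / 3})"
        by (intro compact_continuous_image continuous_on_subset[OF arc_continuous[OF 3(1)] sub]) simp
      then show ?thesis unfolding 3(2) prod.case by (intro closedset compact_imp_closed)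
    qed
  qed
  show ?thesis
  proof (rule lsc_of_countable_pieces[where P = "from_nat_into \<P>"])
    show "(\<lambda>t. ennreal (lag \<zeta> t + A)) \<in> borel_measurable M" "(\<lambda>t. ennreal (lag (\<xi> n) t + A)) \<in> borel_measurable M" for n
      using lag_measurable[OF \<zeta>] lag_measurable[OF \<xi>] by measurable
    show "from_nat_into \<P> i \<in> sets M" for i by (rule meas[OF PiP])
    show "space M \<subseteq> (\<Union>i. from_nat_into \<P> i)"
    proof
      fix t assume "t \<in> space M"
      then have t: "t \<in> {a..b}" by simp
      have "\<exists>P\<in>\<P>. t \<in> P"
        using curve_point[OF \<zeta> t]
      proof (cases rule: network_point_cases)
        case 1
        then show ?thesis using t unfolding \<P>_def by (intro bexI[of _ "?Pv (\<zeta> t)"]) auto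
      next
        case (2 \<gamma> s)
        have len: "0 < arc_len \<gamma>" by (rule len_pos[OF 2(1)])
        obtain j :: nat where "arc_len \<gamma> / s \<le> real j" using real_arch_simple by blast
        then have "arc_len \<gamma> / s \<le> real (j + 2)" by simp
        then have "arc_len \<gamma> / real (j + 2) \<le> s" using 2(3) by (simp add: field_simps)
        then have "\<zeta> t \<in> arc_pt \<gamma> ` {arc_len \<gamma> / real (j + 2)..2 * arc_len \<gamma> / 3}" using 2(2,4) by auto
        then have tP: "t \<in> ?Pe (\<gamma>, j)" using t by simp
        have "?Pe (\<gamma>, j) \<in> \<P>" unfolding \<P>_def using 2(1) by blast
        then show ?thesis by (rule bexI[where x = "?Pe (\<gamma>, j)", rotated]) (rule tP)
      qed
      then show "t \<in> (\<Union>i. from_nat_into \<P> i)" using rP by blast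
    qed
    fix i Q assume Q: "Q \<in> sets M" and sub: "Q \<subseteq> from_nat_into \<P> i"
    from Pcases[OF PiP[of i]] consider "from_nat_into \<P> i = {}" | x where "x \<in> vertices E" "from_nat_into \<P> i = ?Pv x"
      | \<gamma> j where "\<gamma> \<in> E" "from_nat_into \<P> i = ?Pe (\<gamma>, j)"
      by (elim disjE bexE exE) blast+
    then show "(\<integral>\<^sup>+t\<in>Q. ennreal (lag \<zeta> t + A) \<partial>M) \<le> liminf (\<lambda>n. \<integral>\<^sup>+t\<in>Q. ennreal (lag (\<xi> n) t + A) \<partial>M)"
    proof cases
      case 1 then show ?thesis using sub by simp
    next
      case (2 x)
      show ?thesis by (rule lsc_vertex_piece[OF 2(1) Q]) (use sub 2(2) in auto)
    next
      case (3 \<gamma> j)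
      have pos: "0 < arc_len \<gamma> / real (j + 2)" using len_pos[OF 3(1)] by simp
      show ?thesis
      proof (rule lsc_interior_piece[OF 3(1) pos Q])
        fix t assume "t \<in> Q"
        then have "t \<in> ?Pe (\<gamma>, j)" using sub 3(2) by blast
        then show "\<exists>s\<in>{arc_len \<gamma> / real (j + 2)..2 * arc_len \<gamma> / 3}. \<zeta> t = arc_pt \<gamma> s" by auto
      qed
    qed
  qed
qed

end


section \<open>Reduction to bounded actions\<close>

theorem theorem3p4:
  fixes E :: "(real ^ 'n) arc set"
    and H :: "(real ^ 'n) hamiltonian"
    and c :: "real ^ 'n \<Rightarrow> real \<Rightarrow> real"
    and t\<^sub>1 t\<^sub>2 :: real
    and \<xi> :: "nat \<Rightarrow> real \<Rightarrow> real ^ 'n"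
    and \<zeta> :: "real \<Rightarrow> real ^ 'n"
  assumes "network E"
    and "network_hamiltonian E H"
    and "flux_limiter E H c"
    and "0 \<le> t\<^sub>1" and "t\<^sub>1 \<le> t\<^sub>2"
    and "\<And>n. curve_in (network_points E) t\<^sub>1 t\<^sub>2 (\<xi> n)"
    and "curve_in (network_points E) t\<^sub>1 t\<^sub>2 \<zeta>"
    and "uniform_limit {t\<^sub>1..t\<^sub>2} (\<lambda>n \<tau>. geodesic_dist E (\<xi> n \<tau>) (\<zeta> \<tau>)) (\<lambda>_. 0) sequentially"
    and "weakly_converges_L2 t\<^sub>1 t\<^sub>2 (\<lambda>n. velocity (\<xi> n)) (velocity \<zeta>)"
  shows "liminf (\<lambda>n. lebesgue_integral_ereal t\<^sub>1 t\<^sub>2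
             (\<lambda>\<tau>. overall_lagrangian E H c (\<xi> n \<tau>) (velocity (\<xi> n) \<tau>) \<tau>))
         \<ge> lebesgue_integral_ereal t\<^sub>1 t\<^sub>2
             (\<lambda>\<tau>. overall_lagrangian E H c (\<zeta> \<tau>) (velocity \<zeta> \<tau>) \<tau>)"
proof -
  have "\<exists>m>0. \<forall>\<gamma>\<in>E. m \<le> arc_len \<gamma>"
    using assms(1) unfolding network_def by (elim conjE)
  then obtain m where m: "m > 0" "\<And>\<gamma>. \<gamma> \<in> E \<Longrightarrow> m \<le> arc_len \<gamma>" by blast
  \<comment> \<open>The growth bounds are given for T > 0, whereas \<open>t\<^sub>2\<close> may be
    0.\<close>
  define T where "T = t\<^sub>2 + 1"
  have TT: "T > 0" "t\<^sub>2 \<le> T" using assms(4,5) by (auto simp: T_def)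
  interpret network_action E m H c T
    by unfold_locales (use assms(1-3) m TT in auto)
  let ?M = "lebesgue_on {t\<^sub>1..t\<^sub>2}"
  let ?lag = "\<lambda>\<eta> t. overall_lagrangian E H c (\<eta> t) (velocity \<eta> t) t"
  obtain A where A: "A \<ge> 0"
    "\<And>p q t. p \<in> network_points E \<Longrightarrow> t \<in> {0..T} \<Longrightarrow> 0 \<le> overall_lagrangian E H c p q t + A"
    by (rule overall_lagrangian_lower) blast
  define I where "I \<eta> = (\<integral>\<^sup>+t. ennreal (?lag \<eta> t + A) \<partial>?M)" for \<eta>
  have shift: "lebesgue_integral_ereal t\<^sub>1 t\<^sub>2 (?lag \<eta>) = enn2ereal (I \<eta>) - ereal (A * (t\<^sub>2 - t\<^sub>1))"
    if \<eta>: "curve_in (network_points E) t\<^sub>1 t\<^sub>2 \<eta>" for \<eta>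
    unfolding I_def
  proof (rule lebesgue_integral_ereal_shift[OF lagrangian_measurable[OF \<eta> assms(4,5) TT(2)] assms(5) A(1)])
    fix t assume t: "t \<in> {t\<^sub>1..t\<^sub>2}"
    then have "\<eta> t \<in> network_points E" using \<eta> unfolding curve_in_def by blast
    moreover have "t \<in> {0..T}" using t assms(4) TT(2) by auto
    ultimately show "0 \<le> ?lag \<eta> t + A" by (rule A(2))
  qed
  have main: "I \<zeta> \<le> liminf (\<lambda>n. I (\<xi> n))"
  proof (rule ccontr)
    assume "\<not> ?thesis"
    \<comment> \<open>A level strictly between the two sides is finite even if the action of \<zeta>
      is not. Infinitely many of the actions lie below it, which supplies the subsequence with
      bounded actions.\<close>
    then obtain C' where C': "liminf (\<lambda>n. I (\<xi> n)) < C'" "C' < I \<zeta>" using dense not_le by metis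
    then have "C' < top" using less_le_trans top_greatest by blast
    then obtain C where C: "C' = ennreal C" "C \<ge> 0" by (cases C') auto
    have "infinite {n. I (\<xi> n) \<le> C'}"
    proof
      assume "finite {n. I (\<xi> n) \<le> C'}"
      then obtain N where "\<forall>n\<in>{n. I (\<xi> n) \<le> C'}. n < N" by (auto simp: finite_nat_set_iff_bounded)
      then have "\<forall>\<^sub>F n in sequentially. C' \<le> I (\<xi> n)"
        unfolding eventually_sequentially by (intro exI[of _ N]) (metis leD linear mem_Collect_eq)
      then have "C' \<le> liminf (\<lambda>n. I (\<xi> n))" by (rule Liminf_bounded)
      then show False using C'(1) by simp
    qed
    then obtain r :: "nat \<Rightarrow> nat" where r: "strict_mono r" "\<And>n. r n \<in> {n. I (\<xi> n) \<le> C'}"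
      using infinite_enumerate by blast
    have "filterlim (\<lambda>n \<tau>. geodesic_dist E (\<xi> (r n) \<tau>) (\<zeta> \<tau>)) (uniformly_on {t\<^sub>1..t\<^sub>2} (\<lambda>_. 0)) sequentially"
      by (rule filterlim_compose[OF assms(8) filterlim_subseq[OF r(1)]])
    then interpret converging_curves E m H c T "\<lambda>n. \<xi> (r n)" \<zeta> t\<^sub>1 t\<^sub>2 A C
      using assms(4-7) TT(2) A C(2) r(2) assms(9) C(1)
      by unfold_locales (auto simp: I_def weakly_converges_L2_def)
    have "I \<zeta> \<le> liminf (\<lambda>n. I (\<xi> (r n)))" using lsc_bounded_actions unfolding I_def .
    also have "\<dots> \<le> liminf (\<lambda>n. C')" by (rule Liminf_mono) (use r(2) in simp)
    also have "\<dots> = C'" by (simp add: Liminf_const)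
    finally show False using C'(2) by simp
  qed
  \<comment> \<open>Return to extended reals by testing with levels y: negative ones are trivial,
    the others correspond to elements of \<open>ennreal\<close>.\<close>
  have "enn2ereal (I \<zeta>) \<le> liminf (\<lambda>n. enn2ereal (I (\<xi> n)))"
    unfolding le_Liminf_iff
  proof (intro allI impI)
    fix y assume y: "y < enn2ereal (I \<zeta>)"
    show "\<forall>\<^sub>F n in sequentially. y < enn2ereal (I (\<xi> n))"
    proof (cases "y < 0")
      case True
      then show ?thesis by (intro always_eventually allI) (rule less_le_trans[OF _ enn2ereal_nonneg])
    next
      case False
      then have y0: "enn2ereal (e2ennreal y) = y" by (simp add: enn2ereal_e2ennreal)
      then have "e2ennreal y < I \<zeta>" using y by (simp add: less_ennreal.rep_eq)
      then have "\<forall>\<^sub>F n in sequentially. e2ennreal y < I (\<xi> n)" using main unfolding le_Liminf_iff by blast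
      then show ?thesis by eventually_elim (use y0 in \<open>simp add: less_ennreal.rep_eq\<close>)
    qed
  qed
  then have "enn2ereal (I \<zeta>) + (- ereal (A * (t\<^sub>2 - t\<^sub>1))) \<le> liminf (\<lambda>n. enn2ereal (I (\<xi> n))) + (- ereal (A * (t\<^sub>2 - t\<^sub>1)))"
    by (rule add_right_mono)
  also have "\<dots> = liminf (\<lambda>n. enn2ereal (I (\<xi> n)) + (- ereal (A * (t\<^sub>2 - t\<^sub>1))))"
    by (rule Liminf_add_ereal_right[symmetric]) auto
  finally show ?thesis
    unfolding shift[OF assms(6)] shift[OF assms(7)] minus_ereal_def .
qed

end
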